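(* Let $d\ge 1$, let $\Omega\subset\mathbb{R}^d$ be a Borel set with $|\Omega|=1$, and let $A\subset\mathbb{R}^d$ be a countable set. Let $\mathcal{L}=L^2(\Omega,PW_\Omega(\mathbb{R}^d))$ be the Hilbert space of (a.e. classes of) measurable functions $F:\Omega\to PW_\Omega(\mathbb{R}^d)$ with $\|F\|_{\mathcal{L}}^2:=\int_\Omega\|F(\alpha)\|_{L^2(\mathbb{R}^d)}^2\,d\alpha<\infty$. Let $u\in PW_\Omega(\mathbb{R}^d)$ be such that $\hat u$ is nowhere zero on $\Omega$. Then $\{T_au\}_{a\in A}$ is an orthonormal basis for $PW_\Omega(\mathbb{R}^d)$ if and only if the vector-valued Gabor system $\mathcal{G}(A,\Omega,u)=\{G_{a,b}: a,b\in A\}$, where $G_{a,b}:\Omega\to PW_\Omega(\mathbb{R}^d)$, $G_{a,b}(\alpha)=e_b(\alpha)\,T_au$, is an orthonormal basis for $\mathcal{L}$.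
   Context: Functions are complex-valued. The Fourier transform is $\hat u(\xi)=\int_{\mathbb{R}^d} e^{-2\pi i x\cdot\xi}u(x)\,dx$ (extended to $L^2(\mathbb{R}^d)$). The Paley-Wiener space is $PW_\Omega(\mathbb{R}^d)=\{f\in L^2(\mathbb{R}^d):\hat f(\xi)=0\text{ for a.e. }\xi\in\Omega^c\}$, a closed subspace of $L^2(\mathbb{R}^d)$. $T_a$ denotes translation, $T_au(x)=u(x-a)$, and $e_b(\alpha)=e^{-2\pi i\langle\alpha,b\rangle}$ for $\alpha\in\Omega$. "$\hat u$ is nowhere zero on $\Omega$" means $\hat u(\xi)\ne0$ for (almost) every $\xi\in\Omega$. The inner product of $\mathcal{L}$ is $\langle F,G\rangle_{\mathcal{L}}=\int_\Omega\langle F(\alpha),G(\alpha)\rangle_{L^2(\mathbb{R}^d)}\,d\alpha$. *)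

theory Defs
  imports "HOL-Analysis.Analysis" "HOL-Library.Function_Algebras"
begin

text \<open>
  Elements of the \<open>L\<^sup>2\<close> spaces below are represented by Borel functions, not by classes modulo
  null sets. Every notion in this theory depends on its arguments only through their classes:
  inner products and distances are integrals, and the Fourier transform is only used almost
  everywhere.
\<close>

section \<open>Orthonormal bases\<close>

definition ip_norm :: "('v \<Rightarrow> 'v \<Rightarrow> complex) \<Rightarrow> 'v \<Rightarrow> real" where
  "ip_norm ip f = sqrt (Re (ip f f))"

text \<open>
  \<open>H\<close> is (the set of representatives of) a Hilbert space with scalar multiplication \<open>sm\<close> and
  inner product \<open>ip\<close>. The indexed family \<open>(e i)\<close> is an orthonormal basis if it is orthonormal in
  \<open>H\<close> and its closed linear span is \<open>H\<close>.
\<close>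

definition orthonormal_basis ::
  "'v::ab_group_add set \<Rightarrow> (complex \<Rightarrow> 'v \<Rightarrow> 'v) \<Rightarrow> ('v \<Rightarrow> 'v \<Rightarrow> complex) \<Rightarrow> 'i set \<Rightarrow> ('i \<Rightarrow> 'v) \<Rightarrow> bool"
  where
  "orthonormal_basis H sm ip I e \<longleftrightarrow>
     (\<forall>i\<in>I. e i \<in> H) \<and>
     (\<forall>i\<in>I. \<forall>j\<in>I. ip (e i) (e j) = (if i = j then 1 else 0)) \<and>
     (\<forall>f\<in>H. \<forall>\<epsilon>>0. \<exists>J c. finite J \<and> J \<subseteq> I \<and> ip_norm ip (f - (\<Sum>i\<in>J. sm (c i) (e i))) < \<epsilon>)"

section \<open>Square-integrable functions and the Fourier transform\<close>

definition L2 :: "(real^'n \<Rightarrow> complex) set" where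
  "L2 = {f \<in> borel_measurable lborel. integrable lborel (\<lambda>x. (norm (f x))\<^sup>2)}"

definition L2_inner :: "(real^'n \<Rightarrow> complex) \<Rightarrow> (real^'n \<Rightarrow> complex) \<Rightarrow> complex" where
  "L2_inner f g = (LINT x|lborel. f x * cnj (g x))"

abbreviation L2_norm :: "(real^'n \<Rightarrow> complex) \<Rightarrow> real" where
  "L2_norm \<equiv> ip_norm L2_inner"

definition L2_scale :: "complex \<Rightarrow> (real^'n \<Rightarrow> complex) \<Rightarrow> (real^'n \<Rightarrow> complex)" where
  "L2_scale c f = (\<lambda>x. c * f x)"

definition L2_tendsto :: "(nat \<Rightarrow> real^'n \<Rightarrow> complex) \<Rightarrow> (real^'n \<Rightarrow> complex) \<Rightarrow> bool" where
  "L2_tendsto \<phi> f \<longleftrightarrow> (\<forall>n. \<phi> n \<in> L2) \<and> f \<in> L2 \<and> (\<lambda>n. L2_norm (\<phi> n - f)) \<longlonglongrightarrow> 0"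

definition character :: "real^'n \<Rightarrow> real^'n \<Rightarrow> complex" where
  "character b \<alpha> = exp (- (2 * of_real pi * \<i> * of_real (\<alpha> \<bullet> b)))"

definition fourier_L1 :: "(real^'n \<Rightarrow> complex) \<Rightarrow> real^'n \<Rightarrow> complex" where
  "fourier_L1 u \<xi> = (LINT x|lborel. character \<xi> x * u x)"

text \<open>
  The transform on \<open>L\<^sup>2\<close> is the continuous extension of the integral formula from
  \<open>L\<^sup>1 \<inter> L\<^sup>2\<close>. By Plancherel's theorem a \<open>v\<close> as below exists for every \<open>u \<in> L2\<close>, and it is
  unique up to a null set because \<open>L\<^sup>1 \<inter> L\<^sup>2\<close> is dense; \<open>fourier u\<close> is one representative of it.
\<close>

definition fourier :: "(real^'n \<Rightarrow> complex) \<Rightarrow> real^'n \<Rightarrow> complex" where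
  "fourier u = (SOME v. v \<in> L2 \<and>
     (\<forall>\<phi>. (\<forall>n. integrable lborel (\<phi> n)) \<and> L2_tendsto \<phi> u \<longrightarrow>
           L2_tendsto (\<lambda>n. fourier_L1 (\<phi> n)) v))"

section \<open>The Paley-Wiener space\<close>

definition PW :: "(real^'n) set \<Rightarrow> (real^'n \<Rightarrow> complex) set" where
  "PW \<Omega> = {f \<in> L2. AE \<xi> in lborel. \<xi> \<notin> \<Omega> \<longrightarrow> fourier f \<xi> = 0}"

definition translate :: "real^'n \<Rightarrow> (real^'n \<Rightarrow> complex) \<Rightarrow> (real^'n \<Rightarrow> complex)" where
  "translate a u = (\<lambda>x. u (x - a))"

text \<open>The Borel sigma-algebra of \<open>PW \<Omega>\<close>, generated by the sets open for the \<open>L\<^sup>2\<close> distance.\<close>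

definition PW_borel :: "(real^'n) set \<Rightarrow> (real^'n \<Rightarrow> complex) measure" where
  "PW_borel \<Omega> = sigma (PW \<Omega>)
     {U. U \<subseteq> PW \<Omega> \<and> (\<forall>f\<in>U. \<exists>\<epsilon>>0. \<forall>g\<in>PW \<Omega>. L2_norm (g - f) < \<epsilon> \<longrightarrow> g \<in> U)}"

section \<open>The vector-valued space \<open>L\<^sup>2(\<Omega>, PW \<Omega>)\<close>\<close>

text \<open>
  A function \<open>\<Omega> \<rightarrow> PW \<Omega>\<close> is represented by a total function whose values outside \<open>\<Omega>\<close> are
  irrelevant.
\<close>

definition VL2 :: "(real^'n) set \<Rightarrow> (real^'n \<Rightarrow> real^'n \<Rightarrow> complex) set" where
  "VL2 \<Omega> = {F \<in> restrict_space lborel \<Omega> \<rightarrow>\<^sub>M PW_borel \<Omega>.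
              set_integrable lborel \<Omega> (\<lambda>\<alpha>. (L2_norm (F \<alpha>))\<^sup>2)}"

definition VL2_inner ::
  "(real^'n) set \<Rightarrow> (real^'n \<Rightarrow> real^'n \<Rightarrow> complex) \<Rightarrow> (real^'n \<Rightarrow> real^'n \<Rightarrow> complex) \<Rightarrow> complex" where
  "VL2_inner \<Omega> F G = (LINT \<alpha>:\<Omega>|lborel. L2_inner (F \<alpha>) (G \<alpha>))"

definition VL2_scale ::
  "complex \<Rightarrow> (real^'n \<Rightarrow> real^'n \<Rightarrow> complex) \<Rightarrow> (real^'n \<Rightarrow> real^'n \<Rightarrow> complex)" where
  "VL2_scale c F = (\<lambda>\<alpha>. L2_scale c (F \<alpha>))"

definition gabor ::
  "(real^'n \<Rightarrow> complex) \<Rightarrow> real^'n \<Rightarrow> real^'n \<Rightarrow> (real^'n \<Rightarrow> real^'n \<Rightarrow> complex)" where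
  "gabor u a b = (\<lambda>\<alpha>. L2_scale (character b \<alpha>) (translate a u))"

end

theory Submission
  imports Defs "HOL-Probability.Characteristic_Functions"
begin

text \<open>
  If the Gabor system is an orthonormal basis, the inner products
  \<open>\<langle>G a b, G a' b\<rangle> = |\<Omega>| \<langle>T a u, T a' u\<rangle>\<close> give orthonormality of the translates, and a function
  \<open>f \<in> PW \<Omega>\<close> is approximated by expanding the constant function \<open>f\<close> in the Gabor system and
  evaluating the expansion at a suitable point \<open>\<alpha> \<in> \<Omega>\<close>.

  Conversely, suppose that the translates form an orthonormal basis, and let \<open>v\<close> be the Fourier
  transform of \<open>u\<close>. On the Fourier side, \<open>1\<^sub>E / cnj v\<close> and \<open>1\<^bsub>E + t\<^esub> / cnj v\<close> have coefficients of
  equal modulus with respect to the basis \<open>e\<^sub>a v\<close>, hence equal norms by Parseval, so that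
  \<open>\<integral>\<^sub>E 1/|v|\<^sup>2 = \<integral>\<^bsub>E + t\<^esub> 1/|v|\<^sup>2\<close> whenever \<open>E, E + t \<subseteq> \<Omega>\<close> and \<open>|v|\<close> is bounded below on both.
  Therefore \<open>|v|\<close> is constant on \<open>\<Omega>\<close>, and the normalisations of \<open>u\<close> and \<open>\<Omega>\<close> make the constant 1.
  It follows that the characters \<open>e\<^sub>a\<close> form an orthonormal basis of \<open>L\<^sup>2(\<Omega>)\<close>, and the Gabor system is
  the tensor product of two orthonormal bases.

  The unitarity of the Fourier transform \<open>F\<close> is derived from the identity
  \<open>\<integral> F f \<cdot> cnj (F h) \<cdot> g\<^sub>s = \<integral> \<langle>f, T t h\<rangle> K\<^sub>s(t) dt\<close> for integrable \<open>f\<close>, bounded integrable \<open>h\<close>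
  and a Gaussian \<open>g\<^sub>s\<close> with transform \<open>K\<^sub>s\<close>, letting \<open>s \<rightarrow> 0\<close>; surjectivity follows because
  \<open>x \<mapsto> (F g)(-x)\<close> is a preimage of \<open>g\<close>.
\<close>

section \<open>The space \<open>L\<^sup>2\<close>\<close>

text \<open>No infinite series occurs: totality is always used as finite approximation, and the
  identity \<open>L2_norm_expansion\<close> takes the place of Parseval's equality. It also makes
  the tensor product step quantitative: at each \<alpha> the squared error of a Gabor sum is the
  remainder of the expansion of \<open>F \<alpha>\<close> in translates plus the errors made in
  replacing the coefficient functions by trigonometric polynomials, and these terms are integrated
  over \<Omega> separately. The obstacle in the converse is that \<open>1 / v\<close> need not be
  square integrable on \<Omega>. Hence only sets are tested on which \<open>|v|\<close> is at least
  \<open>1 / (n + 1)\<close> both at \<open>x\<close> and at \<open>x + t\<close>; as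
  \<open>n\<close> grows they exhaust the points where both values are nonzero. A set of this kind
  on which the two moduli differ strictly in one direction must be null, because the two integrals
  agree. The transform of an integrable function is a priori only bounded, so its square
  integrability has to precede any identity of inner products. For this reason the Gaussian identity
  is used twice: first for a bound uniform in \<open>s\<close>, to which Fatou's lemma applies, and
  then for the limit of the identity itself.\<close>

lemma borel_measurable_cnj [measurable]:
  "f \<in> borel_measurable M \<Longrightarrow> (\<lambda>x. cnj (f x)) \<in> borel_measurable M"
  by (rule borel_measurable_continuous_on[where f = cnj]) (auto intro: continuous_intros)

lemma L2_iff: "f \<in> L2 \<longleftrightarrow> f \<in> borel_measurable borel \<and> integrable lborel (\<lambda>x. (norm (f x))\<^sup>2)"
  by (simp add: L2_def)

lemma L2_measurable [measurable_dest]: "f \<in> L2 \<Longrightarrow> f \<in> borel_measurable borel"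
  by (simp add: L2_iff)

lemma L2_integrable: "f \<in> L2 \<Longrightarrow> integrable lborel (\<lambda>x. (norm (f x))\<^sup>2)"
  by (simp add: L2_iff)

lemma sum_fun_apply: "(\<Sum>i\<in>J. h i) x = (\<Sum>i\<in>J. h i x)"
  by (induction J rule: infinite_finite_induct) auto

lemma norm_add_squared_le:
  fixes a b :: "'a::real_normed_vector"
  shows "(norm (a + b))\<^sup>2 \<le> 2 * (norm a)\<^sup>2 + 2 * (norm b)\<^sup>2"
proof -
  have "(norm (a + b))\<^sup>2 \<le> (norm a + norm b)\<^sup>2"
    by (intro power_mono norm_triangle_ineq) auto
  also have "\<dots> \<le> 2 * (norm a)\<^sup>2 + 2 * (norm b)\<^sup>2"
    using zero_le_power2[of "norm a - norm b"] by (simp add: power2_eq_square algebra_simps)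
  finally show ?thesis .
qed

lemma L2_add: assumes "f \<in> L2" "g \<in> L2" shows "f + g \<in> L2"
proof -
  have [measurable]: "f \<in> borel_measurable borel" "g \<in> borel_measurable borel"
    using assms by (auto simp: L2_iff)
  have "integrable lborel (\<lambda>x. 2 * (norm (f x))\<^sup>2 + 2 * (norm (g x))\<^sup>2)"
    using assms by (auto simp: L2_iff)
  then have "integrable lborel (\<lambda>x. (norm (f x + g x))\<^sup>2)"
    by (rule Bochner_Integration.integrable_bound)
       (use norm_add_squared_le[of "f _" "g _"] in auto)
  then show ?thesis by (simp add: L2_iff plus_fun_def)
qed

lemma L2_scale_mem: assumes "f \<in> L2" shows "L2_scale c f \<in> L2"
  using assms by (auto simp: L2_iff L2_scale_def norm_mult power_mult_distrib)

lemma L2_uminus: "f \<in> L2 \<Longrightarrow> - f \<in> L2"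
  by (auto simp: L2_iff fun_Compl_def)

lemma L2_diff: "f \<in> L2 \<Longrightarrow> g \<in> L2 \<Longrightarrow> f - g \<in> L2"
  using L2_add[of f "- g"] L2_uminus[of g] by simp

lemma L2_zero: "0 \<in> L2"
  by (simp add: L2_iff zero_fun_def)

lemma L2_sum: "(\<And>i. i \<in> J \<Longrightarrow> h i \<in> L2) \<Longrightarrow> (\<Sum>i\<in>J. h i) \<in> L2"
  by (induction J rule: infinite_finite_induct) (auto simp: L2_zero L2_add)

lemma L2_dominated:
  assumes "g \<in> L2" "f \<in> borel_measurable borel" "\<And>x. norm (f x) \<le> norm (g x)"
  shows "f \<in> L2"
proof -
  have "integrable lborel (\<lambda>x. (norm (f x))\<^sup>2)"
    by (rule Bochner_Integration.integrable_bound[OF L2_integrable[OF assms(1)]])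
       (use assms in \<open>auto intro: power_mono\<close>)
  then show ?thesis using assms by (simp add: L2_iff)
qed

lemma L2_AE_cong:
  assumes "f \<in> L2" "g \<in> borel_measurable borel" "AE x in lborel. f x = g x"
  shows "g \<in> L2"
proof -
  have "integrable lborel (\<lambda>x. (norm (g x))\<^sup>2)"
    by (rule integrable_cong_AE_imp[OF L2_integrable[OF assms(1)]]) (use assms in auto)
  then show ?thesis using assms by (simp add: L2_iff)
qed

section \<open>Inner product and norm of \<open>L2\<close>\<close>

lemma mult_le_half_squares: "(a::real) * b \<le> (a\<^sup>2 + b\<^sup>2) / 2"
  using zero_le_power2[of "a - b"] by (simp add: power2_eq_square algebra_simps)

lemma L2_mult_integrable:
  assumes "f \<in> L2" "g \<in> L2"
  shows "integrable lborel (\<lambda>x. f x * g x)"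
proof -
  have [measurable]: "f \<in> borel_measurable borel" "g \<in> borel_measurable borel"
    using assms by (auto simp: L2_iff)
  have "integrable lborel (\<lambda>x. ((norm (f x))\<^sup>2 + (norm (g x))\<^sup>2) / 2)"
    using assms by (auto simp: L2_iff)
  then show ?thesis
    by (rule Bochner_Integration.integrable_bound)
       (use mult_le_half_squares[of "norm (f _)" "norm (g _)"] in \<open>auto simp: norm_mult\<close>)
qed

lemma L2_cnj: "f \<in> L2 \<Longrightarrow> (\<lambda>x. cnj (f x)) \<in> L2"
  by (auto simp: L2_iff)

lemma L2_inner_integrable:
  "f \<in> L2 \<Longrightarrow> g \<in> L2 \<Longrightarrow> integrable lborel (\<lambda>x. f x * cnj (g x))"
  using L2_mult_integrable[OF _ L2_cnj] by blast

lemma L2_inner_add_left: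
  "\<lbrakk>f \<in> L2; g \<in> L2; h \<in> L2\<rbrakk> \<Longrightarrow> L2_inner (f + g) h = L2_inner f h + L2_inner g h"
  by (simp add: L2_inner_def L2_inner_integrable distrib_right)

lemma L2_inner_diff_left:
  "\<lbrakk>f \<in> L2; g \<in> L2; h \<in> L2\<rbrakk> \<Longrightarrow> L2_inner (f - g) h = L2_inner f h - L2_inner g h"
  by (simp add: L2_inner_def L2_inner_integrable left_diff_distrib)

lemma L2_inner_scale_left: "L2_inner (L2_scale c f) h = c * L2_inner f h"
  by (simp add: L2_inner_def L2_scale_def mult.assoc)

lemma L2_inner_commute: "L2_inner g f = cnj (L2_inner f g)"
  unfolding L2_inner_def Bochner_Integration.integral_cnj[symmetric] by (simp add: mult.commute)

lemma L2_inner_add_right: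
  "\<lbrakk>f \<in> L2; g \<in> L2; h \<in> L2\<rbrakk> \<Longrightarrow> L2_inner h (f + g) = L2_inner h f + L2_inner h g"
  by (simp add: L2_inner_commute[of h] L2_inner_add_left)

lemma L2_inner_diff_right:
  "\<lbrakk>f \<in> L2; g \<in> L2; h \<in> L2\<rbrakk> \<Longrightarrow> L2_inner h (f - g) = L2_inner h f - L2_inner h g"
  by (simp add: L2_inner_commute[of h] L2_inner_diff_left)

lemma L2_inner_scale_right: "L2_inner h (L2_scale c f) = cnj c * L2_inner h f"
  by (simp add: L2_inner_commute[of h] L2_inner_scale_left)

lemma L2_inner_sum_left:
  "\<lbrakk>\<And>i. i \<in> J \<Longrightarrow> h i \<in> L2; g \<in> L2\<rbrakk> \<Longrightarrow> L2_inner (\<Sum>i\<in>J. h i) g = (\<Sum>i\<in>J. L2_inner (h i) g)"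
  by (simp add: L2_inner_def sum_fun_apply sum_distrib_right Bochner_Integration.integral_sum L2_inner_integrable)

lemma L2_inner_sum_right:
  "\<lbrakk>\<And>i. i \<in> J \<Longrightarrow> h i \<in> L2; g \<in> L2\<rbrakk> \<Longrightarrow> L2_inner g (\<Sum>i\<in>J. h i) = (\<Sum>i\<in>J. L2_inner g (h i))"
  by (simp add: L2_inner_def sum_fun_apply sum_distrib_left Bochner_Integration.integral_sum L2_inner_integrable)

lemma L2_inner_cong_AE:
  assumes "f \<in> borel_measurable borel" "f' \<in> borel_measurable borel"
    "g \<in> borel_measurable borel" "g' \<in> borel_measurable borel"
    "AE x in lborel. f x = f' x" "AE x in lborel. g x = g' x"
  shows "L2_inner f g = L2_inner f' g'"
  unfolding L2_inner_def
  by (rule integral_cong_AE) (use assms in auto)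

lemma L2_inner_self: "L2_inner f f = of_real (LINT x|lborel. (norm (f x))\<^sup>2)"
  unfolding L2_inner_def complex_norm_square[symmetric] of_real_power[symmetric]
  by (rule integral_complex_of_real)

lemma L2_norm_eq: "L2_norm f = sqrt (LINT x|lborel. (norm (f x))\<^sup>2)"
  by (simp add: ip_norm_def L2_inner_self)

lemma L2_norm_nonneg [simp]: "0 \<le> L2_norm f"
  by (simp add: L2_norm_eq)

lemma L2_norm_squared: "(L2_norm f)\<^sup>2 = (LINT x|lborel. (norm (f x))\<^sup>2)"
  by (simp add: L2_norm_eq)

lemma L2_inner_self_norm: "L2_inner f f = of_real ((L2_norm f)\<^sup>2)"
  by (simp add: L2_norm_squared L2_inner_self)

lemma L2_norm_cong_AE:
  assumes "f \<in> borel_measurable borel" "g \<in> borel_measurable borel" "AE x in lborel. f x = g x"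
  shows "L2_norm f = L2_norm g"
  using L2_inner_cong_AE[OF assms(1,2,1,2,3,3)] by (simp add: ip_norm_def)

lemma L2_norm_0 [simp]: "L2_norm 0 = 0"
  by (simp add: L2_norm_eq)

lemma L2_norm_uminus: "L2_norm (- f) = L2_norm f"
  by (simp add: L2_norm_eq fun_Compl_def)

lemma L2_norm_minus_commute: "L2_norm (f - g) = L2_norm (g - f)"
  using L2_norm_uminus[of "f - g"] by simp

lemma L2_norm_scale: "L2_norm (L2_scale c f) = norm c * L2_norm f"
  by (simp add: L2_norm_eq L2_scale_def norm_mult power_mult_distrib real_sqrt_mult)

lemma L2_norm_eq_0_iff:
  assumes "f \<in> L2"
  shows "L2_norm f = 0 \<longleftrightarrow> (AE x in lborel. f x = 0)"
  using integral_nonneg_eq_0_iff_AE[OF L2_integrable[OF assms]] by (simp add: L2_norm_eq)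

text \<open>After division by the two norms, the pointwise inequality between geometric and
  arithmetic mean integrates to the bound 1. A vanishing norm cannot be normalised and is treated
  apart: there the integrand is zero almost everywhere.\<close>

lemma L2_Cauchy_Schwarz:
  assumes f: "f \<in> L2" and g: "g \<in> L2"
  shows "norm (L2_inner f g) \<le> L2_norm f * L2_norm g"
proof (cases "L2_norm f = 0 \<or> L2_norm g = 0")
  case True
  then have "AE x in lborel. f x * cnj (g x) = 0"
    using L2_norm_eq_0_iff[OF f] L2_norm_eq_0_iff[OF g] by (elim disjE) auto
  then have "L2_inner f g = 0"
    unfolding L2_inner_def by (rule integral_eq_zero_AE)
  then show ?thesis by simp
next
  case False
  define a b where "a = L2_norm f" and "b = L2_norm g"
  have pos: "a > 0" "b > 0"
    using False L2_norm_nonneg[of f] L2_norm_nonneg[of g] unfolding a_def b_def by linarith+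
  have "norm (L2_inner f g) \<le> (LINT x|lborel. norm (f x * cnj (g x)))"
    unfolding L2_inner_def by (rule integral_norm_bound)
  also have "\<dots> \<le> (LINT x|lborel. a * b / 2 * ((norm (f x))\<^sup>2 / a\<^sup>2 + (norm (g x))\<^sup>2 / b\<^sup>2))"
  proof (rule integral_mono)
    show "integrable lborel (\<lambda>x. norm (f x * cnj (g x)))"
      using L2_inner_integrable[OF f g] by simp
    show "integrable lborel (\<lambda>x. a * b / 2 * ((norm (f x))\<^sup>2 / a\<^sup>2 + (norm (g x))\<^sup>2 / b\<^sup>2))"
      using L2_integrable[OF f] L2_integrable[OF g] by auto
    show "norm (f x * cnj (g x)) \<le> a * b / 2 * ((norm (f x))\<^sup>2 / a\<^sup>2 + (norm (g x))\<^sup>2 / b\<^sup>2)" for x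
    proof -
      have "a * b * ((norm (f x) / a) * (norm (g x) / b))
          \<le> a * b * (((norm (f x) / a)\<^sup>2 + (norm (g x) / b)\<^sup>2) / 2)"
        using pos by (intro mult_left_mono mult_le_half_squares) auto
      then show ?thesis using pos by (simp add: norm_mult power_divide)
    qed
  qed
  also have "\<dots> = a * b"
    using L2_integrable[OF f] L2_integrable[OF g] pos
    by (simp add: L2_norm_squared[symmetric] flip: a_def b_def)
  finally show ?thesis by (simp add: a_def b_def)
qed

lemma L2_norm_add_squared:
  assumes "f \<in> L2" "g \<in> L2"
  shows "(L2_norm (f + g))\<^sup>2 = (L2_norm f)\<^sup>2 + 2 * Re (L2_inner f g) + (L2_norm g)\<^sup>2"
proof -
  have "complex_of_real ((L2_norm (f + g))\<^sup>2) = L2_inner (f + g) (f + g)"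
    by (simp add: L2_inner_self_norm)
  also have "\<dots> = L2_inner f f + (L2_inner f g + cnj (L2_inner f g)) + L2_inner g g"
    using assms by (simp add: L2_inner_add_left L2_inner_add_right L2_add L2_inner_commute[of g f])
  also have "\<dots> = of_real ((L2_norm f)\<^sup>2 + 2 * Re (L2_inner f g) + (L2_norm g)\<^sup>2)"
    by (simp add: L2_inner_self_norm complex_add_cnj)
  finally show ?thesis using of_real_eq_iff by blast
qed

lemma L2_norm_triangle:
  assumes "f \<in> L2" "g \<in> L2"
  shows "L2_norm (f + g) \<le> L2_norm f + L2_norm g"
proof -
  have "(L2_norm (f + g))\<^sup>2 \<le> (L2_norm f + L2_norm g)\<^sup>2"
    using L2_norm_add_squared[OF assms] L2_Cauchy_Schwarz[OF assms] complex_Re_le_cmod[of "L2_inner f g"]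
    by (simp add: power2_sum)
  then show ?thesis by (rule power2_le_imp_le) simp
qed

lemma L2_norm_triangle_diff:
  assumes "f \<in> L2" "g \<in> L2" "h \<in> L2"
  shows "L2_norm (f - h) \<le> L2_norm (f - g) + L2_norm (g - h)"
  using L2_norm_triangle[of "f - g" "g - h"] assms by (simp add: L2_diff)

section \<open>Convergence in \<open>L2\<close>\<close>

lemma L2_tendstoI:
  assumes "\<And>n. \<phi> n \<in> L2" "f \<in> L2" "\<And>n. L2_norm (\<phi> n - f) \<le> r n" "r \<longlonglongrightarrow> 0"
  shows "L2_tendsto \<phi> f"
proof -
  have "(\<lambda>n. L2_norm (\<phi> n - f)) \<longlonglongrightarrow> 0"
    by (rule tendsto_sandwich[OF _ _ tendsto_const assms(4)]) (use assms in auto)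
  then show ?thesis using assms by (simp add: L2_tendsto_def)
qed

lemma L2_tendsto_inner:
  assumes "L2_tendsto \<phi> f" "L2_tendsto \<psi> g"
  shows "(\<lambda>n. L2_inner (\<phi> n) (\<psi> n)) \<longlonglongrightarrow> L2_inner f g"
proof -
  have mem: "\<phi> n \<in> L2" "\<psi> n \<in> L2" "f \<in> L2" "g \<in> L2" for n
    using assms by (auto simp: L2_tendsto_def)
  have "norm (L2_inner (\<phi> n) (\<psi> n) - L2_inner f g)
      \<le> L2_norm (\<phi> n - f) * (L2_norm (\<psi> n - g) + L2_norm g) + L2_norm f * L2_norm (\<psi> n - g)" for n
  proof -
    have "L2_inner (\<phi> n) (\<psi> n) - L2_inner f g = L2_inner (\<phi> n - f) (\<psi> n) + L2_inner f (\<psi> n - g)"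
      by (simp add: L2_inner_diff_left L2_inner_diff_right mem)
    then have "norm (L2_inner (\<phi> n) (\<psi> n) - L2_inner f g)
        \<le> L2_norm (\<phi> n - f) * L2_norm (\<psi> n) + L2_norm f * L2_norm (\<psi> n - g)"
      using norm_triangle_ineq[of "L2_inner (\<phi> n - f) (\<psi> n)" "L2_inner f (\<psi> n - g)"]
        L2_Cauchy_Schwarz[OF L2_diff[OF mem(1,3)] mem(2), of n n]
        L2_Cauchy_Schwarz[OF mem(3) L2_diff[OF mem(2,4)], of n] by (simp only:)
    \<comment> \<open>The norm of \<open>\<psi> n\<close> is traded for a quantity that visibly
      converges, which replaces a separate proof that the sequence is bounded.\<close>
    moreover have "L2_norm (\<psi> n) \<le> L2_norm (\<psi> n - g) + L2_norm g"
      using L2_norm_triangle[of "\<psi> n - g" g] by (simp add: L2_diff mem)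
    moreover have "L2_norm (\<phi> n - f) * L2_norm (\<psi> n) \<le> L2_norm (\<phi> n - f) * (L2_norm (\<psi> n - g) + L2_norm g)"
      by (intro mult_left_mono calculation(2) L2_norm_nonneg)
    ultimately show ?thesis by linarith
  qed
  moreover have "(\<lambda>n. L2_norm (\<phi> n - f) * (L2_norm (\<psi> n - g) + L2_norm g) + L2_norm f * L2_norm (\<psi> n - g))
      \<longlonglongrightarrow> 0 * (0 + L2_norm g) + L2_norm f * 0"
    using assms by (intro tendsto_intros) (auto simp: L2_tendsto_def)
  ultimately have "(\<lambda>n. L2_inner (\<phi> n) (\<psi> n) - L2_inner f g) \<longlonglongrightarrow> 0"
    using Lim_null_comparison[OF always_eventually[OF allI]] by force
  then show ?thesis by (rule LIM_zero_cancel)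
qed

lemma L2_tendsto_add:
  assumes "L2_tendsto \<phi> f" "L2_tendsto \<psi> g"
  shows "L2_tendsto (\<lambda>n. \<phi> n + \<psi> n) (f + g)"
proof (rule L2_tendstoI)
  have mem: "\<phi> n \<in> L2" "\<psi> n \<in> L2" "f \<in> L2" "g \<in> L2" for n
    using assms by (auto simp: L2_tendsto_def)
  show "\<phi> n + \<psi> n \<in> L2" "f + g \<in> L2" for n
    by (simp_all add: L2_add mem)
  show "L2_norm (\<phi> n + \<psi> n - (f + g)) \<le> L2_norm (\<phi> n - f) + L2_norm (\<psi> n - g)" for n
    using L2_norm_triangle[of "\<phi> n - f" "\<psi> n - g"] by (simp add: L2_diff mem algebra_simps)
  show "(\<lambda>n. L2_norm (\<phi> n - f) + L2_norm (\<psi> n - g)) \<longlonglongrightarrow> 0"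
    using tendsto_add[of _ 0 _ _ 0] assms by (auto simp: L2_tendsto_def)
qed

lemma L2_scale_diff: "L2_scale c f - L2_scale c g = L2_scale c (f - g)"
  by (simp add: L2_scale_def fun_eq_iff right_diff_distrib)

lemma L2_tendsto_scale:
  assumes "L2_tendsto \<phi> f"
  shows "L2_tendsto (\<lambda>n. L2_scale c (\<phi> n)) (L2_scale c f)"
proof -
  have "(\<lambda>n. norm c * L2_norm (\<phi> n - f)) \<longlonglongrightarrow> norm c * 0"
    using assms by (intro tendsto_intros) (auto simp: L2_tendsto_def)
  then show ?thesis
    using assms by (auto simp: L2_tendsto_def L2_scale_diff L2_norm_scale L2_scale_mem)
qed

lemma L2_tendsto_unique:
  assumes "L2_tendsto \<phi> f" "L2_tendsto \<phi> g"
  shows "AE x in lborel. f x = g x"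
proof -
  have mem: "\<phi> n \<in> L2" "f \<in> L2" "g \<in> L2" for n
    using assms by (auto simp: L2_tendsto_def)
  have "L2_norm (f - g) \<le> L2_norm (\<phi> n - f) + L2_norm (\<phi> n - g)" for n
    using L2_norm_triangle_diff[of f "\<phi> n" g] L2_norm_minus_commute[of f "\<phi> n"] mem by simp
  moreover have "(\<lambda>n. L2_norm (\<phi> n - f) + L2_norm (\<phi> n - g)) \<longlonglongrightarrow> 0"
    using tendsto_add[of _ 0 _ _ 0] assms by (auto simp: L2_tendsto_def)
  ultimately have "L2_norm (f - g) \<le> 0"
    by (intro LIMSEQ_le_const) blast+
  then have "L2_norm (f - g) = 0" using L2_norm_nonneg[of "f - g"] by linarith
  then show ?thesis
    using L2_norm_eq_0_iff[of "f - g"] mem by (simp add: L2_diff)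
qed

lemma L2_tendsto_dominated:
  fixes f :: "real^'n \<Rightarrow> complex"
  assumes f: "f \<in> L2" and "\<And>n. \<phi> n \<in> borel_measurable borel"
    and "\<And>n x. norm (\<phi> n x) \<le> norm (f x)" and "\<And>x. (\<lambda>n. \<phi> n x) \<longlonglongrightarrow> f x"
  shows "L2_tendsto \<phi> f"
proof -
  have mem: "\<phi> n \<in> L2" for n
    using L2_dominated[OF f] assms by blast
  have [measurable]: "f \<in> borel_measurable borel" "\<phi> n \<in> borel_measurable borel" for n
    using assms by (auto simp: L2_iff)
  have "(\<lambda>n. LINT x|lborel. (norm (\<phi> n x - f x))\<^sup>2) \<longlonglongrightarrow> integral\<^sup>L lborel (\<lambda>x::real^'n. 0 :: real)"
  proof (rule integral_dominated_convergence)
    \<comment> \<open>The factor 4 comes from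
      \<open>|p - q|\<^sup>2 \<le> 2 |p|\<^sup>2 + 2 |q|\<^sup>2\<close> with both moduli at most
      \<open>norm (f x)\<close>.\<close>
    show "integrable lborel (\<lambda>x. 4 * (norm (f x))\<^sup>2)"
      using L2_integrable[OF f] by simp
    have "(\<lambda>n. (norm (\<phi> n x - f x))\<^sup>2) \<longlonglongrightarrow> (norm (f x - f x))\<^sup>2" for x
      by (intro tendsto_intros assms)
    then show "AE x in lborel. (\<lambda>n. (norm (\<phi> n x - f x))\<^sup>2) \<longlonglongrightarrow> 0" by simp
    have "(norm (\<phi> n x - f x))\<^sup>2 \<le> 4 * (norm (f x))\<^sup>2" for n x
      using norm_add_squared_le[of "\<phi> n x" "- f x", simplified]
        power_mono[OF assms(3)[of n x] norm_ge_zero, of 2] by linarith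
    then show "AE x in lborel. norm ((norm (\<phi> n x - f x))\<^sup>2) \<le> 4 * (norm (f x))\<^sup>2" for n
      by simp
  qed auto
  then have "(\<lambda>n. sqrt (LINT x|lborel. (norm ((\<phi> n - f) x))\<^sup>2)) \<longlonglongrightarrow> sqrt 0"
    by (intro tendsto_intros) simp
  then show ?thesis using mem f by (simp add: L2_tendsto_def L2_norm_eq)
qed

section \<open>Completeness of \<open>L2\<close>\<close>

text \<open>
  The weighted sum \<open>\<Sum>k. 2\<^sup>k \<bar>\<psi> (k+1) - \<psi> k\<bar>\<^sup>2\<close> is integrable, hence finite almost everywhere.
  There \<open>\<bar>d\<bar> \<le> 2\<^sup>-\<^sup>k + 2\<^sup>k \<bar>d\<bar>\<^sup>2\<close> gives absolute convergence of the telescoping series.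
\<close>

lemma L2_fast_Cauchy_AE_convergent:
  assumes mem: "\<And>k. \<psi> k \<in> L2"
    and fast: "\<And>k. L2_norm (\<psi> (Suc k) - \<psi> k) \<le> (1/2) ^ k"
  shows "AE x in lborel. convergent (\<lambda>k. \<psi> k x)"
proof -
  have [measurable]: "\<psi> k \<in> borel_measurable borel" for k
    using mem by (simp add: L2_iff)
  define h where "h k x = 2 ^ k * (norm (\<psi> (Suc k) x - \<psi> k x))\<^sup>2" for k x
  have [measurable]: "h k \<in> borel_measurable borel" for k
    by (simp add: h_def[abs_def])
  have int: "integrable lborel (h k)" for k
    using L2_integrable[OF L2_diff[OF mem mem]] by (simp add: h_def[abs_def])
  have "(\<integral>\<^sup>+ x. ennreal (h k x) \<partial>lborel) \<le> ennreal ((1/2) ^ k)" for k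
  proof -
    have "(\<integral>\<^sup>+ x. ennreal (h k x) \<partial>lborel) = ennreal (LINT x|lborel. h k x)"
      by (rule nn_integral_eq_integral[OF int]) (simp add: h_def)
    also have "(LINT x|lborel. h k x) = 2 ^ k * (L2_norm (\<psi> (Suc k) - \<psi> k))\<^sup>2"
      by (simp add: h_def L2_norm_squared)
    also have "\<dots> \<le> 2 ^ k * ((1/2) ^ k)\<^sup>2"
      by (intro mult_left_mono power_mono fast) auto
    also have "\<dots> = (1/2) ^ k"
      by (simp add: power2_eq_square field_simps flip: power_mult_distrib)
    finally show ?thesis by (simp add: ennreal_leI)
  qed
  then have "(\<Sum>k. \<integral>\<^sup>+ x. ennreal (h k x) \<partial>lborel) \<le> (\<Sum>k. ennreal ((1/2) ^ k))"
    by (intro suminf_le) auto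
  also have "\<dots> = ennreal (\<Sum>k. (1/2) ^ k)"
    by (rule suminf_ennreal2) (auto intro: summable_geometric)
  also have "\<dots> < \<infinity>" by simp
  finally have "(\<integral>\<^sup>+ x. (\<Sum>k. ennreal (h k x)) \<partial>lborel) < \<infinity>"
    by (subst nn_integral_suminf) auto
  then have "AE x in lborel. (\<Sum>k. ennreal (h k x)) \<noteq> \<infinity>"
    by (intro nn_integral_noteq_infinite) auto
  then show ?thesis
  proof eventually_elim
    case (elim x)
    have "summable (\<lambda>k. h k x)"
      by (rule summable_suminf_not_top) (use elim in \<open>auto simp: h_def\<close>)
    then have "summable (\<lambda>k. (1/2) ^ k + h k x)"
      by (intro summable_add summable_geometric) auto
    then have "summable (\<lambda>k. \<psi> (Suc k) x - \<psi> k x)"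
    proof (rule summable_comparison_test')
      fix k :: nat assume "k \<ge> 0"
      define d where "d = norm (\<psi> (Suc k) x - \<psi> k x)"
      have "d \<le> (1/2) ^ k + 2 ^ k * d\<^sup>2"
      proof (cases "d \<le> (1/2) ^ k")
        case False
        then have "1 \<le> 2 ^ k * d" by (simp add: field_simps)
        then have "d \<le> (2 ^ k * d) * d"
          using mult_right_mono[of 1 "2 ^ k * d" d] by (simp add: d_def)
        then show ?thesis by (simp add: power2_eq_square mult.assoc add_increasing)
      qed (auto simp: add_increasing2)
      then show "norm (\<psi> (Suc k) x - \<psi> k x) \<le> (1/2) ^ k + h k x"
        by (simp add: h_def d_def)
    qed
    then have "convergent (\<lambda>n. \<Sum>k<n. \<psi> (Suc k) x - \<psi> k x)"
      by (simp add: summable_iff_convergent)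
    then have "convergent (\<lambda>n. \<psi> n x - \<psi> 0 x)"
      by (simp only: sum_lessThan_telescope[of "\<lambda>k. \<psi> k x"])
    from convergent_add[OF this convergent_const[of "\<psi> 0 x"]] show ?case by simp
  qed
qed

text \<open>Fatou's lemma for squared norms. The bound is asked for only from an index
  \<open>N\<close> on, because completeness applies it to differences that are small only late in
  the sequence; the instance \<open>m = N\<close> also yields \<open>0 \<le> B\<close>.\<close>

lemma L2_Fatou:
  assumes "\<And>m. \<psi> m \<in> L2" "v \<in> borel_measurable borel"
    and "AE x in lborel. (\<lambda>m. \<psi> m x) \<longlonglongrightarrow> v x"
    and "\<And>m. m \<ge> N \<Longrightarrow> L2_norm (\<psi> m) \<le> B"
  shows "v \<in> L2" "L2_norm v \<le> B"
proof -
  have [measurable]: "\<psi> m \<in> borel_measurable borel" for m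
    using assms by (simp add: L2_iff)
  note [measurable] = assms(2)
  have B: "0 \<le> B" using assms(4)[of N] L2_norm_nonneg[of "\<psi> N"] by linarith
  have "AE x in lborel. ennreal ((norm (v x))\<^sup>2) = liminf (\<lambda>m. ennreal ((norm (\<psi> m x))\<^sup>2))"
    using assms(3)
  proof eventually_elim
    case (elim x)
    then have "(\<lambda>m. ennreal ((norm (\<psi> m x))\<^sup>2)) \<longlonglongrightarrow> ennreal ((norm (v x))\<^sup>2)"
      by (intro tendsto_intros)
    from lim_imp_Liminf[OF sequentially_bot this] show ?case by simp
  qed
  then have "(\<integral>\<^sup>+ x. ennreal ((norm (v x))\<^sup>2) \<partial>lborel)
      = (\<integral>\<^sup>+ x. liminf (\<lambda>m. ennreal ((norm (\<psi> m x))\<^sup>2)) \<partial>lborel)"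
    by (rule nn_integral_cong_AE)
  also have "\<dots> \<le> liminf (\<lambda>m. \<integral>\<^sup>+ x. ennreal ((norm (\<psi> m x))\<^sup>2) \<partial>lborel)"
    by (rule nn_integral_liminf) auto
  also have "\<dots> \<le> liminf (\<lambda>m. ennreal (B\<^sup>2))"
  proof (rule Liminf_mono, rule eventually_sequentiallyI)
    fix m assume m: "m \<ge> N"
    have "(\<integral>\<^sup>+ x. ennreal ((norm (\<psi> m x))\<^sup>2) \<partial>lborel) = ennreal ((L2_norm (\<psi> m))\<^sup>2)"
      unfolding L2_norm_squared by (rule nn_integral_eq_integral) (use L2_integrable assms in auto)
    also have "\<dots> \<le> ennreal (B\<^sup>2)"
      by (intro ennreal_leI power_mono assms(4) m) auto
    finally show "(\<integral>\<^sup>+ x. ennreal ((norm (\<psi> m x))\<^sup>2) \<partial>lborel) \<le> ennreal (B\<^sup>2)" .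
  qed
  also have "\<dots> = ennreal (B\<^sup>2)" by (simp add: Liminf_const)
  finally have le: "(\<integral>\<^sup>+ x. ennreal ((norm (v x))\<^sup>2) \<partial>lborel) \<le> ennreal (B\<^sup>2)" .
  then have int: "integrable lborel (\<lambda>x. (norm (v x))\<^sup>2)"
    by (intro integrableI_bounded) (auto intro: le_less_trans)
  then show "v \<in> L2" by (simp add: L2_iff)
  have "ennreal ((L2_norm v)\<^sup>2) \<le> ennreal (B\<^sup>2)"
    using le unfolding L2_norm_squared by (subst (asm) nn_integral_eq_integral[OF int]) auto
  then have "(L2_norm v)\<^sup>2 \<le> B\<^sup>2" by simp
  then show "L2_norm v \<le> B" using B by (rule power2_le_imp_le)
qed

text \<open>A subsequence with geometrically small steps converges almost everywhere. Fatou's lemma,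
  applied along this subsequence to its differences from a fixed \<open>\<phi> n\<close>, carries
  the Cauchy estimate over to \<open>v - \<phi> n\<close>, giving membership and rate of convergence
  together.\<close>

lemma L2_complete:
  assumes mem: "\<And>k. \<phi> k \<in> L2"
    and Cauchy: "\<And>\<epsilon>. \<epsilon> > 0 \<Longrightarrow> \<exists>N. \<forall>m\<ge>N. \<forall>n\<ge>N. L2_norm (\<phi> m - \<phi> n) < \<epsilon>"
  obtains v where "L2_tendsto \<phi> v"
proof -
  have "\<exists>N. \<forall>k. (\<forall>m\<ge>N k. \<forall>n\<ge>N k. L2_norm (\<phi> m - \<phi> n) < (1/2) ^ k) \<and> N k < N (Suc k)"
  proof (rule dependent_nat_choice)
    show "\<exists>x. \<forall>m\<ge>x. \<forall>n\<ge>x. L2_norm (\<phi> m - \<phi> n) < (1/2) ^ 0"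
      using Cauchy[of 1] by simp
  next
    fix x and k :: nat
    obtain M where "\<forall>m\<ge>M. \<forall>n\<ge>M. L2_norm (\<phi> m - \<phi> n) < (1/2) ^ Suc k"
      using Cauchy[of "(1/2) ^ Suc k"] by auto
    then show "\<exists>y. (\<forall>m\<ge>y. \<forall>n\<ge>y. L2_norm (\<phi> m - \<phi> n) < (1/2) ^ Suc k) \<and> x < y"
      by (intro exI[of _ "max M (Suc x)"]) auto
  qed
  then obtain N where N: "\<And>k m n. N k \<le> m \<Longrightarrow> N k \<le> n \<Longrightarrow> L2_norm (\<phi> m - \<phi> n) < (1/2) ^ k"
    and inc: "\<And>k. N k < N (Suc k)" by blast
  have mono: "strict_mono N" using inc by (simp add: strict_mono_Suc_iff)
  have "AE x in lborel. convergent (\<lambda>k. \<phi> (N k) x)"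
  proof (rule L2_fast_Cauchy_AE_convergent[where \<psi> = "\<lambda>k. \<phi> (N k)"])
    show "L2_norm (\<phi> (N (Suc k)) - \<phi> (N k)) \<le> (1/2) ^ k" for k
      using N[of k "N (Suc k)" "N k"] inc[of k] by simp
  qed (rule mem)
  define v where "v x = lim (\<lambda>k. \<phi> (N k) x)" for x
  have [measurable]: "\<phi> k \<in> borel_measurable borel" for k
    using mem by (simp add: L2_iff)
  have v[measurable]: "v \<in> borel_measurable borel"
    unfolding v_def[abs_def] by (rule borel_measurable_lim_metric) simp
  have lim: "AE x in lborel. (\<lambda>k. \<phi> (N k) x) \<longlonglongrightarrow> v x"
    using \<open>AE x in lborel. convergent (\<lambda>k. \<phi> (N k) x)\<close>
    by eventually_elim (simp add: v_def convergent_LIMSEQ_iff)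
  have bound: "v - \<phi> n \<in> L2" "L2_norm (v - \<phi> n) \<le> (1/2) ^ j" if "n \<ge> N j" for n j
  proof -
    have *: "\<phi> (N k) - \<phi> n \<in> L2" "v - \<phi> n \<in> borel_measurable borel" for k
      using mem L2_diff by (auto simp: fun_diff_def)
    have **: "AE x in lborel. (\<lambda>k. (\<phi> (N k) - \<phi> n) x) \<longlonglongrightarrow> (v - \<phi> n) x"
      using lim by eventually_elim (auto intro!: tendsto_intros)
    have ***: "L2_norm (\<phi> (N k) - \<phi> n) \<le> (1/2) ^ j" if "k \<ge> j" for k
      using N[of j "N k" n] \<open>n \<ge> N j\<close> strict_mono_leD[OF mono that] by simp
    show "v - \<phi> n \<in> L2" "L2_norm (v - \<phi> n) \<le> (1/2) ^ j"
      using L2_Fatou[where v = "v - \<phi> n" and \<psi> = "\<lambda>k. \<phi> (N k) - \<phi> n", OF * ** ***] by blast+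
  qed
  have "v \<in> L2"
    using L2_add[OF bound(1)[OF order_refl] mem, of 0 "N 0"] by simp
  moreover have "(\<lambda>n. L2_norm (\<phi> n - v)) \<longlonglongrightarrow> 0"
  proof (rule LIMSEQ_I)
    fix r :: real assume "r > 0"
    then obtain j where j: "(1/2) ^ j < r"
      using real_arch_pow_inv[of r "1/2"] by auto
    show "\<exists>no. \<forall>n\<ge>no. norm (L2_norm (\<phi> n - v) - 0) < r"
      using bound(2)[of j] j L2_norm_minus_commute[of v] by (intro exI[of _ "N j"]) (force intro: le_less_trans)
  qed
  ultimately show thesis using that[of v] mem by (simp add: L2_tendsto_def)
qed

section \<open>Approximation by bounded integrable functions\<close>

text \<open>Cutting off both the argument and the value gives bounded functions supported in a ball.
  They are integrable, and they are dominated by \<open>f\<close>, so they converge to it in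
  \<open>L2\<close>.\<close>

definition truncation :: "nat \<Rightarrow> (real^'n \<Rightarrow> complex) \<Rightarrow> (real^'n \<Rightarrow> complex)" where
  "truncation n f = (\<lambda>x. if norm x \<le> n \<and> norm (f x) \<le> n then f x else 0)"

lemma truncation_measurable:
  assumes "f \<in> L2" shows "truncation n f \<in> borel_measurable borel"
proof -
  have [measurable]: "f \<in> borel_measurable borel" using assms by (rule L2_measurable)
  show ?thesis unfolding truncation_def by measurable
qed

lemma norm_truncation_le: "norm (truncation n f x) \<le> norm (f x)" "norm (truncation n f x) \<le> n"
  by (auto simp: truncation_def)

lemma truncation_pointwise: "(\<lambda>n. truncation n f x) \<longlonglongrightarrow> f x"
proof -
  obtain M :: nat where M: "norm x \<le> M" "norm (f x) \<le> M"
    using real_arch_simple[of "max (norm x) (norm (f x))"] by auto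
  have "\<forall>\<^sub>F n in sequentially. f x = truncation n f x"
    using eventually_ge_at_top[of M] by eventually_elim (use M in \<open>force simp: truncation_def\<close>)
  then show ?thesis
    by (rule Lim_transform_eventually[OF tendsto_const])
qed

lemma truncation_tendsto: "f \<in> L2 \<Longrightarrow> L2_tendsto (\<lambda>n. truncation n f) f"
  by (rule L2_tendsto_dominated) (auto simp: truncation_measurable norm_truncation_le truncation_pointwise)

lemma truncation_integrable: assumes "f \<in> L2" shows "integrable lborel (truncation n f)"
proof (rule integrableI_bounded_set[where A = "cball 0 (real n)" and B = "real n"])
  show "emeasure lborel (cball (0::real^'n) (real n)) < \<infinity>"
    by (intro emeasure_bounded_finite) simp
qed (use assms in \<open>auto simp: truncation_measurable norm_truncation_le\<close>, auto simp: truncation_def)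

lemma truncation_L2: "f \<in> L2 \<Longrightarrow> truncation n f \<in> L2"
  by (rule L2_dominated[where g = f]) (auto simp: truncation_measurable norm_truncation_le)

section \<open>Gaussians\<close>

text \<open>With \<open>c\<^sup>2 = 2 * s\<close> the substitution of \<open>c * x\<close> turns the
  standard normal density into a multiple of \<open>exp (- s * x\<^sup>2)\<close>, so the integral
  is the characteristic function of the normal law at \<open>t / c\<close>.\<close>

lemma integrable_gaussian_real:
  assumes s: "(s::real) > 0"
  shows "integrable lborel (\<lambda>x. complex_of_real (exp (- s * x\<^sup>2)) * iexp (t * x))"
    and "(LINT x|lborel. complex_of_real (exp (- s * x\<^sup>2)) * iexp (t * x))
       = complex_of_real (sqrt (pi / s) * exp (- t\<^sup>2 / (4 * s)))"
proof -
  define c where "c = sqrt (2 * s)"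
  have c: "c > 0" "c\<^sup>2 = 2 * s" using s by (auto simp: c_def)
  define f where "f x = std_normal_density x *\<^sub>R iexp ((t / c) * x)" for x
  have intf: "integrable lborel f"
    unfolding f_def[abs_def]
    by (rule Bochner_Integration.integrable_bound[where f = std_normal_density])
       (auto intro!: integrable_normal_density simp: norm_exp_i_times)
  have f_eq: "f (0 + c * x) = (1 / sqrt (2 * pi)) *\<^sub>R (complex_of_real (exp (- s * x\<^sup>2)) * iexp (t * x))" for x
    using c s by (simp add: f_def std_normal_density_def power_mult_distrib scaleR_conv_of_real)
  have 1: "integrable lborel (\<lambda>x. f (0 + c * x))"
    using lborel_integrable_real_affine[OF intf, of c 0] c by simp
  then have "integrable lborel (\<lambda>x. sqrt (2 * pi) *\<^sub>R f (0 + c * x))"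
    by (intro integrable_scaleR_right) auto
  then show "integrable lborel (\<lambda>x. complex_of_real (exp (- s * x\<^sup>2)) * iexp (t * x))"
    unfolding f_eq by simp
  have "complex_of_real (exp (- ((t / c)\<^sup>2) / 2)) = char std_normal_distribution (t / c)"
    by (simp add: char_std_normal_distribution)
  also have "\<dots> = (LINT x|lborel. f x)"
    unfolding char_def f_def by (subst integral_density) auto
  also have "\<dots> = \<bar>c\<bar> *\<^sub>R (LINT x|lborel. f (0 + c * x))"
    by (rule lborel_integral_real_affine) (use c in simp)
  also have "\<dots> = (c / sqrt (2 * pi)) *\<^sub>R (LINT x|lborel. complex_of_real (exp (- s * x\<^sup>2)) * iexp (t * x))"
    using c unfolding f_eq by simp
  finally have "(LINT x|lborel. complex_of_real (exp (- s * x\<^sup>2)) * iexp (t * x))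
      = complex_of_real (sqrt (2 * pi) / c * exp (- ((t / c)\<^sup>2) / 2))"
    using c by (simp add: scaleR_conv_of_real field_simps)
  also have "sqrt (2 * pi) / c = sqrt (pi / s)"
    using s by (simp add: c_def real_sqrt_divide[symmetric])
  also have "- ((t / c)\<^sup>2) / 2 = - t\<^sup>2 / (4 * s)"
    using c by (simp add: power_divide)
  finally show "(LINT x|lborel. complex_of_real (exp (- s * x\<^sup>2)) * iexp (t * x))
       = complex_of_real (sqrt (pi / s) * exp (- t\<^sup>2 / (4 * s)))" .
qed

text \<open>\<open>lborel\<close> is the image of a product of one-dimensional Lebesgue measures
  under the map assembling a vector from its coordinates, which reduces the claim to Fubini's
  theorem for products.\<close>

lemma integral_prod_Basis:
  fixes \<phi> :: "'a::euclidean_space \<Rightarrow> real \<Rightarrow> complex"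
  assumes "\<And>b. b \<in> Basis \<Longrightarrow> integrable lborel (\<phi> b)"
  shows "integrable lborel (\<lambda>x. \<Prod>b\<in>Basis. \<phi> b (x \<bullet> b))"
    and "(LINT x|lborel. (\<Prod>b\<in>Basis. \<phi> b (x \<bullet> b))) = (\<Prod>b\<in>Basis. LINT t|lborel. \<phi> b t)"
proof -
  interpret product_sigma_finite "\<lambda>b::'a. lborel :: real measure" ..
  have m[measurable]: "\<phi> b \<in> borel_measurable borel" if "b \<in> Basis" for b
    using assms[OF that] by auto
  have pm: "(\<lambda>x. \<Prod>b\<in>Basis. \<phi> b (x \<bullet> b)) \<in> borel_measurable borel"
  proof (rule borel_measurable_prod)
    fix b :: 'a assume "b \<in> Basis"
    then show "(\<lambda>x. \<phi> b (x \<bullet> b)) \<in> borel_measurable borel"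
      by (intro measurable_compose[OF _ m]) auto
  qed
  have cm: "(\<lambda>f. \<Sum>b\<in>Basis. f b *\<^sub>R b) \<in> (\<Pi>\<^sub>M b\<in>Basis. lborel) \<rightarrow>\<^sub>M (borel :: 'a measure)"
    by measurable
  have eq: "(\<Prod>b\<in>Basis. \<phi> b ((\<Sum>b\<in>Basis. f b *\<^sub>R b) \<bullet> b)) = (\<Prod>b\<in>Basis. \<phi> b (f b))" for f
    by (intro prod.cong) auto
  show "integrable lborel (\<lambda>x. \<Prod>b\<in>Basis. \<phi> b (x \<bullet> b))"
    by (subst lborel_eq, subst integrable_distr_eq[OF cm pm], unfold eq)
       (intro product_integrable_prod assms finite_Basis)
  show "(LINT x|lborel. (\<Prod>b\<in>Basis. \<phi> b (x \<bullet> b))) = (\<Prod>b\<in>Basis. LINT t|lborel. \<phi> b t)"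
    by (subst lborel_eq, subst integral_distr[OF cm pm], unfold eq)
       (intro product_integral_prod assms finite_Basis)
qed

section \<open>Characters, the Gaussian and its transform\<close>

lemma norm_character [simp]: "norm (character b \<alpha>) = 1"
proof -
  have "character b \<alpha> = exp (\<i> * of_real (- (2 * pi * (\<alpha> \<bullet> b))))"
    by (simp add: character_def algebra_simps)
  then show ?thesis by (simp only: norm_exp_i_times)
qed

lemma character_commute: "character b \<alpha> = character \<alpha> b"
  by (simp add: character_def inner_commute)

lemma character_add: "character b (x + y) = character b x * character b y"
  by (simp add: character_def inner_add_left algebra_simps flip: exp_add)

lemma character_0 [simp]: "character b 0 = 1" "character 0 x = 1"
  by (simp_all add: character_def)

lemma cnj_character: "cnj (character b x) = character b (- x)" "cnj (character b x) = character (- b) x"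
  by (simp_all add: character_def exp_cnj)

lemma character_mult_cnj [simp]: "character b x * cnj (character b x) = 1"
  by (simp add: complex_norm_square[symmetric])

lemma character_measurable [measurable]:
  "f \<in> borel_measurable M \<Longrightarrow> g \<in> borel_measurable M \<Longrightarrow> (\<lambda>x. character (f x) (g x)) \<in> borel_measurable M"
  unfolding character_def by measurable

definition gaussian :: "real \<Rightarrow> real^'n \<Rightarrow> complex" where
  "gaussian s x = of_real (exp (- s * (norm x)\<^sup>2))"

text \<open>The Fourier transform of \<open>gaussian s\<close>, concentrating at 0 as
  \<open>s\<close> tends to 0. It is real-valued so that it can serve as a density.\<close>

definition heat_kernel :: "real \<Rightarrow> real^'n \<Rightarrow> real" where
  "heat_kernel s x = sqrt (pi / s) ^ CARD('n) * exp (- pi\<^sup>2 / s * (norm x)\<^sup>2)"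

lemma gaussian_measurable [measurable]: "gaussian s \<in> borel_measurable borel"
  unfolding gaussian_def by measurable

lemma heat_kernel_measurable [measurable]: "heat_kernel s \<in> borel_measurable borel"
  unfolding heat_kernel_def by measurable

lemma heat_kernel_nonneg: "s > 0 \<Longrightarrow> heat_kernel s x \<ge> 0"
  by (simp add: heat_kernel_def)

lemma sum_Basis_inner_squared: "(\<Sum>b\<in>Basis. (x \<bullet> b)\<^sup>2) = (norm (x::'a::euclidean_space))\<^sup>2"
  unfolding power2_norm_eq_inner unfolding power2_eq_square by (rule euclidean_inner[symmetric])

text \<open>Character and Gaussian both factor over the coordinates, leaving one-dimensional
  integrals with frequencies \<open>- 2 * pi * (\<xi> \<bullet> b)\<close>; their square over
  \<open>4 * s\<close> is the \<open>pi\<^sup>2 / s\<close> in the kernel.\<close>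

lemma gaussian_fourier:
  fixes \<xi> :: "real^'n"
  assumes s: "s > 0"
  shows "integrable lborel (\<lambda>x. character \<xi> x * gaussian s x)"
    and "(LINT x|lborel. character \<xi> x * gaussian s x) = of_real (heat_kernel s \<xi>)"
proof -
  define \<phi> where "\<phi> b r = complex_of_real (exp (- s * r\<^sup>2)) * iexp ((- 2 * pi * (\<xi> \<bullet> b)) * r)"
    for b :: "real^'n" and r
  have eq: "character \<xi> x * gaussian s x = (\<Prod>b\<in>Basis. \<phi> b (x \<bullet> b))" for x
  proof -
    have "(\<Prod>b\<in>Basis. \<phi> b (x \<bullet> b)) = exp (\<Sum>b\<in>Basis. complex_of_real (- s * (x \<bullet> b)\<^sup>2)
        + \<i> * of_real ((- 2 * pi * (\<xi> \<bullet> b)) * (x \<bullet> b)))"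
      by (simp only: \<phi>_def exp_sum[OF finite_Basis] exp_add exp_of_real)
    also have "(\<Sum>b\<in>Basis. complex_of_real (- s * (x \<bullet> b)\<^sup>2)
        + \<i> * of_real ((- 2 * pi * (\<xi> \<bullet> b)) * (x \<bullet> b)))
       = of_real (- s * (\<Sum>b\<in>Basis. (x \<bullet> b)\<^sup>2)) + \<i> * of_real (- 2 * pi * (\<Sum>b\<in>Basis. (x \<bullet> b) * (\<xi> \<bullet> b)))"
      unfolding sum_distrib_left of_real_sum sum.distrib by (simp add: mult_ac)
    also have "(\<Sum>b\<in>Basis. (x \<bullet> b)\<^sup>2) = (norm x)\<^sup>2"
      by (rule sum_Basis_inner_squared)
    also have "(\<Sum>b\<in>Basis. (x \<bullet> b) * (\<xi> \<bullet> b)) = x \<bullet> \<xi>"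
      by (rule euclidean_inner[symmetric])
    finally show ?thesis
      unfolding exp_add exp_of_real by (simp add: character_def gaussian_def mult_ac)
  qed
  have int: "integrable lborel (\<phi> b)" for b
    unfolding \<phi>_def[abs_def] by (rule integrable_gaussian_real[OF s])
  show "integrable lborel (\<lambda>x. character \<xi> x * gaussian s x)"
    unfolding eq by (rule integral_prod_Basis) (rule int)
  have "(LINT x|lborel. character \<xi> x * gaussian s x) = (\<Prod>b\<in>Basis. LINT t|lborel. \<phi> b t)"
    unfolding eq by (rule integral_prod_Basis) (rule int)
  also have "\<dots> = (\<Prod>b\<in>(Basis :: (real^'n) set). of_real (sqrt (pi / s) * exp (- (- 2 * pi * (\<xi> \<bullet> b))\<^sup>2 / (4 * s))))"
    unfolding \<phi>_def by (intro prod.cong refl integrable_gaussian_real[OF s])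
  also have "\<dots> = of_real (sqrt (pi / s) ^ CARD('n) *
      (\<Prod>b\<in>(Basis :: (real^'n) set). exp (- pi\<^sup>2 / s * (\<xi> \<bullet> b)\<^sup>2)))"
    unfolding of_real_prod[symmetric] prod.distrib by (simp add: power_mult_distrib)
  also have "(\<Prod>b\<in>(Basis :: (real^'n) set). exp (- pi\<^sup>2 / s * (\<xi> \<bullet> b)\<^sup>2)) = exp (- pi\<^sup>2 / s * (norm \<xi>)\<^sup>2)"
    unfolding exp_sum[OF finite_Basis, symmetric] sum_distrib_left[symmetric]
    by (simp add: sum_Basis_inner_squared)
  finally show "(LINT x|lborel. character \<xi> x * gaussian s x) = of_real (heat_kernel s \<xi>)"
    by (simp add: heat_kernel_def)
qed

lemma gaussian_integrable: "s > 0 \<Longrightarrow> integrable lborel (gaussian s :: real^'n \<Rightarrow> complex)"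
  using gaussian_fourier(1)[of s 0] by simp

lemma heat_kernel_eq_gaussian:
  "complex_of_real (heat_kernel s (x::real^'n)) = of_real (sqrt (pi / s) ^ CARD('n)) * gaussian (pi\<^sup>2 / s) x"
  by (simp add: heat_kernel_def gaussian_def)

text \<open>The kernel is a multiple of the Gaussian with parameter \<open>pi\<^sup>2\<close>, so
  its mass is read off from the transform of that Gaussian at 0.\<close>

lemma heat_kernel_integral_1:
  "integrable lborel (heat_kernel 1 :: real^'n \<Rightarrow> real)" "(LINT x|lborel. heat_kernel 1 (x :: real^'n)) = 1"
proof -
  have int: "integrable lborel (\<lambda>x :: real^'n. complex_of_real (heat_kernel 1 x))"
    unfolding heat_kernel_eq_gaussian by (intro integrable_mult_right gaussian_integrable) simp
  then show "integrable lborel (heat_kernel 1 :: real^'n \<Rightarrow> real)"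
    using complex_of_real_integrable_eq by blast
  have "complex_of_real (LINT x|lborel. heat_kernel 1 (x :: real^'n)) = (LINT x|lborel. complex_of_real (heat_kernel 1 (x :: real^'n)))"
    by simp
  also have "\<dots> = of_real (sqrt pi ^ CARD('n)) * of_real (heat_kernel (pi\<^sup>2) (0 :: real^'n))"
    unfolding heat_kernel_eq_gaussian[of 1] using gaussian_fourier(2)[of "pi\<^sup>2" "0 :: real^'n"] by simp
  also have "\<dots> = of_real ((sqrt pi * sqrt (pi / pi\<^sup>2)) ^ CARD('n))"
    by (simp add: heat_kernel_def power_mult_distrib)
  also have "sqrt pi * sqrt (pi / pi\<^sup>2) = 1"
    by (simp add: real_sqrt_mult[symmetric] power2_eq_square)
  finally show "(LINT x|lborel. heat_kernel 1 (x :: real^'n)) = 1"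
    by simp
qed

text \<open>Rescaling moves the parameter \<open>s\<close> out of the kernel and into the
  translation, so the limit in \<open>s\<close> can be taken against one fixed density.\<close>

lemma heat_kernel_scale:
  assumes "s > 0"
  shows "sqrt s ^ CARD('n) * heat_kernel s (sqrt s *\<^sub>R (y :: real^'n)) = heat_kernel 1 y"
  using assms by (simp add: heat_kernel_def power_mult_distrib real_sqrt_divide power_divide)

section \<open>Affine substitutions in Lebesgue integrals\<close>

lemma lborel_integral_affine:
  fixes f :: "'a::euclidean_space \<Rightarrow> 'b::{banach, second_countable_topology}"
  assumes c: "c \<noteq> 0" and [measurable]: "f \<in> borel_measurable borel"
  shows "(LINT x|lborel. f x) = (\<bar>c\<bar> ^ DIM('a)) *\<^sub>R (LINT x|lborel. f (t + c *\<^sub>R x))"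
  by (subst lborel_affine[OF c, of t], subst integral_density) (auto simp: integral_distr)

lemma lborel_integrable_affine:
  fixes f :: "'a::euclidean_space \<Rightarrow> 'b::{banach, second_countable_topology}"
  assumes c: "c \<noteq> 0" and f: "integrable lborel f"
  shows "integrable lborel (\<lambda>x. f (t + c *\<^sub>R x))"
proof -
  have [measurable]: "f \<in> borel_measurable borel" using f by auto
  have "integrable (density (distr lborel borel (\<lambda>x. t + c *\<^sub>R x)) (\<lambda>_. \<bar>c\<bar> ^ DIM('a))) f"
    using f lborel_affine[OF c, of t] by simp
  then have "integrable (distr lborel borel (\<lambda>x. t + c *\<^sub>R x)) (\<lambda>x. (\<bar>c\<bar> ^ DIM('a)) *\<^sub>R f x)"
    by (subst (asm) integrable_density) auto
  then have "integrable lborel (\<lambda>x. (\<bar>c\<bar> ^ DIM('a)) *\<^sub>R f (t + c *\<^sub>R x))"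
    by (subst (asm) integrable_distr_eq) auto
  from integrable_scaleR_right[OF this, of "inverse (\<bar>c\<bar> ^ DIM('a))"] show ?thesis
    using c by simp
qed

lemma lborel_integral_shift:
  fixes f :: "'a::euclidean_space \<Rightarrow> 'b::{banach, second_countable_topology}"
  assumes [measurable]: "f \<in> borel_measurable borel"
  shows "(LINT x|lborel. f (x - a)) = (LINT x|lborel. f x)"
  using lborel_integral_affine[of 1 f "-a"] by simp

lemma lborel_integrable_shift:
  fixes f :: "'a::euclidean_space \<Rightarrow> 'b::{banach, second_countable_topology}"
  shows "integrable lborel f \<Longrightarrow> integrable lborel (\<lambda>x. f (x - a))"
  using lborel_integrable_affine[of 1 f "-a"] by simp

lemma lborel_integral_reflect:
  fixes f :: "'a::euclidean_space \<Rightarrow> 'b::{banach, second_countable_topology}"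
  assumes [measurable]: "f \<in> borel_measurable borel"
  shows "(LINT x|lborel. f (a - x)) = (LINT x|lborel. f x)"
  using lborel_integral_affine[of "-1" f a] by simp

lemma lborel_integrable_reflect:
  fixes f :: "'a::euclidean_space \<Rightarrow> 'b::{banach, second_countable_topology}"
  shows "integrable lborel f \<Longrightarrow> integrable lborel (\<lambda>x. f (a - x))"
  using lborel_integrable_affine[of "-1" f a] by simp

section \<open>Fourier transforms of integrable functions\<close>

text \<open>A bounded factor preserves integrability of \<open>f x * h y\<close> on the product
  space. The kernels used are characters and their conjugates, with \<open>C = 1\<close>, and
  conjugated shifts of a bounded function, with \<open>C = B\<close>.\<close>

lemma Fubini_bounded_kernel:
  fixes f :: "'a::euclidean_space \<Rightarrow> complex" and h :: "'b::euclidean_space \<Rightarrow> complex"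
  assumes f: "integrable lborel f" and h: "integrable lborel h"
    and k: "(\<lambda>(x, y). k x y) \<in> borel_measurable (borel \<Otimes>\<^sub>M borel)"
    and C: "\<And>x y. norm (k x y) \<le> C"
  shows "(LINT x|lborel. f x * (LINT y|lborel. k x y * h y)) = (LINT y|lborel. (LINT x|lborel. f x * k x y) * h y)"
proof -
  note [measurable] = k borel_measurable_integrable[OF f] borel_measurable_integrable[OF h]
  have [measurable]: "f \<in> borel_measurable borel" "h \<in> borel_measurable borel"
    using f h by auto
  have "integrable (lborel \<Otimes>\<^sub>M lborel) (\<lambda>(x, y). f x * h y)"
  proof (rule lborel_pair.Fubini_integrable)
    have "integrable lborel (\<lambda>x. norm (f x) * (LINT y|lborel. norm (h y)))"
      using f by simp
    then show "integrable lborel (\<lambda>x. LINT y|lborel. norm (case (x, y) of (x, y) \<Rightarrow> f x * h y))"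
      by (simp add: norm_mult)
  qed (use h in auto)
  then have "integrable (lborel \<Otimes>\<^sub>M lborel) (\<lambda>z. C *\<^sub>R norm (case z of (x, y) \<Rightarrow> f x * h y))"
    by (intro integrable_scaleR_right integrable_norm)
  then have "integrable (lborel \<Otimes>\<^sub>M lborel) (\<lambda>(x, y). f x * k x y * h y)"
  proof (rule Bochner_Integration.integrable_bound)
    have "norm (f x * k x y * h y) \<le> norm (C * norm (f x * h y))" for x y
    proof -
      have "norm (f x * k x y * h y) = norm (k x y) * norm (f x * h y)"
        by (simp add: norm_mult)
      also have "\<dots> \<le> C * norm (f x * h y)"
        by (intro mult_right_mono C) auto
      also have "\<dots> \<le> norm (C * norm (f x * h y))" by simp
      finally show ?thesis .
    qed
    then show "AE z in lborel \<Otimes>\<^sub>M lborel. norm (case z of (x, y) \<Rightarrow> f x * k x y * h y)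
        \<le> norm (C *\<^sub>R norm (case z of (x, y) \<Rightarrow> f x * h y))"
      by (intro AE_I2) (auto split: prod.split)
  qed measurable
  note Fub = lborel_pair.Fubini_integral[OF this]
  have "(LINT y|lborel. f x * k x y * h y) = f x * (LINT y|lborel. k x y * h y)" for x
    by (simp add: mult.assoc)
  with Fub show ?thesis by simp
qed

lemma fourier_L1_measurable [measurable]:
  assumes [measurable]: "f \<in> borel_measurable borel"
  shows "fourier_L1 f \<in> borel_measurable borel"
  unfolding fourier_L1_def[abs_def] by measurable

lemma norm_fourier_L1_le: "norm (fourier_L1 f \<xi>) \<le> (LINT x|lborel. norm (f x))"
proof -
  have "norm (fourier_L1 f \<xi>) \<le> (LINT x|lborel. norm (character \<xi> x * f x))"
    unfolding fourier_L1_def by (rule integral_norm_bound)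
  then show ?thesis by (simp add: norm_mult)
qed

lemma character_mult_integrable:
  assumes "integrable lborel f"
  shows "integrable lborel (\<lambda>x. character \<xi> x * f x)"
  by (rule Bochner_Integration.integrable_bound[OF assms]) (use assms in \<open>auto simp: norm_mult\<close>)

lemma fourier_L1_multiplication:
  assumes "integrable lborel f" "integrable lborel h"
  shows "(LINT \<xi>|lborel. fourier_L1 f \<xi> * h \<xi>) = (LINT x|lborel. f x * fourier_L1 h x)"
proof -
  have "(LINT x|lborel. f x * (LINT \<xi>|lborel. character \<xi> x * h \<xi>))
      = (LINT \<xi>|lborel. (LINT x|lborel. f x * character \<xi> x) * h \<xi>)"
    by (rule Fubini_bounded_kernel[where C = 1]) (use assms in auto)
  then show ?thesis
    by (simp add: fourier_L1_def mult.commute[of "f _"] character_commute[of _ "_ :: real^'a"] cong: integral_cong)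
qed

lemma heat_kernel_integrable:
  "s > 0 \<Longrightarrow> integrable lborel (\<lambda>x :: real^'n. complex_of_real (heat_kernel s x))"
  unfolding heat_kernel_eq_gaussian by (intro integrable_mult_right gaussian_integrable) simp

text \<open>Multiplication by the Gaussian becomes convolution with its transform: once the
  integrals are exchanged, the two characters merge into \<open>character (x - y) \<xi>\<close>, and
  the integral over \<open>\<xi>\<close> is the kernel at \<open>x - y\<close>.\<close>

lemma fourier_gaussian_damped:
  fixes h :: "real^'n \<Rightarrow> complex"
  assumes h: "integrable lborel h" and s: "s > 0"
  shows "fourier_L1 (\<lambda>\<xi>. cnj (fourier_L1 h \<xi>) * gaussian s \<xi>) x
       = (LINT t|lborel. cnj (h (x - t)) * of_real (heat_kernel s t))"
proof -
  have [measurable]: "h \<in> borel_measurable borel" using h by auto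
  have "fourier_L1 (\<lambda>\<xi>. cnj (fourier_L1 h \<xi>) * gaussian s \<xi>) x
      = (LINT \<xi>|lborel. (character x \<xi> * gaussian s \<xi>) * (LINT y|lborel. cnj (character \<xi> y) * cnj (h y)))"
    by (simp add: fourier_L1_def mult_ac flip: Bochner_Integration.integral_cnj)
  also have "\<dots> = (LINT y|lborel. (LINT \<xi>|lborel. (character x \<xi> * gaussian s \<xi>) * cnj (character \<xi> y)) * cnj (h y))"
    by (rule Fubini_bounded_kernel[where C = 1])
       (use h gaussian_fourier(1)[OF s] in \<open>auto simp: case_prod_unfold\<close>)
  also have "\<dots> = (LINT y|lborel. of_real (heat_kernel s (x - y)) * cnj (h y))"
  proof (intro Bochner_Integration.integral_cong refl)
    fix y
    have "(character x \<xi> * gaussian s \<xi>) * cnj (character \<xi> y) = character (x - y) \<xi> * gaussian s \<xi>" for \<xi>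
      using character_add[of \<xi> x "- y"]
      by (simp add: cnj_character character_commute[of x] character_commute[of "x - y"])
    then show "(LINT \<xi>|lborel. (character x \<xi> * gaussian s \<xi>) * cnj (character \<xi> y)) * cnj (h y)
        = of_real (heat_kernel s (x - y)) * cnj (h y)"
      by (simp only: gaussian_fourier(2)[OF s])
  qed
  also have "\<dots> = (LINT t|lborel. of_real (heat_kernel s (x - (x - t))) * cnj (h (x - t)))"
    by (rule lborel_integral_reflect[symmetric]) measurable
  finally show ?thesis by (simp add: mult.commute)
qed

text \<open>The multiplication formula moves the transform from \<open>f\<close> to the damped
  factor, where it is known explicitly. The Gaussian makes that factor integrable, and the bound on
  \<open>h\<close> makes its shifts an admissible kernel for the second exchange of
  integrals.\<close>

lemma gaussian_pairing:
  fixes f h :: "real^'n \<Rightarrow> complex"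
  assumes f: "integrable lborel f" and h: "integrable lborel h" and B: "\<And>x. norm (h x) \<le> B" and s: "s > 0"
  shows "(LINT \<xi>|lborel. fourier_L1 f \<xi> * (cnj (fourier_L1 h \<xi>) * gaussian s \<xi>))
       = (LINT y|lborel. L2_inner f (translate (sqrt s *\<^sub>R y) h) * of_real (heat_kernel 1 y))"
proof -
  have [measurable]: "f \<in> borel_measurable borel" "h \<in> borel_measurable borel" using f h by auto
  have "integrable lborel (\<lambda>\<xi>. (LINT x|lborel. norm (h x)) *\<^sub>R gaussian s \<xi>)"
    using gaussian_integrable[OF s] by (rule integrable_scaleR_right)
  then have "integrable lborel (\<lambda>\<xi>. cnj (fourier_L1 h \<xi>) * gaussian s \<xi>)"
    by (rule Bochner_Integration.integrable_bound)
       (auto simp: norm_mult intro!: AE_I2 mult_right_mono norm_fourier_L1_le order_trans[OF norm_fourier_L1_le])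
  then have "(LINT \<xi>|lborel. fourier_L1 f \<xi> * (cnj (fourier_L1 h \<xi>) * gaussian s \<xi>))
      = (LINT x|lborel. f x * (LINT t|lborel. cnj (h (x - t)) * of_real (heat_kernel s t)))"
    using fourier_gaussian_damped[OF h s] by (simp add: fourier_L1_multiplication[OF f])
  also have "\<dots> = (LINT t|lborel. (LINT x|lborel. f x * cnj (h (x - t))) * of_real (heat_kernel s t))"
    by (rule Fubini_bounded_kernel[where C = B]) (use f B heat_kernel_integrable[OF s] in auto)
  \<comment> \<open>Substitution \<open>t = sqrt s *\<^sub>R y\<close>; the Jacobian is absorbed by
    \<open>heat_kernel_scale\<close>.\<close>
  also have "\<dots> = (\<bar>sqrt s\<bar> ^ DIM(real^'n)) *\<^sub>R (LINT y|lborel.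
      (LINT x|lborel. f x * cnj (h (x - (0 + sqrt s *\<^sub>R y)))) * of_real (heat_kernel s (0 + sqrt s *\<^sub>R y)))"
    by (rule lborel_integral_affine) (use s in auto)
  also have "\<dots> = (LINT y|lborel. (sqrt s ^ CARD('n)) *\<^sub>R
      ((LINT x|lborel. f x * cnj (h (x - sqrt s *\<^sub>R y))) * of_real (heat_kernel s (sqrt s *\<^sub>R y))))"
    using s by simp
  also have "\<dots> = (LINT y|lborel. L2_inner f (translate (sqrt s *\<^sub>R y) h) * of_real (heat_kernel 1 y))"
    by (simp add: heat_kernel_scale[OF s, symmetric] L2_inner_def translate_def scaleR_conv_of_real mult_ac)
  finally show ?thesis .
qed

section \<open>Translation in \<open>L2\<close> and its continuity in \<open>L1\<close>\<close>

lemma translate_measurable [measurable]: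
  assumes [measurable]: "f \<in> borel_measurable borel"
  shows "translate a f \<in> borel_measurable borel"
  unfolding translate_def by measurable

lemma translate_L2:
  assumes "f \<in> L2" shows "translate a f \<in> L2"
  using lborel_integrable_shift[OF L2_integrable[OF assms], of a] translate_measurable[OF L2_measurable[OF assms], of a]
  by (simp add: L2_iff translate_def)

lemma L2_norm_translate:
  assumes "f \<in> L2" shows "L2_norm (translate a f) = L2_norm f"
proof -
  have [measurable]: "f \<in> borel_measurable borel" using assms by (rule L2_measurable)
  show ?thesis
    unfolding L2_norm_eq translate_def using lborel_integral_shift[of "\<lambda>x. (norm (f x))\<^sup>2" a] by simp
qed

lemma L2_boundedI:
  assumes f: "integrable lborel f" and B: "\<And>x. norm (f x) \<le> B"
  shows "f \<in> L2"
proof -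
  have [measurable]: "f \<in> borel_measurable borel" using f by auto
  have "integrable lborel (\<lambda>x. B * norm (f x))" using f by simp
  then have "integrable lborel (\<lambda>x. (norm (f x))\<^sup>2)"
    by (rule Bochner_Integration.integrable_bound)
       (use B in \<open>auto simp: power2_eq_square intro!: AE_I2 mult_right_mono order_trans[OF _ abs_ge_self]\<close>)
  then show ?thesis by (simp add: L2_iff)
qed

text \<open>Translation preserves the \<open>L1\<close> norm, so the error for \<open>h\<close> is
  at most that for \<open>g\<close> plus twice the distance of \<open>h\<close> from
  \<open>g\<close>: the budget is \<open>r / 2\<close> and two times \<open>r / 4\<close>. It serves
  both the passage from open to measurable sets and the passage to limits.\<close>

lemma L1_shift_closure:
  fixes h :: "real^'n \<Rightarrow> complex" and t :: "nat \<Rightarrow> real^'n"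
  assumes h: "integrable lborel h"
    and approx: "\<And>\<epsilon>. \<epsilon> > 0 \<Longrightarrow> \<exists>g. integrable lborel g \<and> (LINT x|lborel. norm (h x - g x)) < \<epsilon> \<and>
        (\<lambda>n. LINT x|lborel. norm (g (x - t n) - g x)) \<longlonglongrightarrow> 0"
  shows "(\<lambda>n. LINT x|lborel. norm (h (x - t n) - h x)) \<longlonglongrightarrow> 0"
proof (rule LIMSEQ_I)
  fix r :: real assume "r > 0"
  then obtain g where g: "integrable lborel g" and le: "(LINT x|lborel. norm (h x - g x)) < r / 4"
    and lim: "(\<lambda>n. LINT x|lborel. norm (g (x - t n) - g x)) \<longlonglongrightarrow> 0"
    using approx[of "r / 4"] by auto
  obtain N where "\<forall>n\<ge>N. norm ((LINT x|lborel. norm (g (x - t n) - g x)) - 0) < r / 2"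
    using LIMSEQ_D[OF lim, of "r / 2"] \<open>r > 0\<close> by auto
  then have N: "(LINT x|lborel. norm (g (x - t n) - g x)) < r / 2" if "n \<ge> N" for n
    using that by (auto simp: abs_less_iff)
  have [measurable]: "h \<in> borel_measurable borel" "g \<in> borel_measurable borel" using h g by auto
  have int: "integrable lborel (\<lambda>x. norm (h (x - t n) - g (x - t n)))"
    "integrable lborel (\<lambda>x. norm (g (x - t n) - g x))" "integrable lborel (\<lambda>x. norm (h x - g x))" for n
    using h g by (auto intro!: lborel_integrable_shift Bochner_Integration.integrable_diff)
  have "(LINT x|lborel. norm (h (x - t n) - h x)) < r" if "n \<ge> N" for n
  proof -
    have "(LINT x|lborel. norm (h (x - t n) - h x)) \<le> (LINT x|lborel.
        (norm (h (x - t n) - g (x - t n)) + norm (g (x - t n) - g x)) + norm (h x - g x))"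
    proof (rule integral_mono)
      show "integrable lborel (\<lambda>x. norm (h (x - t n) - h x))"
        using h by (auto intro!: lborel_integrable_shift Bochner_Integration.integrable_diff)
      show "norm (h (x - t n) - h x)
          \<le> (norm (h (x - t n) - g (x - t n)) + norm (g (x - t n) - g x)) + norm (h x - g x)" for x
        using norm_triangle_ineq[of "h (x - t n) - g (x - t n)" "g (x - t n) - g x"]
          norm_triangle_ineq4[of "(h (x - t n) - g (x - t n)) + (g (x - t n) - g x)" "h x - g x"] by simp
    qed (intro Bochner_Integration.integrable_add int)
    also have "\<dots> = (LINT x|lborel. norm (h (x - t n) - g (x - t n)))
        + (LINT x|lborel. norm (g (x - t n) - g x)) + (LINT x|lborel. norm (h x - g x))"
      by (simp only: Bochner_Integration.integral_add Bochner_Integration.integrable_add int)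
    also have "(LINT x|lborel. norm (h (x - t n) - g (x - t n))) = (LINT x|lborel. norm (h x - g x))"
      using lborel_integral_shift[of "\<lambda>x. norm (h x - g x)" "t n"] by simp
    finally show ?thesis using le N[OF that] by linarith
  qed
  then show "\<exists>no. \<forall>n\<ge>no. norm ((LINT x|lborel. norm (h (x - t n) - h x)) - 0) < r"
    by (intro exI[of _ N]) auto
qed

text \<open>At boundary points of \<open>U\<close> the shifted indicators need not converge. The
  argument therefore looks at the overlap, where openness gives pointwise convergence on
  \<open>U\<close>, and uses that the symmetric difference has measure
  \<open>2 |U| - 2 |U \<inter> (U + t n)|\<close>.\<close>

lemma L1_shift_open:
  fixes t :: "nat \<Rightarrow> real^'n" and c :: complex
  assumes t: "t \<longlonglongrightarrow> 0" and U: "open U" "emeasure lborel U < \<infinity>"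
  shows "(\<lambda>n. LINT x|lborel. norm (indicator U (x - t n) *\<^sub>R c - indicator U x *\<^sub>R c)) \<longlonglongrightarrow> 0"
proof -
  have [measurable]: "U \<in> sets borel" using U by simp
  have int: "integrable lborel (\<lambda>x. indicator U x :: real)"
    using U by (intro integrable_real_indicator) auto
  have int': "integrable lborel (\<lambda>x. indicator U (x - a) :: real)" for a
    by (rule lborel_integrable_shift[OF int])
  have int2: "integrable lborel (\<lambda>x. indicator U (x - a) * indicator U x :: real)" for a
    by (rule Bochner_Integration.integrable_bound[OF int]) (auto simp: indicator_def)
  have lim: "(\<lambda>n. LINT x|lborel. indicator U (x - t n) * indicator U x :: real)
      \<longlonglongrightarrow> (LINT x|lborel. indicator U x)"
  proof (rule integral_dominated_convergence[OF _ _ int])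
    have "(\<lambda>n. indicator U (x - t n) * indicator U x :: real) \<longlonglongrightarrow> indicator U x" for x
    proof (cases "x \<in> U")
      case True
      have "(\<lambda>n. x - t n) \<longlonglongrightarrow> x - 0" by (intro tendsto_intros t)
      then have "\<forall>\<^sub>F n in sequentially. x - t n \<in> U"
        using topological_tendstoD U True by fastforce
      then have "\<forall>\<^sub>F n in sequentially. (1::real) = indicator U (x - t n) * indicator U x"
        by eventually_elim (use True in simp)
      then show ?thesis using True by (auto intro: Lim_transform_eventually[OF tendsto_const])
    qed simp
    then show "AE x in lborel. (\<lambda>n. indicator U (x - t n) * indicator U x :: real) \<longlonglongrightarrow> indicator U x"
      by simp
  qed (auto simp: indicator_def)
  have "(\<lambda>n. norm c * (2 * (LINT x|lborel. indicator U x) - 2 * (LINT x|lborel. indicator U (x - t n) * indicator U x)))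
      \<longlonglongrightarrow> norm c * (2 * (LINT x|lborel. indicator U x) - 2 * (LINT x|lborel. indicator U x))"
    by (intro tendsto_intros lim)
  moreover have "(LINT x|lborel. norm (indicator U (x - t n) *\<^sub>R c - indicator U x *\<^sub>R c))
      = norm c * (2 * (LINT x|lborel. indicator U x) - 2 * (LINT x|lborel. indicator U (x - t n) * indicator U x))" for n
  proof -
    have "(LINT x|lborel. norm (indicator U (x - t n) *\<^sub>R c - indicator U x *\<^sub>R c))
        = (LINT x|lborel. norm c * ((indicator U (x - t n) + indicator U x) - 2 * (indicator U (x - t n) * indicator U x)))"
      by (intro Bochner_Integration.integral_cong refl) (auto simp: indicator_def)
    also have "\<dots> = norm c * (((LINT x|lborel. indicator U (x - t n)) + (LINT x|lborel. indicator U x))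
        - 2 * (LINT x|lborel. indicator U (x - t n) * indicator U x))"
      by (simp add: int int' int2)
    also have "(LINT x|lborel. indicator U (x - t n) :: real) = (LINT x|lborel. indicator U x)"
      by (rule lborel_integral_shift) measurable
    finally show ?thesis by simp
  qed
  ultimately show ?thesis by simp
qed

lemma L1_shift_tendsto:
  fixes h :: "real^'n \<Rightarrow> complex" and t :: "nat \<Rightarrow> real^'n"
  assumes h: "integrable lborel h" and t: "t \<longlonglongrightarrow> 0"
  shows "(\<lambda>n. LINT x|lborel. norm (h (x - t n) - h x)) \<longlonglongrightarrow> 0"
  using h
proof (induction rule: integrable_induct)
  case (base A c)
  show ?case
  proof (rule L1_shift_closure)
    have [measurable]: "A \<in> sets borel" using base by simp
    show "integrable lborel (\<lambda>x. indicator A x *\<^sub>R c)" using base by simp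
    fix \<epsilon> :: real assume "\<epsilon> > 0"
    \<comment> \<open>Approximating \<open>A\<close> by an open set within \<open>\<delta>\<close>
      costs \<open>norm c * \<delta> < \<epsilon>\<close>; the added 1 covers
      \<open>c = 0\<close>.\<close>
    define \<delta> where "\<delta> = \<epsilon> / (norm c + 1)"
    have \<delta>: "\<delta> > 0" using \<open>\<epsilon> > 0\<close> by (simp add: \<delta>_def add_nonneg_pos)
    obtain U where U: "open U" "A \<subseteq> U" "emeasure lborel (U - A) < \<delta>"
      using outer_regular_lborel[of A \<delta>] \<delta> by auto
    have [measurable]: "U \<in> sets borel" using U by simp
    have "emeasure lborel U = emeasure lborel A + emeasure lborel (U - A)"
      using U by (subst plus_emeasure) (auto simp: Un_absorb1)
    then have finU: "emeasure lborel U < \<infinity>"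
      using base U(3) by (simp add: less_top[symmetric]) (metis ennreal_less_top less_trans order_less_irrefl)
    have finD: "emeasure lborel (U - A) < \<infinity>"
      using U(3) by (rule less_trans) simp
    have "(LINT x|lborel. norm (indicator A x *\<^sub>R c - indicator U x *\<^sub>R c)) = (LINT x|lborel. norm c * indicator (U - A) x)"
      using U(2) by (intro Bochner_Integration.integral_cong refl) (auto simp: indicator_def)
    also have "\<dots> = norm c * measure lborel (U - A)" using finD by simp
    also have "\<dots> \<le> norm c * \<delta>"
      using U(3) finD \<delta> by (intro mult_left_mono) (auto simp: emeasure_eq_ennreal_measure ennreal_less_iff)
    also have "\<dots> < \<epsilon>"
    proof -
      have "norm c + 1 > 0" by (simp add: add_nonneg_pos)
      then show ?thesis using \<open>\<epsilon> > 0\<close> by (simp add: \<delta>_def field_simps)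
    qed
    finally show "\<exists>g. integrable lborel g \<and> (LINT x|lborel. norm (indicator A x *\<^sub>R c - g x)) < \<epsilon> \<and>
        (\<lambda>n. LINT x|lborel. norm (g (x - t n) - g x)) \<longlonglongrightarrow> 0"
      using L1_shift_open[OF t U(1) finU, of c] finU
      by (intro exI[of _ "\<lambda>x. indicator U x *\<^sub>R c"]) auto
  qed
next
  case (add f g)
  have [measurable]: "f \<in> borel_measurable borel" "g \<in> borel_measurable borel" using add by auto
  have int: "integrable lborel (\<lambda>x. norm (f (x - t n) - f x))" "integrable lborel (\<lambda>x. norm (g (x - t n) - g x))" for n
    using add by (auto intro!: lborel_integrable_shift Bochner_Integration.integrable_diff)
  show ?case
  proof (rule tendsto_sandwich[OF _ _ tendsto_const])
    show "(\<lambda>n. (LINT x|lborel. norm (f (x - t n) - f x)) + (LINT x|lborel. norm (g (x - t n) - g x))) \<longlonglongrightarrow> 0"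
      using tendsto_add[OF add(3,4)] by simp
    have "(LINT x|lborel. norm (f (x - t n) + g (x - t n) - (f x + g x)))
        \<le> (LINT x|lborel. norm (f (x - t n) - f x) + norm (g (x - t n) - g x))" for n
    proof (rule integral_mono)
      show "integrable lborel (\<lambda>x. norm (f (x - t n) + g (x - t n) - (f x + g x)))"
        using add by (auto intro!: lborel_integrable_shift Bochner_Integration.integrable_diff)
      show "norm (f (x - t n) + g (x - t n) - (f x + g x)) \<le> norm (f (x - t n) - f x) + norm (g (x - t n) - g x)" for x
        by (rule norm_diff_triangle_ineq)
    qed (intro Bochner_Integration.integrable_add int)
    then show "\<forall>\<^sub>F n in sequentially. (LINT x|lborel. norm (f (x - t n) + g (x - t n) - (f x + g x)))
        \<le> (LINT x|lborel. norm (f (x - t n) - f x)) + (LINT x|lborel. norm (g (x - t n) - g x))"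
      by (simp add: int)
  qed simp
next
  case (lim f s)
  show ?case
  proof (rule L1_shift_closure[OF lim(4)])
    fix \<epsilon> :: real assume "\<epsilon> > 0"
    have [measurable]: "f \<in> borel_measurable borel" "s n \<in> borel_measurable borel" for n using lim by auto
    have "(\<lambda>n. LINT x|lborel. norm (f x - s n x)) \<longlonglongrightarrow> integral\<^sup>L lborel (\<lambda>x :: real^'n. 0 :: real)"
    proof (rule integral_dominated_convergence)
      \<comment> \<open>The induction rule supplies approximants with
        \<open>norm (s n x) \<le> 2 * norm (f x)\<close>, whence the factor 3.\<close>
      show "integrable lborel (\<lambda>x. 3 * norm (f x))" using lim(4) by simp
      have "(\<lambda>n. norm (f x - s n x)) \<longlonglongrightarrow> norm (f x - f x)" for x
        by (intro tendsto_intros lim(2)) simp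
      then show "AE x in lborel. (\<lambda>n. norm (f x - s n x)) \<longlonglongrightarrow> 0" by simp
      show "AE x in lborel. norm (norm (f x - s n x)) \<le> 3 * norm (f x)" for n
      proof (rule AE_I2)
        fix x
        show "norm (norm (f x - s n x)) \<le> 3 * norm (f x)"
          using norm_triangle_ineq4[of "f x" "s n x"] lim(3)[of x n] by simp
      qed
    qed auto
    from LIMSEQ_D[OF this \<open>\<epsilon> > 0\<close>] obtain n where "(LINT x|lborel. norm (f x - s n x)) < \<epsilon>" by auto
    then show "\<exists>g. integrable lborel g \<and> (LINT x|lborel. norm (f x - g x)) < \<epsilon> \<and>
        (\<lambda>n. LINT x|lborel. norm (g (x - t n) - g x)) \<longlonglongrightarrow> 0"
      using lim(1,5) by blast
  qed
qed

section \<open>Plancherel theory\<close>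

lemma norm_gaussian: "norm (gaussian s x) = exp (- s * (norm x)\<^sup>2)"
  by (simp add: gaussian_def)

lemma gaussian_tendsto_1:
  assumes "s \<longlonglongrightarrow> 0" shows "(\<lambda>n. gaussian (s n) x) \<longlonglongrightarrow> 1"
proof -
  have "(\<lambda>n. complex_of_real (exp (- s n * (norm x)\<^sup>2))) \<longlonglongrightarrow> of_real (exp (- 0 * (norm x)\<^sup>2))"
    by (intro tendsto_intros assms)
  then show ?thesis by (simp add: gaussian_def)
qed

section \<open>The contraction property on \<open>L1 \<inter> L2\<close>\<close>

text \<open>Each shifted inner product obeys the Cauchy-Schwarz bound with the norm of the unshifted
  \<open>h\<close>, and the density has mass 1. What matters is that the bound does not depend on
  \<open>s\<close>.\<close>

lemma norm_gaussian_pairing_le: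
  fixes f h :: "real^'n \<Rightarrow> complex"
  assumes f: "integrable lborel f" "f \<in> L2" and h: "integrable lborel h" "\<And>x. norm (h x) \<le> B" and s: "s > 0"
  shows "norm (LINT \<xi>|lborel. fourier_L1 f \<xi> * (cnj (fourier_L1 h \<xi>) * gaussian s \<xi>)) \<le> L2_norm f * L2_norm h"
proof -
  have hL2: "h \<in> L2" by (rule L2_boundedI[OF h])
  have [measurable]: "f \<in> borel_measurable borel" "h \<in> borel_measurable borel" using f h by auto
  have bound: "norm (L2_inner f (translate (sqrt s *\<^sub>R y) h) * of_real (heat_kernel 1 y))
      \<le> L2_norm f * L2_norm h * heat_kernel 1 y" for y
    using L2_Cauchy_Schwarz[OF f(2) translate_L2[OF hL2], of "sqrt s *\<^sub>R y"]
    by (auto simp: norm_mult heat_kernel_nonneg L2_norm_translate[OF hL2] intro!: mult_right_mono)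
  have int: "integrable lborel (\<lambda>y :: real^'n. L2_norm f * L2_norm h * heat_kernel 1 y)"
    using heat_kernel_integral_1(1) by (rule integrable_mult_right)
  have "norm (LINT \<xi>|lborel. fourier_L1 f \<xi> * (cnj (fourier_L1 h \<xi>) * gaussian s \<xi>))
      = norm (LINT y|lborel. L2_inner f (translate (sqrt s *\<^sub>R y) h) * of_real (heat_kernel 1 y))"
    by (simp only: gaussian_pairing[OF f(1) h s])
  also have "\<dots> \<le> (LINT y :: real^'n|lborel. L2_norm f * L2_norm h * heat_kernel 1 y)"
  proof (rule Bochner_Integration.integral_norm_bound_integral[OF _ int bound])
    show "integrable lborel (\<lambda>y. L2_inner f (translate (sqrt s *\<^sub>R y) h) * of_real (heat_kernel 1 y))"
    proof (rule Bochner_Integration.integrable_bound[OF int])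
      show "(\<lambda>y. L2_inner f (translate (sqrt s *\<^sub>R y) h) * of_real (heat_kernel 1 y)) \<in> borel_measurable lborel"
        unfolding L2_inner_def translate_def by measurable
      show "AE y in lborel. norm (L2_inner f (translate (sqrt s *\<^sub>R y) h) * of_real (heat_kernel 1 y))
          \<le> norm (L2_norm f * L2_norm h * heat_kernel 1 y)"
        by (rule AE_I2, unfold real_norm_def) (rule order_trans[OF bound abs_ge_self])
    qed
  qed
  also have "\<dots> = L2_norm f * L2_norm h"
    by (simp add: heat_kernel_integral_1)
  finally show ?thesis .
qed

lemma fourier_L1_contraction_bounded:
  fixes f :: "real^'n \<Rightarrow> complex"
  assumes f: "integrable lborel f" "\<And>x. norm (f x) \<le> B"
  shows "fourier_L1 f \<in> L2" "L2_norm (fourier_L1 f) \<le> L2_norm f"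
proof -
  have fL2: "f \<in> L2" by (rule L2_boundedI[OF f])
  have [measurable]: "f \<in> borel_measurable borel" using f by auto
  define s where "s m = inverse (real (Suc m))" for m
  have s: "s m > 0" for m by (simp add: s_def)
  \<comment> \<open>Half the parameter, because the squared modulus of \<open>\<psi> m\<close> must
    contain \<open>gaussian (s m)\<close>; pairing \<open>f\<close> with itself then bounds its norm
    by that of \<open>f\<close>, and Fatou's lemma removes the damping.\<close>
  define \<psi> where "\<psi> m \<xi> = fourier_L1 f \<xi> * gaussian (s m / 2) \<xi>" for m \<xi>
  have psiL2: "\<psi> m \<in> L2" for m
  proof -
    define C where "C = (LINT x|lborel. norm (f x))"
    have "integrable lborel (\<lambda>\<xi>. C\<^sup>2 * norm (gaussian (s m) \<xi> :: complex))"
      using gaussian_integrable[OF s] by (intro integrable_mult_right integrable_norm)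
    then have "integrable lborel (\<lambda>\<xi>. (norm (\<psi> m \<xi>))\<^sup>2)"
    proof (rule Bochner_Integration.integrable_bound)
      show "AE \<xi> in lborel. norm ((norm (\<psi> m \<xi>))\<^sup>2) \<le> norm (C\<^sup>2 * norm (gaussian (s m) \<xi> :: complex))"
      proof (rule AE_I2)
        fix \<xi> :: "real^'n"
        have "(norm (fourier_L1 f \<xi>))\<^sup>2 \<le> C\<^sup>2"
          unfolding C_def by (intro power_mono norm_fourier_L1_le) auto
        moreover have "(norm (gaussian (s m / 2) \<xi>))\<^sup>2 = norm (gaussian (s m) \<xi>)"
          by (simp add: norm_gaussian power2_eq_square flip: exp_add)
        ultimately show "norm ((norm (\<psi> m \<xi>))\<^sup>2) \<le> norm (C\<^sup>2 * norm (gaussian (s m) \<xi> :: complex))"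
          by (simp add: \<psi>_def norm_mult power_mult_distrib mult_right_mono)
      qed
    qed (simp add: \<psi>_def[abs_def])
    then show ?thesis by (simp add: L2_iff \<psi>_def[abs_def])
  qed
  have bound: "L2_norm (\<psi> m) \<le> L2_norm f" for m
  proof -
    have "\<psi> m \<xi> * cnj (\<psi> m \<xi>) = fourier_L1 f \<xi> * (cnj (fourier_L1 f \<xi>) * gaussian (s m) \<xi>)" for \<xi>
    proof -
      have "gaussian (s m / 2) \<xi> * cnj (gaussian (s m / 2) \<xi>) = gaussian (s m) \<xi>"
        by (simp add: gaussian_def flip: of_real_mult exp_add)
      then show ?thesis by (simp add: \<psi>_def mult_ac)
    qed
    then have "complex_of_real ((L2_norm (\<psi> m))\<^sup>2)
        = (LINT \<xi>|lborel. fourier_L1 f \<xi> * (cnj (fourier_L1 f \<xi>) * gaussian (s m) \<xi>))"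
      unfolding L2_inner_self_norm[symmetric] L2_inner_def by simp
    then have "norm (complex_of_real ((L2_norm (\<psi> m))\<^sup>2)) \<le> L2_norm f * L2_norm f"
      using norm_gaussian_pairing_le[OF f(1) fL2 f s] by simp
    then have "(L2_norm (\<psi> m))\<^sup>2 \<le> (L2_norm f)\<^sup>2"
      by (simp only: norm_of_real power2_eq_square abs_mult_self_eq)
    then show ?thesis by (rule power2_le_imp_le) simp
  qed
  have "s \<longlonglongrightarrow> 0"
    unfolding s_def[abs_def] by (rule LIMSEQ_inverse_real_of_nat)
  from tendsto_divide[OF this tendsto_const[of 2]]
  have s0: "(\<lambda>m. s m / 2) \<longlonglongrightarrow> 0" by simp
  have lim: "AE \<xi> in lborel. (\<lambda>m. \<psi> m \<xi>) \<longlonglongrightarrow> fourier_L1 f \<xi>"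
  proof (rule AE_I2)
    fix \<xi>
    show "(\<lambda>m. \<psi> m \<xi>) \<longlonglongrightarrow> fourier_L1 f \<xi>"
      using tendsto_mult[OF tendsto_const[of "fourier_L1 f \<xi>"] gaussian_tendsto_1[OF s0, of \<xi>]]
      by (simp add: \<psi>_def)
  qed
  have m: "fourier_L1 f \<in> borel_measurable borel" by measurable
  show "fourier_L1 f \<in> L2" "L2_norm (fourier_L1 f) \<le> L2_norm f"
    using L2_Fatou[where N = 0, OF psiL2 m lim bound] by auto
qed

lemma L2_norm_mono:
  assumes "f \<in> L2" "g \<in> L2" "\<And>x. norm (f x) \<le> norm (g x)"
  shows "L2_norm f \<le> L2_norm g"
  unfolding L2_norm_eq using assms
  by (intro real_sqrt_le_mono integral_mono power_mono) (auto simp: L2_iff)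

text \<open>Truncations fall under the bounded case and their transforms converge pointwise because
  \<open>f\<close> is integrable; Fatou's lemma preserves the common bound.\<close>

lemma fourier_L1_contraction:
  fixes f :: "real^'n \<Rightarrow> complex"
  assumes f: "integrable lborel f" "f \<in> L2"
  shows "fourier_L1 f \<in> L2" "L2_norm (fourier_L1 f) \<le> L2_norm f"
proof -
  have [measurable]: "f \<in> borel_measurable borel" using f by auto
  note tr = fourier_L1_contraction_bounded[OF truncation_integrable[OF f(2)] norm_truncation_le(2)]
  have bound: "L2_norm (fourier_L1 (truncation n f)) \<le> L2_norm f" for n
    using tr(2)[of n] L2_norm_mono[OF truncation_L2[OF f(2)] f(2) norm_truncation_le(1), of n] by linarith
  have lim: "AE \<xi> in lborel. (\<lambda>n. fourier_L1 (truncation n f) \<xi>) \<longlonglongrightarrow> fourier_L1 f \<xi>"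
  proof (rule AE_I2)
    fix \<xi>
    show "(\<lambda>n. fourier_L1 (truncation n f) \<xi>) \<longlonglongrightarrow> fourier_L1 f \<xi>"
      unfolding fourier_L1_def
    proof (rule integral_dominated_convergence)
      show "integrable lborel (\<lambda>x. norm (f x))" using f by simp
      show "AE x in lborel. (\<lambda>n. character \<xi> x * truncation n f x) \<longlonglongrightarrow> character \<xi> x * f x"
        by (intro AE_I2 tendsto_intros truncation_pointwise)
      show "(\<lambda>x. character \<xi> x * truncation n f x) \<in> borel_measurable lborel" for n
        using truncation_measurable[OF f(2), of n] by simp
    qed (auto simp: norm_mult norm_truncation_le)
  qed
  have m: "fourier_L1 f \<in> borel_measurable borel" by measurable
  show "fourier_L1 f \<in> L2" "L2_norm (fourier_L1 f) \<le> L2_norm f"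
    using L2_Fatou[where N = 0, OF tr(1) m lim bound] by auto
qed

section \<open>Parseval's identity for bounded integrable functions\<close>

text \<open>Boundedness of \<open>f\<close> reduces the claim to continuity of translation of
  \<open>h\<close> in \<open>L1\<close>.\<close>

lemma L2_inner_translate_tendsto:
  fixes f h :: "real^'n \<Rightarrow> complex" and t :: "nat \<Rightarrow> real^'n"
  assumes f: "f \<in> L2" "\<And>x. norm (f x) \<le> B" and h: "integrable lborel h" "h \<in> L2" and t: "t \<longlonglongrightarrow> 0"
  shows "(\<lambda>n. L2_inner f (translate (t n) h)) \<longlonglongrightarrow> L2_inner f h"
proof -
  have [measurable]: "f \<in> borel_measurable borel" "h \<in> borel_measurable borel" using f h by (auto simp: L2_iff)
  have le: "norm (L2_inner f (translate (t n) h) - L2_inner f h) \<le> B * (LINT x|lborel. norm (h (x - t n) - h x))" for n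
  proof -
    have d: "translate (t n) h - h \<in> L2" by (intro L2_diff translate_L2 h)
    have int: "integrable lborel (\<lambda>x. norm (h (x - t n) - h x))"
      using h by (auto intro!: lborel_integrable_shift Bochner_Integration.integrable_diff)
    have "norm (L2_inner f (translate (t n) h) - L2_inner f h) = norm (L2_inner f (translate (t n) h - h))"
      by (simp add: L2_inner_diff_right f h translate_L2)
    also have "\<dots> \<le> (LINT x|lborel. B * norm (h (x - t n) - h x))"
      unfolding L2_inner_def
    proof (rule Bochner_Integration.integral_norm_bound_integral)
      show "integrable lborel (\<lambda>x. f x * cnj ((translate (t n) h - h) x))"
        by (rule L2_inner_integrable[OF f(1) d])
      show "norm (f x * cnj ((translate (t n) h - h) x)) \<le> B * norm (h (x - t n) - h x)" for x
        by (simp add: norm_mult translate_def mult_right_mono f(2) flip: complex_cnj_diff)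
    qed (use int in simp)
    finally show ?thesis by simp
  qed
  have "(\<lambda>n. B * (LINT x|lborel. norm (h (x - t n) - h x))) \<longlonglongrightarrow> B * 0"
    by (intro tendsto_intros L1_shift_tendsto h t)
  then have "(\<lambda>n. L2_inner f (translate (t n) h) - L2_inner f h) \<longlonglongrightarrow> 0"
    using Lim_null_comparison[OF always_eventually[OF allI[OF le]]] by simp
  then show ?thesis by (rule LIM_zero_cancel)
qed

text \<open>Both sides of \<open>gaussian_pairing\<close> converge by dominated convergence: the
  frequency side is dominated by a product of two \<open>L2\<close> functions, the other side by a
  multiple of the density.\<close>

lemma fourier_L1_Parseval:
  fixes f h :: "real^'n \<Rightarrow> complex"
  assumes f: "integrable lborel f" "\<And>x. norm (f x) \<le> B" and h: "integrable lborel h" "\<And>x. norm (h x) \<le> B"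
  shows "L2_inner (fourier_L1 f) (fourier_L1 h) = L2_inner f h"
proof -
  have L2: "f \<in> L2" "h \<in> L2" by (rule L2_boundedI[OF f], rule L2_boundedI[OF h])
  have [measurable]: "f \<in> borel_measurable borel" "h \<in> borel_measurable borel" using f h by auto
  define s where "s m = inverse (real (Suc m))" for m
  have s: "s m > 0" for m by (simp add: s_def)
  have s0: "s \<longlonglongrightarrow> 0"
    unfolding s_def[abs_def] by (rule LIMSEQ_inverse_real_of_nat)
  have F: "fourier_L1 f \<in> L2" "fourier_L1 h \<in> L2"
    using fourier_L1_contraction_bounded(1) f h by blast+
  have "(\<lambda>n. LINT \<xi>|lborel. fourier_L1 f \<xi> * (cnj (fourier_L1 h \<xi>) * gaussian (s n) \<xi>))
      \<longlonglongrightarrow> (LINT \<xi>|lborel. fourier_L1 f \<xi> * cnj (fourier_L1 h \<xi>))"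
  proof (rule integral_dominated_convergence)
    show "integrable lborel (\<lambda>\<xi>. norm (fourier_L1 f \<xi> * cnj (fourier_L1 h \<xi>)))"
      by (intro integrable_norm L2_inner_integrable F)
    show "AE \<xi> in lborel. (\<lambda>n. fourier_L1 f \<xi> * (cnj (fourier_L1 h \<xi>) * gaussian (s n) \<xi>))
        \<longlonglongrightarrow> fourier_L1 f \<xi> * cnj (fourier_L1 h \<xi>)"
    proof (rule AE_I2)
      fix \<xi>
      have "(\<lambda>n. fourier_L1 f \<xi> * (cnj (fourier_L1 h \<xi>) * gaussian (s n) \<xi>))
        \<longlonglongrightarrow> fourier_L1 f \<xi> * (cnj (fourier_L1 h \<xi>) * 1)"
        by (intro tendsto_intros gaussian_tendsto_1 s0)
      then show "(\<lambda>n. fourier_L1 f \<xi> * (cnj (fourier_L1 h \<xi>) * gaussian (s n) \<xi>))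
        \<longlonglongrightarrow> fourier_L1 f \<xi> * cnj (fourier_L1 h \<xi>)" by simp
    qed
    show "AE \<xi> in lborel. norm (fourier_L1 f \<xi> * (cnj (fourier_L1 h \<xi>) * gaussian (s n) \<xi>))
        \<le> norm (fourier_L1 f \<xi> * cnj (fourier_L1 h \<xi>))" for n
    proof (rule AE_I2)
      fix \<xi> :: "real^'n"
      have "norm (gaussian (s n) \<xi>) \<le> 1" using s[of n] by (simp add: norm_gaussian)
      then have "norm (fourier_L1 f \<xi> * cnj (fourier_L1 h \<xi>)) * norm (gaussian (s n) \<xi>)
          \<le> norm (fourier_L1 f \<xi> * cnj (fourier_L1 h \<xi>)) * 1"
        by (intro mult_left_mono) auto
      then show "norm (fourier_L1 f \<xi> * (cnj (fourier_L1 h \<xi>) * gaussian (s n) \<xi>))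
        \<le> norm (fourier_L1 f \<xi> * cnj (fourier_L1 h \<xi>))"
        by (simp add: norm_mult mult_ac)
    qed
  qed measurable
  then have "(\<lambda>n. LINT y|lborel. L2_inner f (translate (sqrt (s n) *\<^sub>R y) h) * of_real (heat_kernel 1 y))
      \<longlonglongrightarrow> L2_inner (fourier_L1 f) (fourier_L1 h)"
    by (simp only: gaussian_pairing[OF f(1) h s] L2_inner_def[of "fourier_L1 f"])
  moreover have "(\<lambda>n. LINT y|lborel. L2_inner f (translate (sqrt (s n) *\<^sub>R y) h) * of_real (heat_kernel 1 y))
      \<longlonglongrightarrow> (LINT y :: real^'n|lborel. L2_inner f h * of_real (heat_kernel 1 y))"
  proof (rule integral_dominated_convergence)
    show "integrable lborel (\<lambda>y :: real^'n. L2_norm f * L2_norm h * heat_kernel 1 y)"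
      using heat_kernel_integral_1(1) by (rule integrable_mult_right)
    show "AE y in lborel. norm (L2_inner f (translate (sqrt (s n) *\<^sub>R y) h) * of_real (heat_kernel 1 y))
        \<le> L2_norm f * L2_norm h * heat_kernel 1 y" for n
    proof (rule AE_I2)
      fix y :: "real^'n"
      show "norm (L2_inner f (translate (sqrt (s n) *\<^sub>R y) h) * of_real (heat_kernel 1 y))
        \<le> L2_norm f * L2_norm h * heat_kernel 1 y"
      using L2_Cauchy_Schwarz[OF L2(1) translate_L2[OF L2(2)], of "sqrt (s n) *\<^sub>R y"]
      by (auto simp: norm_mult heat_kernel_nonneg L2_norm_translate[OF L2(2)] intro!: mult_right_mono)
    qed
    show "AE y in lborel. (\<lambda>n. L2_inner f (translate (sqrt (s n) *\<^sub>R y) h) * of_real (heat_kernel 1 y))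
        \<longlonglongrightarrow> L2_inner f h * of_real (heat_kernel 1 y)"
    proof (intro AE_I2 tendsto_mult tendsto_const L2_inner_translate_tendsto[OF L2(1) f(2) h(1) L2(2)])
      fix y :: "real^'n"
      have "(\<lambda>n. sqrt (s n) *\<^sub>R y) \<longlonglongrightarrow> sqrt 0 *\<^sub>R y"
        by (intro tendsto_intros s0)
      then show "(\<lambda>n. sqrt (s n) *\<^sub>R y) \<longlonglongrightarrow> 0" by simp
    qed
    show "(\<lambda>y. L2_inner f (translate (sqrt (s n) *\<^sub>R y) h) * of_real (heat_kernel 1 y)) \<in> borel_measurable lborel" for n
      unfolding L2_inner_def translate_def by measurable
  qed measurable
  ultimately have "L2_inner (fourier_L1 f) (fourier_L1 h)
      = (LINT y :: real^'n|lborel. L2_inner f h * of_real (heat_kernel 1 y))"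
    by (rule LIMSEQ_unique)
  then show ?thesis by (simp add: heat_kernel_integral_1)
qed

section \<open>The transform on \<open>L2\<close>\<close>

lemma fourier_L1_diff:
  assumes "integrable lborel f" "integrable lborel g"
  shows "fourier_L1 (f - g) = fourier_L1 f - fourier_L1 g"
  using assms by (auto simp: fourier_L1_def fun_eq_iff right_diff_distrib character_mult_integrable)

lemma L2_norm_fourier_L1_diff_le:
  assumes "integrable lborel f" "f \<in> L2" "integrable lborel g" "g \<in> L2"
  shows "L2_norm (fourier_L1 f - fourier_L1 g) \<le> L2_norm (f - g)"
proof -
  have "integrable lborel (f - g)"
    unfolding fun_diff_def using assms by (intro Bochner_Integration.integrable_diff)
  then have "L2_norm (fourier_L1 (f - g)) \<le> L2_norm (f - g)"
    by (rule fourier_L1_contraction(2)) (intro L2_diff assms)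
  then show ?thesis using assms by (simp add: fourier_L1_diff)
qed

text \<open>By the contraction property the transforms of the truncations form a Cauchy sequence,
  and their limit is the candidate \<open>v\<close>.\<close>

lemma fourier_exists:
  assumes u: "u \<in> L2"
  shows "\<exists>v. v \<in> L2 \<and> (\<forall>\<phi>. (\<forall>n. integrable lborel (\<phi> n)) \<and> L2_tendsto \<phi> u \<longrightarrow>
           L2_tendsto (\<lambda>n. fourier_L1 (\<phi> n)) v)"
proof -
  define T where "T n = truncation n u" for n
  have T: "integrable lborel (T n)" "T n \<in> L2" "fourier_L1 (T n) \<in> L2" for n
    using truncation_integrable[OF u] truncation_L2[OF u] fourier_L1_contraction(1) by (auto simp: T_def)
  have limT: "L2_tendsto T u" unfolding T_def[abs_def] by (rule truncation_tendsto[OF u])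
  obtain v where v: "L2_tendsto (\<lambda>n. fourier_L1 (T n)) v"
  proof (rule L2_complete[OF T(3)])
    fix \<epsilon> :: real assume "\<epsilon> > 0"
    have "(\<lambda>n. L2_norm (T n - u)) \<longlonglongrightarrow> 0" using limT by (simp add: L2_tendsto_def)
    from LIMSEQ_D[OF this, of "\<epsilon> / 2"] \<open>\<epsilon> > 0\<close>
    obtain N where N: "\<And>n. n \<ge> N \<Longrightarrow> L2_norm (T n - u) < \<epsilon> / 2" by auto
    have "L2_norm (fourier_L1 (T m) - fourier_L1 (T n)) < \<epsilon>" if "m \<ge> N" "n \<ge> N" for m n
      using L2_norm_fourier_L1_diff_le[OF T(1,2,1,2), of m n] L2_norm_triangle_diff[OF T(2) u T(2), of m n]
        N[OF that(1)] N[OF that(2)] L2_norm_minus_commute[of u "T n"] by linarith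
    then show "\<exists>N. \<forall>m\<ge>N. \<forall>n\<ge>N. L2_norm (fourier_L1 (T m) - fourier_L1 (T n)) < \<epsilon>" by blast
  qed
  have vL2: "v \<in> L2" using v by (simp add: L2_tendsto_def)
  \<comment> \<open>The definition quantifies over all approximating sequences, so independence of
    the choice has to be shown: every such sequence is compared with the truncations, again by the
    contraction property.\<close>
  have "L2_tendsto (\<lambda>n. fourier_L1 (\<phi> n)) v" if \<phi>: "\<And>n. integrable lborel (\<phi> n)" and lim: "L2_tendsto \<phi> u" for \<phi>
  proof (rule L2_tendstoI[OF _ vL2])
    have p: "\<phi> n \<in> L2" for n using lim by (simp add: L2_tendsto_def)
    show F: "fourier_L1 (\<phi> n) \<in> L2" for n by (intro fourier_L1_contraction(1) \<phi> p)
    show "L2_norm (fourier_L1 (\<phi> n) - v) \<le> (L2_norm (\<phi> n - u) + L2_norm (T n - u)) + L2_norm (fourier_L1 (T n) - v)" for n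
      using L2_norm_triangle_diff[OF F T(3) vL2, of n n] L2_norm_fourier_L1_diff_le[OF \<phi> p T(1,2), of n n]
        L2_norm_triangle_diff[OF p u T(2), of n n] L2_norm_minus_commute[of u "T n"] by linarith
    have "(\<lambda>n. (L2_norm (\<phi> n - u) + L2_norm (T n - u)) + L2_norm (fourier_L1 (T n) - v)) \<longlonglongrightarrow> (0 + 0) + 0"
      using lim limT v unfolding L2_tendsto_def by (intro tendsto_add) blast+
    then show "(\<lambda>n. (L2_norm (\<phi> n - u) + L2_norm (T n - u)) + L2_norm (fourier_L1 (T n) - v)) \<longlonglongrightarrow> 0"
      by simp
  qed
  then show ?thesis using vL2 by blast
qed

text \<open>The choice in the definition of \<open>fourier\<close> is resolved here once; all later
  properties of the transform rest on these two facts.\<close>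

lemma fourier_L2: "u \<in> L2 \<Longrightarrow> fourier u \<in> L2"
  and fourier_tendsto: "u \<in> L2 \<Longrightarrow> (\<And>n. integrable lborel (\<phi> n)) \<Longrightarrow> L2_tendsto \<phi> u \<Longrightarrow>
    L2_tendsto (\<lambda>n. fourier_L1 (\<phi> n)) (fourier u)"
  using someI_ex[OF fourier_exists[of u]] unfolding fourier_def by blast+

lemma fourier_truncation_tendsto:
  "u \<in> L2 \<Longrightarrow> L2_tendsto (\<lambda>n. fourier_L1 (truncation n u)) (fourier u)"
  by (intro fourier_tendsto truncation_integrable truncation_tendsto)

lemma fourier_measurable: "u \<in> L2 \<Longrightarrow> fourier u \<in> borel_measurable borel"
  by (intro L2_measurable fourier_L2)

lemma fourier_Parseval:
  assumes "u \<in> L2" "v \<in> L2"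
  shows "L2_inner (fourier u) (fourier v) = L2_inner u v"
proof -
  have eq: "L2_inner (fourier_L1 (truncation n u)) (fourier_L1 (truncation n v))
      = L2_inner (truncation n u) (truncation n v)" for n
    by (intro fourier_L1_Parseval[where B = n] truncation_integrable assms norm_truncation_le)
  have "(\<lambda>n. L2_inner (truncation n u) (truncation n v)) \<longlonglongrightarrow> L2_inner (fourier u) (fourier v)"
    using L2_tendsto_inner[OF fourier_truncation_tendsto[OF assms(1)] fourier_truncation_tendsto[OF assms(2)]]
    unfolding eq .
  moreover have "(\<lambda>n. L2_inner (truncation n u) (truncation n v)) \<longlonglongrightarrow> L2_inner u v"
    by (intro L2_tendsto_inner truncation_tendsto assms)
  ultimately show ?thesis by (rule LIMSEQ_unique)
qed

lemma fourier_norm: "u \<in> L2 \<Longrightarrow> L2_norm (fourier u) = L2_norm u"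
  by (simp add: ip_norm_def fourier_Parseval)

section \<open>The transform of sums, multiples and translates\<close>

lemma fourier_add:
  assumes "u \<in> L2" "v \<in> L2"
  shows "AE \<xi> in lborel. fourier (u + v) \<xi> = fourier u \<xi> + fourier v \<xi>"
proof -
  let ?\<phi> = "\<lambda>n. truncation n u + truncation n v"
  have "L2_tendsto (\<lambda>n. fourier_L1 (?\<phi> n)) (fourier (u + v))"
    by (intro fourier_tendsto L2_add L2_tendsto_add truncation_tendsto assms)
       (unfold plus_fun_def, intro Bochner_Integration.integrable_add truncation_integrable assms)
  moreover have "fourier_L1 (?\<phi> n) = fourier_L1 (truncation n u) + fourier_L1 (truncation n v)" for n
    by (simp add: fourier_L1_def fun_eq_iff distrib_left character_mult_integrable truncation_integrable assms)
  ultimately have "L2_tendsto (\<lambda>n. fourier_L1 (truncation n u) + fourier_L1 (truncation n v)) (fourier (u + v))"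
    by simp
  from L2_tendsto_unique[OF this L2_tendsto_add[OF fourier_truncation_tendsto fourier_truncation_tendsto]]
  show ?thesis using assms by simp
qed

lemma fourier_scale:
  assumes "u \<in> L2"
  shows "AE \<xi> in lborel. fourier (L2_scale c u) \<xi> = c * fourier u \<xi>"
proof -
  let ?\<phi> = "\<lambda>n. L2_scale c (truncation n u)"
  have "L2_tendsto (\<lambda>n. fourier_L1 (?\<phi> n)) (fourier (L2_scale c u))"
    by (intro fourier_tendsto L2_scale_mem L2_tendsto_scale truncation_tendsto assms)
       (unfold L2_scale_def, intro integrable_mult_right truncation_integrable assms)
  moreover have "fourier_L1 (?\<phi> n) = L2_scale c (fourier_L1 (truncation n u))" for n
    by (simp add: fourier_L1_def fun_eq_iff L2_scale_def mult.left_commute[of _ c])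
  ultimately have "L2_tendsto (\<lambda>n. L2_scale c (fourier_L1 (truncation n u))) (fourier (L2_scale c u))"
    by simp
  from L2_tendsto_unique[OF this L2_tendsto_scale[OF fourier_truncation_tendsto]]
  show ?thesis using assms by (simp add: L2_scale_def)
qed

lemma fourier_0: "AE \<xi> in lborel. fourier (0 :: real^'n \<Rightarrow> complex) \<xi> = 0"
proof -
  have 0: "(0 :: real^'n \<Rightarrow> complex) \<in> L2" by (rule L2_zero)
  show ?thesis using L2_norm_eq_0_iff[OF fourier_L2[OF 0]] fourier_norm[OF 0] by simp
qed

lemma fourier_sum:
  assumes "\<And>i. i \<in> J \<Longrightarrow> h i \<in> L2"
  shows "AE \<xi> in lborel. fourier (\<Sum>i\<in>J. h i) \<xi> = (\<Sum>i\<in>J. fourier (h i) \<xi>)"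
  using assms
proof (induction J rule: infinite_finite_induct)
  case (insert x F)
  then have "AE \<xi> in lborel. fourier (h x + sum h F) \<xi> = fourier (h x) \<xi> + fourier (sum h F) \<xi>"
    by (intro fourier_add L2_sum) auto
  moreover have "AE \<xi> in lborel. fourier (sum h F) \<xi> = (\<Sum>i\<in>F. fourier (h i) \<xi>)"
    using insert by auto
  ultimately show ?case
    unfolding sum.insert[OF insert(1,2)] by eventually_elim (simp only:)
qed (use fourier_0 in simp_all)

lemma translate_diff: "translate a (f - g) = translate a f - translate a g"
  by (simp add: translate_def fun_eq_iff)

lemma fourier_translate:
  assumes u: "u \<in> L2"
  shows "AE \<xi> in lborel. fourier (translate a u) \<xi> = character a \<xi> * fourier u \<xi>"
proof -
  let ?\<phi> = "\<lambda>n. translate a (truncation n u)"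
  have T: "truncation n u \<in> L2" for n by (rule truncation_L2[OF u])
  have tr: "L2_tendsto ?\<phi> (translate a u)"
    using truncation_tendsto[OF u]
    by (simp add: L2_tendsto_def translate_L2 L2_norm_translate L2_diff flip: translate_diff)
  have "L2_tendsto (\<lambda>n. fourier_L1 (?\<phi> n)) (fourier (translate a u))"
    by (intro fourier_tendsto translate_L2 u tr)
       (unfold translate_def, intro lborel_integrable_shift truncation_integrable u)
  moreover have "fourier_L1 (?\<phi> n) = (\<lambda>\<xi>. character a \<xi> * fourier_L1 (truncation n u) \<xi>)" for n
  proof
    fix \<xi>
    have [measurable]: "truncation n u \<in> borel_measurable borel" by (rule truncation_measurable[OF u])
    have "fourier_L1 (?\<phi> n) \<xi> = (LINT x|lborel. character \<xi> ((x - a) + a) * truncation n u (x - a))"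
      by (simp add: fourier_L1_def translate_def)
    also have "\<dots> = (LINT x|lborel. character \<xi> (x + a) * truncation n u x)"
      by (rule lborel_integral_shift) measurable
    finally show "fourier_L1 (?\<phi> n) \<xi> = character a \<xi> * fourier_L1 (truncation n u) \<xi>"
      by (simp add: fourier_L1_def character_add character_commute[of a] mult.assoc
          mult.left_commute[of _ "character \<xi> a"])
  qed
  ultimately have 1: "L2_tendsto (\<lambda>n \<xi>. character a \<xi> * fourier_L1 (truncation n u) \<xi>) (fourier (translate a u))"
    by simp
  have "(\<lambda>\<xi>. character a \<xi> * g \<xi>) \<in> L2" if "g \<in> L2" for g
    using that by (auto simp: L2_iff norm_mult)
  moreover have "L2_norm ((\<lambda>\<xi>. character a \<xi> * g \<xi>) - (\<lambda>\<xi>. character a \<xi> * h \<xi>)) = L2_norm (g - h)" for g h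
    by (simp add: L2_norm_eq norm_mult flip: right_diff_distrib)
  ultimately have "L2_tendsto (\<lambda>n \<xi>. character a \<xi> * fourier_L1 (truncation n u) \<xi>) (\<lambda>\<xi>. character a \<xi> * fourier u \<xi>)"
    using fourier_truncation_tendsto[OF u] by (simp add: L2_tendsto_def)
  from L2_tendsto_unique[OF 1 this] show ?thesis .
qed

section \<open>Conjugation, the multiplication formula and surjectivity\<close>

lemma L2_cnj_tendsto:
  assumes "L2_tendsto \<phi> f" shows "L2_tendsto (\<lambda>n x. cnj (\<phi> n x)) (\<lambda>x. cnj (f x))"
  using assms by (auto simp: L2_tendsto_def L2_cnj L2_norm_eq simp flip: complex_cnj_diff)

lemma reflect_L2:
  fixes f :: "real^'n \<Rightarrow> complex"
  assumes "f \<in> L2" shows "(\<lambda>x. f (- x)) \<in> L2" "L2_norm (\<lambda>x. f (- x)) = L2_norm f"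
proof -
  have [measurable]: "f \<in> borel_measurable borel" using assms by (rule L2_measurable)
  show "(\<lambda>x. f (- x)) \<in> L2"
    using lborel_integrable_reflect[OF L2_integrable[OF assms], of 0] by (simp add: L2_iff)
  show "L2_norm (\<lambda>x. f (- x)) = L2_norm f"
    using lborel_integral_reflect[of "\<lambda>x. (norm (f x))\<^sup>2" 0] by (simp add: L2_norm_eq)
qed

lemma L2_reflect_tendsto:
  assumes "L2_tendsto \<phi> f" shows "L2_tendsto (\<lambda>n x. \<phi> n (- x)) (\<lambda>x. f (- x))"
proof -
  have mem: "\<phi> n \<in> L2" "f \<in> L2" for n using assms by (auto simp: L2_tendsto_def)
  have "L2_norm ((\<lambda>x. \<phi> n (- x)) - (\<lambda>x. f (- x))) = L2_norm (\<phi> n - f)" for n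
    using reflect_L2(2)[OF L2_diff[OF mem, of n]] by (simp add: fun_diff_def)
  then show ?thesis using assms by (simp add: L2_tendsto_def reflect_L2)
qed

lemma fourier_cnj:
  assumes u: "u \<in> L2"
  shows "AE x in lborel. fourier (\<lambda>x. cnj (u x)) x = cnj (fourier u (- x))"
proof -
  let ?\<phi> = "\<lambda>n x. cnj (truncation n u x)"
  have "L2_tendsto (\<lambda>n. fourier_L1 (?\<phi> n)) (fourier (\<lambda>x. cnj (u x)))"
    by (intro fourier_tendsto L2_cnj L2_cnj_tendsto truncation_tendsto u integrable_cnj truncation_integrable)
  moreover have "fourier_L1 (?\<phi> n) = (\<lambda>x. cnj (fourier_L1 (truncation n u) (- x)))" for n
    by (simp add: fourier_L1_def fun_eq_iff cnj_character(2) flip: Bochner_Integration.integral_cnj)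
  ultimately have 1: "L2_tendsto (\<lambda>n x. cnj (fourier_L1 (truncation n u) (- x))) (fourier (\<lambda>x. cnj (u x)))"
    by simp
  show ?thesis
    by (rule L2_tendsto_unique[OF 1 L2_reflect_tendsto[OF L2_cnj_tendsto[OF fourier_truncation_tendsto[OF u]]]])
qed

text \<open>Each bilinear integral is an inner product against a conjugate, so the formula for
  truncations passes to the limit by continuity of the inner product.\<close>

lemma fourier_multiplication:
  assumes f: "f \<in> L2" and h: "h \<in> L2"
  shows "(LINT \<xi>|lborel. fourier f \<xi> * h \<xi>) = (LINT x|lborel. f x * fourier h x)"
proof -
  have 1: "(\<lambda>n. LINT \<xi>|lborel. fourier_L1 (truncation n f) \<xi> * truncation n h \<xi>) \<longlonglongrightarrow> (LINT \<xi>|lborel. fourier f \<xi> * h \<xi>)"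
    using L2_tendsto_inner[OF fourier_truncation_tendsto[OF f] L2_cnj_tendsto[OF truncation_tendsto[OF h]]]
    by (simp add: L2_inner_def)
  have 2: "(\<lambda>n. LINT x|lborel. truncation n f x * fourier_L1 (truncation n h) x) \<longlonglongrightarrow> (LINT x|lborel. f x * fourier h x)"
    using L2_tendsto_inner[OF truncation_tendsto[OF f] L2_cnj_tendsto[OF fourier_truncation_tendsto[OF h]]]
    by (simp add: L2_inner_def)
  have eq: "(LINT \<xi>|lborel. fourier_L1 (truncation n f) \<xi> * truncation n h \<xi>)
      = (LINT x|lborel. truncation n f x * fourier_L1 (truncation n h) x)" for n
    by (intro fourier_L1_multiplication truncation_integrable f h)
  show ?thesis by (rule LIMSEQ_unique[OF 1[unfolded eq] 2])
qed

text \<open>For the reflected transform \<open>f\<close> of \<open>g\<close>, the multiplication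
  formula and the conjugation rule give \<open>L2_inner (fourier f) g = L2_inner f f\<close>, the
  squared norm of \<open>g\<close>. Since \<open>fourier f\<close> and \<open>g\<close> have equal
  norms, expanding the square of their distance gives 0.\<close>

lemma fourier_surj:
  fixes g :: "real^'n \<Rightarrow> complex"
  assumes g: "g \<in> L2"
  obtains f where "f \<in> L2" "AE \<xi> in lborel. fourier f \<xi> = g \<xi>"
proof -
  define f where "f = (\<lambda>x. fourier g (- x))"
  have f: "f \<in> L2" "L2_norm f = L2_norm g"
    using reflect_L2[OF fourier_L2[OF g]] fourier_norm[OF g] by (auto simp: f_def)
  have F: "fourier f \<in> L2" by (rule fourier_L2[OF f(1)])
  have "L2_inner (fourier f) g = (LINT x|lborel. f x * fourier (\<lambda>x. cnj (g x)) x)"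
    unfolding L2_inner_def by (rule fourier_multiplication[OF f(1) L2_cnj[OF g]])
  also have "\<dots> = L2_inner f f"
    unfolding L2_inner_def
  proof (rule integral_cong_AE)
    show "AE x in lborel. f x * fourier (\<lambda>x. cnj (g x)) x = f x * cnj (f x)"
      using fourier_cnj[OF g] by eventually_elim (simp add: f_def)
  qed (use f fourier_L2[OF L2_cnj[OF g]] in \<open>auto simp: L2_iff\<close>)
  also have "\<dots> = of_real ((L2_norm g)\<^sup>2)" by (simp add: L2_inner_self_norm f)
  finally have "Re (L2_inner (fourier f) (- g)) = - ((L2_norm g)\<^sup>2)"
    by (simp add: L2_inner_def)
  then have "(L2_norm (fourier f + - g))\<^sup>2 = 0"
    using L2_norm_add_squared[OF F L2_uminus[OF g]]
    by (simp add: L2_norm_uminus fourier_norm f)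
  then have "L2_norm (fourier f - g) = 0" by simp
  then have "AE \<xi> in lborel. fourier f \<xi> = g \<xi>"
    using L2_norm_eq_0_iff[OF L2_diff[OF F g]] by simp
  with f that show thesis by blast
qed

section \<open>Translation bases of the Paley-Wiener space\<close>

text \<open>Completing the square around the coefficients \<open>L2_inner f (e i)\<close>. Choosing
  \<open>p\<close> equal to them gives Bessel's inequality; arbitrary \<open>p\<close> gives best
  approximation; trigonometric polynomials evaluated at \<alpha> give the error of a Gabor
  sum.\<close>

lemma L2_norm_expansion:
  fixes f :: "real^'n \<Rightarrow> complex"
  assumes J: "finite J" and e: "\<And>i. i \<in> J \<Longrightarrow> e i \<in> L2"
    and on: "\<And>i j. i \<in> J \<Longrightarrow> j \<in> J \<Longrightarrow> L2_inner (e i) (e j) = (if i = j then 1 else 0)"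
    and f: "f \<in> L2"
  shows "(L2_norm (f - (\<Sum>i\<in>J. L2_scale (p i) (e i))))\<^sup>2
       = (L2_norm f)\<^sup>2 - (\<Sum>i\<in>J. (norm (L2_inner f (e i)))\<^sup>2) + (\<Sum>i\<in>J. (norm (L2_inner f (e i) - p i))\<^sup>2)"
proof -
  define g where "g = (\<Sum>i\<in>J. L2_scale (p i) (e i))"
  have pe: "i \<in> J \<Longrightarrow> L2_scale (p i) (e i) \<in> L2" for i by (intro L2_scale_mem e)
  have g: "g \<in> L2" unfolding g_def by (intro L2_sum pe)
  have fg: "L2_inner f g = (\<Sum>i\<in>J. cnj (p i) * L2_inner f (e i))"
    unfolding g_def by (simp add: L2_inner_sum_right pe f L2_inner_scale_right)
  have "L2_inner g g = (\<Sum>i\<in>J. cnj (p i) * (\<Sum>j\<in>J. p j * L2_inner (e j) (e i)))"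
    unfolding g_def by (simp add: L2_inner_sum_right L2_inner_sum_left pe L2_sum L2_inner_scale_right L2_inner_scale_left e)
  also have "\<dots> = (\<Sum>i\<in>J. cnj (p i) * p i)"
    by (intro sum.cong refl arg_cong[where f = "(*) _"]) (simp add: on J if_distrib[of "(*) _"] sum.delta cong: if_cong)
  also have "\<dots> = of_real (\<Sum>i\<in>J. (norm (p i))\<^sup>2)"
    unfolding of_real_sum complex_norm_square by (simp add: mult.commute)
  finally have gg: "(L2_norm g)\<^sup>2 = (\<Sum>i\<in>J. (norm (p i))\<^sup>2)"
    unfolding L2_inner_self_norm of_real_eq_iff .
  have "L2_inner f (- g) = - L2_inner f g"
    by (simp add: L2_inner_def)
  then have "(L2_norm (f - g))\<^sup>2 = (L2_norm f)\<^sup>2 - 2 * Re (L2_inner f g) + (L2_norm g)\<^sup>2"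
    using L2_norm_add_squared[OF f L2_uminus[OF g]] by (simp add: L2_norm_uminus)
  also have "\<dots> = (L2_norm f)\<^sup>2 + (\<Sum>i\<in>J. (norm (p i))\<^sup>2 - 2 * Re (cnj (p i) * L2_inner f (e i)))"
    unfolding fg gg by (simp add: sum_subtractf sum_distrib_left)
  also have "(\<Sum>i\<in>J. (norm (p i))\<^sup>2 - 2 * Re (cnj (p i) * L2_inner f (e i)))
      = (\<Sum>i\<in>J. (norm (L2_inner f (e i) - p i))\<^sup>2 - (norm (L2_inner f (e i)))\<^sup>2)"
    by (intro sum.cong refl) (simp add: cmod_power2 power2_diff algebra_simps)
  finally show ?thesis unfolding g_def[symmetric] sum_subtractf by linarith
qed

lemma orthonormal_basisD:
  assumes "orthonormal_basis H sm ip I e"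
  shows "i \<in> I \<Longrightarrow> e i \<in> H"
    and "i \<in> I \<Longrightarrow> j \<in> I \<Longrightarrow> ip (e i) (e j) = (if i = j then 1 else 0)"
    and "f \<in> H \<Longrightarrow> \<epsilon> > 0 \<Longrightarrow> \<exists>J c. finite J \<and> J \<subseteq> I \<and> ip_norm ip (f - (\<Sum>i\<in>J. sm (c i) (e i))) < \<epsilon>"
  using assms unfolding orthonormal_basis_def by blast+

lemma Bessel:
  assumes "finite J" "\<And>i. i \<in> J \<Longrightarrow> e i \<in> L2" "f \<in> L2"
    and "\<And>i j. i \<in> J \<Longrightarrow> j \<in> J \<Longrightarrow> L2_inner (e i) (e j) = (if i = j then 1 else 0)"
  shows "(\<Sum>i\<in>J. (norm (L2_inner f (e i)))\<^sup>2) \<le> (L2_norm f)\<^sup>2"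
  using L2_norm_expansion[OF assms(1,2,4,3), of "\<lambda>i. L2_inner f (e i)"] zero_le_power2[of "L2_norm (f - (\<Sum>i\<in>J. L2_scale (L2_inner f (e i)) (e i)))"]
  by (simp del: zero_le_power2)

text \<open>Replacing arbitrary approximating coefficients by inner products can only reduce the
  distance, which turns density of the span into a finite form of Parseval's equality.\<close>

lemma orthonormal_basis_approx:
  assumes onb: "orthonormal_basis H L2_scale L2_inner I e" and H: "H \<subseteq> L2" and f: "f \<in> H" and "\<epsilon> > 0"
  obtains J where "finite J" "J \<subseteq> I" "(L2_norm f)\<^sup>2 - (\<Sum>i\<in>J. (norm (L2_inner f (e i)))\<^sup>2) < \<epsilon>"
proof -
  obtain J c where J: "finite J" "J \<subseteq> I" and lt: "L2_norm (f - (\<Sum>i\<in>J. L2_scale (c i) (e i))) < sqrt \<epsilon>"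
    using orthonormal_basisD(3)[OF onb f, of "sqrt \<epsilon>"] \<open>\<epsilon> > 0\<close> by auto
  have "(L2_norm (f - (\<Sum>i\<in>J. L2_scale (c i) (e i))))\<^sup>2 < (sqrt \<epsilon>)\<^sup>2"
    by (rule power_strict_mono[OF lt]) auto
  moreover have "(L2_norm (f - (\<Sum>i\<in>J. L2_scale (c i) (e i))))\<^sup>2
      = (L2_norm f)\<^sup>2 - (\<Sum>i\<in>J. (norm (L2_inner f (e i)))\<^sup>2) + (\<Sum>i\<in>J. (norm (L2_inner f (e i) - c i))\<^sup>2)"
    using onb[THEN orthonormal_basisD(1)] onb[THEN orthonormal_basisD(2)] J H f
    by (intro L2_norm_expansion) blast+
  moreover have "0 \<le> (\<Sum>i\<in>J. (norm (L2_inner f (e i) - c i))\<^sup>2)"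
    by (intro sum_nonneg) auto
  ultimately have "(L2_norm f)\<^sup>2 - (\<Sum>i\<in>J. (norm (L2_inner f (e i)))\<^sup>2) < \<epsilon>"
    using \<open>\<epsilon> > 0\<close> by simp
  with J that show thesis by blast
qed

text \<open>Finitely many coefficients nearly exhaust the norm of \<open>f\<close>, and Bessel's
  inequality bounds the coefficients of \<open>g\<close> of the same moduli. Used in both directions
  it yields equality of norms.\<close>

lemma orthonormal_basis_norm_le:
  assumes onb: "orthonormal_basis H L2_scale L2_inner I e" and H: "H \<subseteq> L2" and f: "f \<in> H" and g: "g \<in> L2"
    and eq: "\<And>i. i \<in> I \<Longrightarrow> norm (L2_inner f (e i)) = norm (L2_inner g (e i))"
  shows "L2_norm f \<le> L2_norm g"
proof -
  have "(L2_norm f)\<^sup>2 \<le> (L2_norm g)\<^sup>2 + \<epsilon>" if "\<epsilon> > 0" for \<epsilon>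
  proof -
    obtain J where J: "finite J" "J \<subseteq> I" and lt: "(L2_norm f)\<^sup>2 - (\<Sum>i\<in>J. (norm (L2_inner f (e i)))\<^sup>2) < \<epsilon>"
      using orthonormal_basis_approx[OF onb H f \<open>\<epsilon> > 0\<close>] .
    have "(\<Sum>i\<in>J. (norm (L2_inner f (e i)))\<^sup>2) = (\<Sum>i\<in>J. (norm (L2_inner g (e i)))\<^sup>2)"
      using J eq by (intro sum.cong) auto
    also have "\<dots> \<le> (L2_norm g)\<^sup>2"
      using onb[THEN orthonormal_basisD(1)] onb[THEN orthonormal_basisD(2)] J H g
      by (intro Bessel) blast+
    finally show ?thesis using lt by linarith
  qed
  then have "(L2_norm f)\<^sup>2 \<le> (L2_norm g)\<^sup>2" by (rule field_le_epsilon)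
  then show ?thesis by (rule power2_le_imp_le) simp
qed

section \<open>The Paley-Wiener space on the frequency side\<close>

lemma PW_L2: "f \<in> PW \<Omega> \<Longrightarrow> f \<in> L2"
  by (simp add: PW_def)

lemma PW_subset_L2: "PW \<Omega> \<subseteq> L2"
  by (auto simp: PW_def)

lemma PW_scale: assumes "f \<in> PW \<Omega>" shows "L2_scale c f \<in> PW \<Omega>"
proof -
  have "AE \<xi> in lborel. \<xi> \<notin> \<Omega> \<longrightarrow> fourier f \<xi> = 0" using assms by (simp add: PW_def)
  with fourier_scale[OF PW_L2[OF assms], of c]
  have "AE \<xi> in lborel. \<xi> \<notin> \<Omega> \<longrightarrow> fourier (L2_scale c f) \<xi> = 0" by eventually_elim simp
  then show ?thesis using assms by (simp add: PW_def L2_scale_mem)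
qed

lemma PW_translate: assumes "f \<in> PW \<Omega>" shows "translate a f \<in> PW \<Omega>"
proof -
  have "AE \<xi> in lborel. \<xi> \<notin> \<Omega> \<longrightarrow> fourier f \<xi> = 0" using assms by (simp add: PW_def)
  with fourier_translate[OF PW_L2[OF assms], of a]
  have "AE \<xi> in lborel. \<xi> \<notin> \<Omega> \<longrightarrow> fourier (translate a f) \<xi> = 0" by eventually_elim simp
  then show ?thesis using assms by (simp add: PW_def translate_L2)
qed

lemma PW_surj:
  fixes g :: "real^'n \<Rightarrow> complex"
  assumes "g \<in> L2" "AE \<xi> in lborel. \<xi> \<notin> \<Omega> \<longrightarrow> g \<xi> = 0"
  obtains f where "f \<in> PW \<Omega>" "AE \<xi> in lborel. fourier f \<xi> = g \<xi>"
proof -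
  obtain f where f: "f \<in> L2" "AE \<xi> in lborel. fourier f \<xi> = g \<xi>"
    using fourier_surj[OF assms(1)] .
  have "AE \<xi> in lborel. \<xi> \<notin> \<Omega> \<longrightarrow> fourier f \<xi> = 0"
    using f(2) assms(2) by eventually_elim simp
  with f that show thesis by (simp add: PW_def)
qed

text \<open>Here \<open>g\<close> is any Borel representative of the transform, so that coefficients
  can be computed from a function prescribed on the frequency side.\<close>

lemma L2_inner_translate_fourier:
  fixes f u :: "real^'n \<Rightarrow> complex"
  assumes f: "f \<in> L2" and u: "u \<in> L2" and [measurable]: "g \<in> borel_measurable borel"
    and g: "AE \<xi> in lborel. fourier f \<xi> = g \<xi>"
  shows "L2_inner f (translate a u) = (LINT \<xi>|lborel. g \<xi> * cnj (character a \<xi> * fourier u \<xi>))"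
proof -
  have [measurable]: "fourier f \<in> borel_measurable borel" "fourier u \<in> borel_measurable borel"
    "fourier (translate a u) \<in> borel_measurable borel"
    using f u translate_L2 by (auto intro: fourier_measurable)
  have "L2_inner f (translate a u) = (LINT \<xi>|lborel. fourier f \<xi> * cnj (fourier (translate a u) \<xi>))"
    using fourier_Parseval[OF f translate_L2[OF u]] by (simp add: L2_inner_def)
  also have "\<dots> = (LINT \<xi>|lborel. g \<xi> * cnj (character a \<xi> * fourier u \<xi>))"
  proof (rule integral_cong_AE)
    show "AE \<xi> in lborel. fourier f \<xi> * cnj (fourier (translate a u) \<xi>) = g \<xi> * cnj (character a \<xi> * fourier u \<xi>)"
      using g fourier_translate[OF u, of a] by eventually_elim simp
  qed measurable
  finally show ?thesis .
qed

lemma AE_lborel_shift: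
  fixes a :: "'a::euclidean_space"
  assumes [measurable]: "Measurable.pred borel P" and "AE t in lborel. P (a + t)"
  shows "AE y in lborel. P y"
proof -
  show ?thesis
    by (subst lborel_distr_plus[symmetric, of a], subst AE_distr_iff) (use assms(2) in auto)
qed

section \<open>The modulus of the transform of the generator\<close>

locale translation_basis =
  fixes \<Omega> A :: "(real^'n) set" and u :: "real^'n \<Rightarrow> complex"
  assumes borel_\<Omega> [measurable]: "\<Omega> \<in> sets borel" and measure_\<Omega>: "emeasure lborel \<Omega> = 1"
    and u_PW: "u \<in> PW \<Omega>"
    and fourier_u_nonzero: "AE \<xi> in lborel. \<xi> \<in> \<Omega> \<longrightarrow> fourier u \<xi> \<noteq> 0"
    and onb: "orthonormal_basis (PW \<Omega>) L2_scale L2_inner A (\<lambda>a. translate a u)"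
begin

lemma u_L2: "u \<in> L2" by (rule PW_L2[OF u_PW])

lemma fourier_u_measurable [measurable]: "fourier u \<in> borel_measurable borel"
  by (rule fourier_measurable[OF u_L2])

lemma fourier_u_outside: "AE \<xi> in lborel. \<xi> \<notin> \<Omega> \<longrightarrow> fourier u \<xi> = 0"
  using u_PW by (simp add: PW_def)

lemma not_AE_outside_\<Omega>: "\<not> (AE x in lborel. x \<notin> \<Omega>)"
  using measure_\<Omega> AE_iff_measurable[of \<Omega> lborel "\<lambda>x. x \<notin> \<Omega>"] by simp

lemma norm_u: "L2_norm u = 1"
proof -
  \<comment> \<open>An empty family would force \<open>u\<close> to have norm 0, hence its transform
    to vanish almost everywhere, against nonvanishing on a set of measure 1.\<close>
  have "A \<noteq> {}"
  proof
    assume "A = {}"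
    then have "L2_norm u < \<epsilon>" if "\<epsilon> > 0" for \<epsilon>
      using orthonormal_basisD(3)[OF onb u_PW that] by auto
    then have "\<not> L2_norm u > 0" by blast
    then have "L2_norm (fourier u) = 0"
      using L2_norm_nonneg[of u] fourier_norm[OF u_L2] by linarith
    then have "AE \<xi> in lborel. fourier u \<xi> = 0"
      using L2_norm_eq_0_iff[OF fourier_L2[OF u_L2]] by simp
    with fourier_u_nonzero have "AE x in lborel. x \<notin> \<Omega>" by eventually_elim blast
    then show False using not_AE_outside_\<Omega> by simp
  qed
  then obtain a where "a \<in> A" by blast
  then have "L2_inner (translate a u) (translate a u) = 1"
    using orthonormal_basisD(2)[OF onb, of a a] by simp
  then have "(L2_norm (translate a u))\<^sup>2 = 1"
    unfolding L2_inner_self_norm by (metis of_real_eq_1_iff)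
  then show ?thesis
    using L2_norm_translate[OF u_L2, of a] L2_norm_nonneg[of u] by (simp add: power2_eq_1_iff)
qed

text \<open>Division by \<open>cnj (fourier u)\<close> cancels the weight in the coefficient at
  \<open>a\<close> and leaves the integral of \<open>cnj (character a x)\<close> over
  \<open>E\<close>. Shifting \<open>E\<close> multiplies this by the unimodular number
  \<open>cnj (character a t)\<close>. The lower bound \<open>c\<close> makes both quotients square
  integrable.\<close>

lemma inverse_weight_shift_invariant:
  assumes E [measurable]: "E \<in> sets borel" and sub: "E \<subseteq> \<Omega>" "\<And>x. x \<in> E \<Longrightarrow> x + t \<in> \<Omega>" and c: "c > 0"
    and low: "\<And>x. x \<in> E \<Longrightarrow> c \<le> norm (fourier u x)" "\<And>x. x \<in> E \<Longrightarrow> c \<le> norm (fourier u (x + t))"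
  shows "integrable lborel (\<lambda>x. indicator E x / (norm (fourier u x))\<^sup>2)"
    and "integrable lborel (\<lambda>x. indicator E x / (norm (fourier u (x + t)))\<^sup>2)"
    and "(LINT x|lborel. indicator E x / (norm (fourier u x))\<^sup>2)
       = (LINT x|lborel. indicator E x / (norm (fourier u (x + t)))\<^sup>2)"
proof -
  define g where "g x = indicator E x / cnj (fourier u x)" for x
  \<comment> \<open>\<open>indicator E (x - t)\<close> is the indicator of \<open>E + t\<close> at
    \<open>x\<close>.\<close>
  define g' where "g' x = indicator E (x - t) / cnj (fourier u x)" for x
  have [measurable]: "g \<in> borel_measurable borel" "g' \<in> borel_measurable borel"
    by (simp_all add: g_def[abs_def] g'_def[abs_def])
  have "emeasure lborel E \<le> 1"
    using emeasure_mono[OF sub(1), of lborel] measure_\<Omega> by simp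
  then have "emeasure lborel E < \<infinity>"
    by (rule le_less_trans) simp
  then have intE: "integrable lborel (\<lambda>x. indicator E x / c\<^sup>2 :: real)"
    by (intro integrable_divide integrable_real_indicator) auto
  have sq: "(norm (g x))\<^sup>2 = indicator E x / (norm (fourier u x))\<^sup>2"
    "(norm (g' x))\<^sup>2 = indicator E (x - t) / (norm (fourier u x))\<^sup>2" for x
    by (auto simp: g_def g'_def norm_divide power_divide indicator_def)
  have bd: "indicator E x / (norm (fourier u x))\<^sup>2 \<le> indicator E x / c\<^sup>2"
    "indicator E (x - t) / (norm (fourier u x))\<^sup>2 \<le> indicator E (x - t) / c\<^sup>2" for x
    using low(1)[of x] low(2)[of "x - t"] c by (auto simp: indicator_def intro!: frac_le power_mono)
  have int: "integrable lborel (\<lambda>x. (norm (g x))\<^sup>2)" "integrable lborel (\<lambda>x. (norm (g' x))\<^sup>2)"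
    by (rule Bochner_Integration.integrable_bound[OF intE], simp, simp add: sq bd)
       (rule Bochner_Integration.integrable_bound[OF lborel_integrable_shift[OF intE, of t]], simp, simp add: sq bd)
  then have L2: "g \<in> L2" "g' \<in> L2" by (simp_all add: L2_iff)
  have shift: "(LINT x|lborel. indicator E (x - t) / (norm (fourier u x))\<^sup>2)
      = (LINT x|lborel. indicator E x / (norm (fourier u (x + t)))\<^sup>2)"
    using lborel_integral_shift[of "\<lambda>x. indicator E x / (norm (fourier u (x + t)))\<^sup>2" t] by simp
  show "integrable lborel (\<lambda>x. indicator E x / (norm (fourier u x))\<^sup>2)"
    using int(1) by (simp add: sq)
  show "integrable lborel (\<lambda>x. indicator E x / (norm (fourier u (x + t)))\<^sup>2)"
    using lborel_integrable_shift[OF int(2), of "-t"] by (simp add: sq)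
  have supp: "AE \<xi> in lborel. \<xi> \<notin> \<Omega> \<longrightarrow> g \<xi> = 0" "AE \<xi> in lborel. \<xi> \<notin> \<Omega> \<longrightarrow> g' \<xi> = 0"
    using sub(1) sub(2)[of "_ - t"] by (auto simp: g_def g'_def indicator_def intro!: AE_I2)
  obtain f where f: "f \<in> PW \<Omega>" "AE \<xi> in lborel. fourier f \<xi> = g \<xi>"
    using PW_surj[OF L2(1) supp(1)] .
  obtain f' where f': "f' \<in> PW \<Omega>" "AE \<xi> in lborel. fourier f' \<xi> = g' \<xi>"
    using PW_surj[OF L2(2) supp(2)] .
  have coef: "norm (L2_inner f (translate a u)) = norm (L2_inner f' (translate a u))" for a
  proof -
    have nz: "x \<in> E \<Longrightarrow> fourier u x \<noteq> 0" "x - t \<in> E \<Longrightarrow> fourier u x \<noteq> 0" for x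
      using low(1)[of x] low(2)[of "x - t"] c by auto
    have "L2_inner f (translate a u) = (LINT \<xi>|lborel. g \<xi> * cnj (character a \<xi> * fourier u \<xi>))"
      by (rule L2_inner_translate_fourier) (use f PW_L2 u_L2 in auto)
    also have "\<dots> = (LINT x|lborel. indicator E x * cnj (character a x))"
      using nz(1) by (intro Bochner_Integration.integral_cong) (auto simp: g_def indicator_def)
    finally have 1: "L2_inner f (translate a u) = (LINT x|lborel. indicator E x * cnj (character a x))" .
    have "L2_inner f' (translate a u) = (LINT \<xi>|lborel. g' \<xi> * cnj (character a \<xi> * fourier u \<xi>))"
      by (rule L2_inner_translate_fourier) (use f' PW_L2 u_L2 in auto)
    also have "\<dots> = (LINT x|lborel. indicator E (x - t) * cnj (character a ((x - t) + t)))"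
      using nz(2) by (intro Bochner_Integration.integral_cong) (auto simp: g'_def indicator_def)
    also have "\<dots> = (LINT x|lborel. indicator E x * cnj (character a (x + t)))"
      by (rule lborel_integral_shift) measurable
    also have "\<dots> = (LINT x|lborel. indicator E x * cnj (character a x)) * cnj (character a t)"
      by (simp add: character_add mult.assoc[symmetric])
    finally show ?thesis using 1 by (simp add: norm_mult)
  qed
  have "L2_norm f = L2_norm f'"
    by (rule antisym; rule orthonormal_basis_norm_le[OF onb PW_subset_L2]) (use f f' PW_L2 coef in auto)
  moreover have "L2_norm f = L2_norm g" "L2_norm f' = L2_norm g'"
    using fourier_norm[OF PW_L2[OF f(1)]] fourier_norm[OF PW_L2[OF f'(1)]]
      L2_norm_cong_AE[OF _ _ f(2)] L2_norm_cong_AE[OF _ _ f'(2)]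
    by (simp_all add: fourier_measurable PW_L2[OF f(1)] PW_L2[OF f'(1)])
  ultimately have "(L2_norm g)\<^sup>2 = (L2_norm g')\<^sup>2" by simp
  then show "(LINT x|lborel. indicator E x / (norm (fourier u x))\<^sup>2)
       = (LINT x|lborel. indicator E x / (norm (fourier u (x + t)))\<^sup>2)"
    by (simp add: L2_norm_squared sq shift)
qed

lemma norm_fourier_shift_invariant:
  "AE x in lborel. x \<in> \<Omega> \<longrightarrow> x + t \<in> \<Omega> \<longrightarrow> fourier u x \<noteq> 0 \<longrightarrow> fourier u (x + t) \<noteq> 0 \<longrightarrow>
     norm (fourier u x) = norm (fourier u (x + t))"
proof -
  define D where "D x = 1 / (norm (fourier u x))\<^sup>2 - 1 / (norm (fourier u (x + t)))\<^sup>2" for x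
  define S where "S n = {x \<in> \<Omega>. x + t \<in> \<Omega> \<and> 1 / real (Suc n) \<le> norm (fourier u x)
    \<and> 1 / real (Suc n) \<le> norm (fourier u (x + t))}" for n
  have [measurable]: "D \<in> borel_measurable borel" by (simp add: D_def[abs_def])
  have [measurable]: "S n \<in> sets borel" for n
  proof -
    have "{x \<in> space borel. x \<in> \<Omega> \<and> x + t \<in> \<Omega> \<and> 1 / real (Suc n) \<le> norm (fourier u x)
        \<and> 1 / real (Suc n) \<le> norm (fourier u (x + t))} \<in> sets borel"
      by measurable
    then show ?thesis by (simp add: S_def)
  qed
  \<comment> \<open>On the set where \<open>\<sigma> * D\<close> is positive, equal integrals force
    a positive function to have integral 0. Taking \<sigma> to be 1 and -1 covers both signs of
    \<open>D\<close>.\<close>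
  have null: "AE x in lborel. \<not> (x \<in> S n \<and> \<sigma> * D x > 0)" for n \<sigma>
  proof -
    define E where "E = S n \<inter> {x. \<sigma> * D x > 0}"
    have [measurable]: "E \<in> sets borel"
    proof -
      have "{x \<in> space borel. x \<in> S n \<and> \<sigma> * D x > 0} \<in> sets borel" by measurable
      then show ?thesis by (simp add: E_def Int_def)
    qed
    note inv = inverse_weight_shift_invariant[of E t "1 / real (Suc n)"]
    have sub: "E \<subseteq> \<Omega>" "\<And>x. x \<in> E \<Longrightarrow> x + t \<in> \<Omega>" "1 / real (Suc n) > 0"
      "\<And>x. x \<in> E \<Longrightarrow> 1 / real (Suc n) \<le> norm (fourier u x)"
      "\<And>x. x \<in> E \<Longrightarrow> 1 / real (Suc n) \<le> norm (fourier u (x + t))"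
      by (auto simp: E_def S_def)
    have eq: "indicator E x * (\<sigma> * D x) = \<sigma> * (indicator E x / (norm (fourier u x))\<^sup>2
        - indicator E x / (norm (fourier u (x + t)))\<^sup>2)" for x
      by (simp add: D_def algebra_simps)
    have int: "integrable lborel (\<lambda>x. indicator E x * (\<sigma> * D x))"
      unfolding eq by (intro integrable_mult_right Bochner_Integration.integrable_diff inv sub) simp_all
    have "(LINT x|lborel. indicator E x * (\<sigma> * D x)) = 0"
      unfolding eq using inv[OF _ sub] by simp
    then have "AE x in lborel. indicator E x * (\<sigma> * D x) = 0"
      by (subst integral_nonneg_eq_0_iff_AE[OF int, symmetric]) (auto simp: E_def indicator_def)
    then show ?thesis by eventually_elim (auto simp: E_def indicator_def)
  qed
  have "AE x in lborel. \<forall>n. \<not> (x \<in> S n \<and> 1 * D x > 0) \<and> \<not> (x \<in> S n \<and> (-1) * D x > 0)"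
    unfolding AE_all_countable using null by (intro allI AE_conjI)
  then show ?thesis
  proof eventually_elim
    case (elim x)
    show ?case
    proof (intro impI)
      assume x: "x \<in> \<Omega>" "x + t \<in> \<Omega>" "fourier u x \<noteq> 0" "fourier u (x + t) \<noteq> 0"
      define m where "m = min (norm (fourier u x)) (norm (fourier u (x + t)))"
      have "m > 0" using x by (simp add: m_def)
      then obtain n where "1 / real (Suc n) < m" by (rule nat_approx_posE)
      then have "x \<in> S n" using x by (simp add: S_def m_def)
      then have "D x = 0" using elim[rule_format, of n] by simp
      then have "(norm (fourier u x))\<^sup>2 = (norm (fourier u (x + t)))\<^sup>2"
        using x by (simp add: D_def field_simps)
      then show "norm (fourier u x) = norm (fourier u (x + t))" by simp
    qed
  qed
qed

text \<open>
  With \<open>v = fourier u\<close>, the shift invariance of \<open>\<bar>v\<bar>\<close> holds for each \<open>t\<close> outside a null set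
  depending on \<open>t\<close>; by Fubini it gives \<open>\<bar>v(x)\<bar> = \<bar>v(y)\<bar>\<close> for almost all pairs in \<open>\<Omega> \<times> \<Omega>\<close>.
\<close>

lemma norm_fourier_u: "AE \<xi> in lborel. \<xi> \<in> \<Omega> \<longrightarrow> norm (fourier u \<xi>) = 1"
proof -
  define Q where "Q x y \<longleftrightarrow> (x \<in> \<Omega> \<longrightarrow> y \<in> \<Omega> \<longrightarrow> fourier u x \<noteq> 0 \<longrightarrow> fourier u y \<noteq> 0 \<longrightarrow>
     norm (fourier u x) = norm (fourier u y))" for x y
  have "AE t in lborel. AE x in lborel. Q x (x + t)"
    unfolding Q_def using norm_fourier_shift_invariant by simp
  moreover have "{z \<in> space (lborel \<Otimes>\<^sub>M lborel). Q (snd z) (snd z + fst z)} \<in> sets (lborel \<Otimes>\<^sub>M (lborel :: (real^'n) measure))"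
    unfolding Q_def by measurable
  ultimately have "AE x in lborel. AE t in lborel. Q x (x + t)"
    using lborel_pair.AE_commute[of "\<lambda>t x. Q x (x + t)"] by blast
  then have "AE x in lborel. (x \<in> \<Omega> \<longrightarrow> fourier u x \<noteq> 0) \<and> (AE t in lborel. Q x (x + t))"
    using fourier_u_nonzero by eventually_elim blast
  then obtain x where x: "x \<in> \<Omega>" "fourier u x \<noteq> 0" "AE t in lborel. Q x (x + t)"
    using not_AE_outside_\<Omega> by (metis (mono_tags, lifting) AE_mp AE_I2)
  have "AE y in lborel. Q x y"
    by (rule AE_lborel_shift[OF _ x(3)]) (simp add: Q_def)
  then have AEc: "AE y in lborel. y \<in> \<Omega> \<longrightarrow> norm (fourier u y) = norm (fourier u x)"
    using fourier_u_nonzero by eventually_elim (use x in \<open>auto simp: Q_def\<close>)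
  have "1 = (L2_norm (fourier u))\<^sup>2"
    using norm_u fourier_norm[OF u_L2] by simp
  also have "\<dots> = (LINT y|lborel. (norm (fourier u x))\<^sup>2 * indicator \<Omega> y)"
    unfolding L2_norm_squared
  proof (rule integral_cong_AE)
    show "AE y in lborel. (norm (fourier u y))\<^sup>2 = (norm (fourier u x))\<^sup>2 * indicator \<Omega> y"
      using AEc fourier_u_outside by eventually_elim (auto simp: indicator_def)
  qed measurable
  also have "\<dots> = (norm (fourier u x))\<^sup>2"
    using measure_\<Omega> by (simp add: measure_def)
  finally have "norm (fourier u x) = 1"
    using norm_ge_zero[of "fourier u x"] by (metis abs_of_nonneg real_sqrt_abs real_sqrt_one)
  with AEc show ?thesis by simp
qed

section \<open>Characters as an orthonormal basis over \<Omega>\<close>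

text \<open>The weight \<open>|fourier u|\<^sup>2\<close> is almost everywhere the indicator of
  \<Omega>, so these integrals are the inner products of the translates seen on the frequency
  side.\<close>

lemma character_orthonormal:
  assumes "a \<in> A" "b \<in> A"
  shows "(LINT \<xi>:\<Omega>|lborel. character a \<xi> * cnj (character b \<xi>)) = (if a = b then 1 else 0)"
proof -
  have "(LINT \<xi>:\<Omega>|lborel. character a \<xi> * cnj (character b \<xi>))
      = (LINT \<xi>|lborel. (character a \<xi> * fourier u \<xi>) * cnj (character b \<xi> * fourier u \<xi>))"
    unfolding set_lebesgue_integral_def
  proof (rule integral_cong_AE)
    show "AE \<xi> in lborel. indicator \<Omega> \<xi> *\<^sub>R (character a \<xi> * cnj (character b \<xi>))
        = (character a \<xi> * fourier u \<xi>) * cnj (character b \<xi> * fourier u \<xi>)"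
      using norm_fourier_u fourier_u_outside
    proof eventually_elim
      case (elim \<xi>)
      have "(character a \<xi> * fourier u \<xi>) * cnj (character b \<xi> * fourier u \<xi>)
          = (character a \<xi> * cnj (character b \<xi>)) * of_real ((norm (fourier u \<xi>))\<^sup>2)"
        using complex_norm_square[of "fourier u \<xi>"] by (simp add: mult_ac)
      then show ?case using elim by (cases "\<xi> \<in> \<Omega>") auto
    qed
  qed measurable
  also have "\<dots> = L2_inner (translate a u) (translate b u)"
    by (rule L2_inner_translate_fourier[symmetric])
       (use u_L2 translate_L2 fourier_translate in auto)
  finally show ?thesis using orthonormal_basisD(2)[OF onb assms] by simp
qed

text \<open>Multiplication by \<open>fourier u\<close> is isometric on functions supported in
  \<Omega> and takes characters to transforms of translates, so totality is pulled back from the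
  translates. Integrability is part of the conclusion since the integral of a non-integrable
  function is 0 by convention and its smallness would say nothing.\<close>

lemma character_total:
  assumes g: "g \<in> L2" "\<And>x. x \<notin> \<Omega> \<Longrightarrow> g x = 0" and "\<epsilon> > 0"
  obtains K c where "finite K" "K \<subseteq> A"
    "integrable lborel (\<lambda>x. indicator \<Omega> x * (norm (g x - (\<Sum>b\<in>K. c b * character b x)))\<^sup>2)"
    "(LINT x|lborel. indicator \<Omega> x * (norm (g x - (\<Sum>b\<in>K. c b * character b x)))\<^sup>2) < \<epsilon>"
proof -
  note [measurable] = L2_measurable[OF g(1)]
  have "integrable lborel (\<lambda>x. (norm (g x * fourier u x))\<^sup>2)"
  proof (rule integrable_cong_AE_imp[OF L2_integrable[OF g(1)]])
    show "AE x in lborel. (norm (g x))\<^sup>2 = (norm (g x * fourier u x))\<^sup>2"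
      using norm_fourier_u by eventually_elim (use g(2) in \<open>auto simp: norm_mult\<close>)
  qed measurable
  then have gv: "(\<lambda>x. g x * fourier u x) \<in> L2" by (simp add: L2_iff)
  obtain f where f: "f \<in> PW \<Omega>" "AE \<xi> in lborel. fourier f \<xi> = g \<xi> * fourier u \<xi>"
    using PW_surj[OF gv, of \<Omega>] g(2) by auto
  obtain K c where K: "finite K" "K \<subseteq> A" and lt: "L2_norm (f - (\<Sum>b\<in>K. L2_scale (c b) (translate b u))) < sqrt \<epsilon>"
    using orthonormal_basisD(3)[OF onb f(1), of "sqrt \<epsilon>"] \<open>\<epsilon> > 0\<close> by auto
  \<comment> \<open>The signs go into the coefficients, so that the difference becomes a sum to
    which additivity of the transform applies.\<close>
  define h where "h = (\<Sum>b\<in>K. L2_scale (- c b) (translate b u))"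
  have tL2: "L2_scale d (translate b u) \<in> L2" for d b
    by (intro L2_scale_mem translate_L2 u_L2)
  have hL2: "h \<in> L2" unfolding h_def by (intro L2_sum tL2)
  have fh: "f - (\<Sum>b\<in>K. L2_scale (c b) (translate b u)) = f + h"
    by (simp add: h_def fun_eq_iff sum_fun_apply L2_scale_def sum_negf)
  have fhL2: "f + h \<in> L2" by (intro L2_add PW_L2[OF f(1)] hL2)
  have "AE \<xi> in lborel. \<forall>b\<in>K. fourier (L2_scale (- c b) (translate b u)) \<xi> = - c b * (character b \<xi> * fourier u \<xi>)"
  proof (rule AE_finite_allI[OF K(1)])
    fix b
    show "AE \<xi> in lborel. fourier (L2_scale (- c b) (translate b u)) \<xi> = - c b * (character b \<xi> * fourier u \<xi>)"
      using fourier_scale[OF translate_L2[OF u_L2], of "- c b" b] fourier_translate[OF u_L2, of b]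
      by eventually_elim simp
  qed
  then have "AE \<xi> in lborel. (norm (fourier (f + h) \<xi>))\<^sup>2
      = indicator \<Omega> \<xi> * (norm (g \<xi> - (\<Sum>b\<in>K. c b * character b \<xi>)))\<^sup>2"
    using fourier_add[OF PW_L2[OF f(1)] hL2] fourier_sum[of K "\<lambda>b. L2_scale (- c b) (translate b u)", OF tL2]
      f(2) norm_fourier_u fourier_u_outside
  proof eventually_elim
    case (elim \<xi>)
    have "fourier (f + h) \<xi> = (g \<xi> - (\<Sum>b\<in>K. c b * character b \<xi>)) * fourier u \<xi>"
    proof -
      have "(\<Sum>b\<in>K. c b * (character b \<xi> * fourier u \<xi>)) = (\<Sum>b\<in>K. c b * character b \<xi>) * fourier u \<xi>"
        by (simp add: sum_distrib_right mult.assoc)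
      then show ?thesis
        using elim(1-4) unfolding h_def[symmetric] by (simp add: sum_negf left_diff_distrib)
    qed
    then show ?case using elim(5,6) by (cases "\<xi> \<in> \<Omega>") (auto simp: norm_mult)
  qed
  note AE = this
  have int: "integrable lborel (\<lambda>x. indicator \<Omega> x * (norm (g x - (\<Sum>b\<in>K. c b * character b x)))\<^sup>2)"
    by (rule integrable_cong_AE_imp[OF L2_integrable[OF fourier_L2[OF fhL2]]]) (measurable, use AE in eventually_elim, simp)
  have [measurable]: "fourier (f + h) \<in> borel_measurable borel" by (rule fourier_measurable[OF fhL2])
  have "(LINT x|lborel. indicator \<Omega> x * (norm (g x - (\<Sum>b\<in>K. c b * character b x)))\<^sup>2)
      = (L2_norm (fourier (f + h)))\<^sup>2"
    unfolding L2_norm_squared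
    by (rule integral_cong_AE) (measurable, use AE in eventually_elim, simp)
  also have "\<dots> = (L2_norm (f + h))\<^sup>2" by (simp add: fourier_norm fhL2)
  also have "\<dots> < (sqrt \<epsilon>)\<^sup>2"
    using lt unfolding fh by (intro power_strict_mono) auto
  finally show thesis using that[OF K int] \<open>\<epsilon> > 0\<close> by simp
qed

end

section \<open>The vector-valued space\<close>

lemma PW_borel_generators:
  "{U. U \<subseteq> PW \<Omega> \<and> (\<forall>f\<in>U. \<exists>\<epsilon>>0. \<forall>g\<in>PW \<Omega>. L2_norm (g - f) < \<epsilon> \<longrightarrow> g \<in> U)} \<subseteq> Pow (PW \<Omega>)"
  by blast

lemma space_PW_borel: "space (PW_borel \<Omega>) = PW \<Omega>"
  unfolding PW_borel_def by (rule space_measure_of[OF PW_borel_generators])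

lemma PW_borel_openI:
  assumes "U \<subseteq> PW \<Omega>" "\<And>f. f \<in> U \<Longrightarrow> \<exists>\<epsilon>>0. \<forall>g\<in>PW \<Omega>. L2_norm (g - f) < \<epsilon> \<longrightarrow> g \<in> U"
  shows "U \<in> sets (PW_borel \<Omega>)"
  unfolding PW_borel_def sets_measure_of[OF PW_borel_generators]
  using assms by (intro sigma_sets.Basic) simp

text \<open>The functional is Lipschitz by the Cauchy-Schwarz inequality, so preimages of open sets
  are generators of the sigma-algebra. The added 1 in the radius covers
  \<open>L2_norm w = 0\<close>.\<close>

lemma L2_inner_PW_borel_measurable:
  fixes w :: "real^'n \<Rightarrow> complex"
  assumes w: "w \<in> L2"
  shows "(\<lambda>f. L2_inner f w) \<in> borel_measurable (PW_borel \<Omega>)"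
proof (rule borel_measurableI)
  fix S :: "complex set" assume S: "open S"
  show "(\<lambda>f. L2_inner f w) -` S \<inter> space (PW_borel \<Omega>) \<in> sets (PW_borel \<Omega>)"
  proof (rule PW_borel_openI)
    fix f assume f: "f \<in> (\<lambda>f. L2_inner f w) -` S \<inter> space (PW_borel \<Omega>)"
    then have fPW: "f \<in> PW \<Omega>" by (simp add: space_PW_borel)
    obtain e where e: "e > 0" "ball (L2_inner f w) e \<subseteq> S"
      using S f by (auto simp: open_contains_ball)
    have pos: "L2_norm w + 1 > 0" using L2_norm_nonneg[of w] by linarith
    show "\<exists>\<epsilon>>0. \<forall>g\<in>PW \<Omega>. L2_norm (g - f) < \<epsilon> \<longrightarrow> g \<in> (\<lambda>f. L2_inner f w) -` S \<inter> space (PW_borel \<Omega>)"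
    proof (intro exI[of _ "e / (L2_norm w + 1)"] conjI ballI impI)
      fix g assume g: "g \<in> PW \<Omega>" and lt: "L2_norm (g - f) < e / (L2_norm w + 1)"
      have gf: "g - f \<in> L2" by (intro L2_diff PW_L2[OF g] PW_L2[OF fPW])
      have "norm (L2_inner g w - L2_inner f w) = norm (L2_inner (g - f) w)"
        using L2_inner_diff_left[OF PW_L2[OF g] PW_L2[OF fPW] w] by simp
      also have "\<dots> \<le> L2_norm (g - f) * L2_norm w" by (rule L2_Cauchy_Schwarz[OF gf w])
      also have "\<dots> \<le> L2_norm (g - f) * (L2_norm w + 1)" by (intro mult_left_mono) auto
      also have "\<dots> < e" using lt pos by (simp add: field_simps)
      finally have "L2_inner g w \<in> ball (L2_inner f w) e" by (simp add: dist_norm norm_minus_commute)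
      then show "g \<in> (\<lambda>f. L2_inner f w) -` S \<inter> space (PW_borel \<Omega>)"
        using e g by (auto simp: space_PW_borel)
    qed (use e pos in simp)
  qed (auto simp: space_PW_borel)
qed

text \<open>The map is norm continuous on the whole space because the character is continuous;
  preimages of generators are therefore open before they are cut down to \<Omega>.\<close>

lemma character_scale_measurable:
  fixes w :: "real^'n \<Rightarrow> complex"
  assumes \<Omega>: "\<Omega> \<in> sets borel" and w: "w \<in> PW \<Omega>"
  shows "(\<lambda>\<alpha>. L2_scale (character b \<alpha>) w) \<in> restrict_space lborel \<Omega> \<rightarrow>\<^sub>M PW_borel \<Omega>"
  unfolding PW_borel_def
proof (rule measurable_measure_of[OF PW_borel_generators])
  show "(\<lambda>\<alpha>. L2_scale (character b \<alpha>) w) \<in> space (restrict_space lborel \<Omega>) \<rightarrow> PW \<Omega>"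
    using PW_scale[OF w] by auto
next
  fix U assume "U \<in> {U. U \<subseteq> PW \<Omega> \<and> (\<forall>f\<in>U. \<exists>\<epsilon>>0. \<forall>g\<in>PW \<Omega>. L2_norm (g - f) < \<epsilon> \<longrightarrow> g \<in> U)}"
  then have U: "\<And>f. f \<in> U \<Longrightarrow> \<exists>\<epsilon>>0. \<forall>g\<in>PW \<Omega>. L2_norm (g - f) < \<epsilon> \<longrightarrow> g \<in> U" by blast
  have pos: "L2_norm w + 1 > 0" using L2_norm_nonneg[of w] by linarith
  have "open ((\<lambda>\<alpha>. L2_scale (character b \<alpha>) w) -` U)"
    unfolding open_dist
  proof
    fix \<alpha> assume "\<alpha> \<in> (\<lambda>\<alpha>. L2_scale (character b \<alpha>) w) -` U"
    then have "L2_scale (character b \<alpha>) w \<in> U" by simp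
    from U[OF this] obtain \<epsilon>
      where \<epsilon>: "\<epsilon> > 0" "\<And>g. g \<in> PW \<Omega> \<Longrightarrow> L2_norm (g - L2_scale (character b \<alpha>) w) < \<epsilon> \<Longrightarrow> g \<in> U"
      by blast
    have "isCont (character b) \<alpha>"
      unfolding character_def[abs_def] by (intro continuous_intros)
    then obtain d where d: "d > 0" "\<And>\<beta>. dist \<beta> \<alpha> < d \<Longrightarrow> dist (character b \<beta>) (character b \<alpha>) < \<epsilon> / (L2_norm w + 1)"
      using \<epsilon>(1) pos unfolding continuous_at_eps_delta by (metis divide_pos_pos)
    have "L2_scale (character b \<beta>) w \<in> U" if "dist \<beta> \<alpha> < d" for \<beta>
    proof (rule \<epsilon>(2)[OF PW_scale[OF w]])
      have "L2_scale (character b \<beta>) w - L2_scale (character b \<alpha>) w = L2_scale (character b \<beta> - character b \<alpha>) w"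
        by (simp add: L2_scale_def fun_eq_iff left_diff_distrib)
      then have "L2_norm (L2_scale (character b \<beta>) w - L2_scale (character b \<alpha>) w)
          = dist (character b \<beta>) (character b \<alpha>) * L2_norm w"
        by (simp add: L2_norm_scale dist_norm)
      also have "\<dots> \<le> dist (character b \<beta>) (character b \<alpha>) * (L2_norm w + 1)"
        by (intro mult_left_mono) auto
      also have "\<dots> < \<epsilon>" using d(2)[OF that] pos by (simp add: field_simps)
      finally show "L2_norm (L2_scale (character b \<beta>) w - L2_scale (character b \<alpha>) w) < \<epsilon>" .
    qed
    then show "\<exists>e>0. \<forall>y. dist y \<alpha> < e \<longrightarrow> y \<in> (\<lambda>\<alpha>. L2_scale (character b \<alpha>) w) -` U"
      using d(1) by (intro exI[of _ d]) simp
  qed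
  then have "(\<lambda>\<alpha>. L2_scale (character b \<alpha>) w) -` U \<in> sets borel" by simp
  then show "(\<lambda>\<alpha>. L2_scale (character b \<alpha>) w) -` U \<inter> space (restrict_space lborel \<Omega>)
      \<in> sets (restrict_space lborel \<Omega>)"
    using \<Omega> by (simp add: sets_restrict_space_iff space_restrict_space)
qed

section \<open>Inner products and finite sums of Gabor functions\<close>

lemma VL2_norm_eq:
  "ip_norm (VL2_inner \<Omega>) F = sqrt (LINT \<alpha>|lborel. indicator \<Omega> \<alpha> * (L2_norm (F \<alpha>))\<^sup>2)"
proof -
  have "VL2_inner \<Omega> F F = (LINT \<alpha>|lborel. complex_of_real (indicator \<Omega> \<alpha> * (L2_norm (F \<alpha>))\<^sup>2))"
    unfolding VL2_inner_def set_lebesgue_integral_def L2_inner_self_norm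
    by (intro Bochner_Integration.integral_cong refl) (simp add: scaleR_conv_of_real)
  also have "\<dots> = complex_of_real (LINT \<alpha>|lborel. indicator \<Omega> \<alpha> * (L2_norm (F \<alpha>))\<^sup>2)"
    by (rule integral_complex_of_real)
  finally show ?thesis by (simp add: ip_norm_def)
qed

lemma VL2_inner_gabor:
  "VL2_inner \<Omega> (gabor u a b) (gabor u a' b')
   = (LINT \<alpha>:\<Omega>|lborel. character b \<alpha> * cnj (character b' \<alpha>)) * L2_inner (translate a u) (translate a' u)"
proof -
  have "VL2_inner \<Omega> (gabor u a b) (gabor u a' b') = (LINT \<alpha>|lborel.
      (indicator \<Omega> \<alpha> *\<^sub>R (character b \<alpha> * cnj (character b' \<alpha>))) * L2_inner (translate a u) (translate a' u))"
    unfolding VL2_inner_def gabor_def L2_inner_scale_left L2_inner_scale_right set_lebesgue_integral_def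
    by (intro Bochner_Integration.integral_cong refl) (simp add: mult_ac)
  then show ?thesis by (simp only: integral_mult_left_zero set_lebesgue_integral_def)
qed

text \<open>At a fixed \<alpha> a Gabor sum is a combination of translates whose coefficients are
  trigonometric polynomials in \<alpha>. The index set is a \<open>Sigma\<close> so that each
  translate may have its own set of characters.\<close>

lemma gabor_sum:
  assumes "finite J" "\<And>a. a \<in> J \<Longrightarrow> finite (K a)"
  shows "(\<Sum>i\<in>Sigma J K. VL2_scale (c i) (case i of (a, b) \<Rightarrow> gabor u a b)) \<alpha>
       = (\<Sum>a\<in>J. L2_scale (\<Sum>b\<in>K a. c (a, b) * character b \<alpha>) (translate a u))"
proof
  fix x
  have "(\<Sum>i\<in>Sigma J K. VL2_scale (c i) (case i of (a, b) \<Rightarrow> gabor u a b)) \<alpha> x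
      = (\<Sum>i\<in>Sigma J K. VL2_scale (c i) (case i of (a, b) \<Rightarrow> gabor u a b) \<alpha> x)"
    by (simp only: sum_fun_apply)
  also have "\<dots> = (\<Sum>(a, b)\<in>Sigma J K. c (a, b) * character b \<alpha> * translate a u x)"
    by (intro sum.cong refl) (auto simp: VL2_scale_def gabor_def L2_scale_def)
  also have "\<dots> = (\<Sum>a\<in>J. \<Sum>b\<in>K a. c (a, b) * character b \<alpha> * translate a u x)"
    by (subst sum.Sigma) (use assms in auto)
  also have "\<dots> = (\<Sum>a\<in>J. L2_scale (\<Sum>b\<in>K a. c (a, b) * character b \<alpha>) (translate a u) x)"
    by (simp add: L2_scale_def sum_distrib_right)
  also have "\<dots> = (\<Sum>a\<in>J. L2_scale (\<Sum>b\<in>K a. c (a, b) * character b \<alpha>) (translate a u)) x"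
    by (simp only: sum_fun_apply)
  finally show "(\<Sum>i\<in>Sigma J K. VL2_scale (c i) (case i of (a, b) \<Rightarrow> gabor u a b)) \<alpha> x
      = (\<Sum>a\<in>J. L2_scale (\<Sum>b\<in>K a. c (a, b) * character b \<alpha>) (translate a u)) x" .
qed

text \<open>Separates the error of expanding \<open>F \<alpha>\<close> in the translates from the
  errors of approximating each coefficient by characters.\<close>

lemma gabor_distance:
  assumes J: "finite J" "\<And>a. a \<in> J \<Longrightarrow> finite (K a)" and u: "u \<in> L2"
    and on: "\<And>a b. a \<in> J \<Longrightarrow> b \<in> J \<Longrightarrow> L2_inner (translate a u) (translate b u) = (if a = b then 1 else 0)"
    and F: "F \<alpha> \<in> L2"
  shows "(L2_norm ((F - (\<Sum>i\<in>Sigma J K. VL2_scale (c i) (case i of (a, b) \<Rightarrow> gabor u a b))) \<alpha>))\<^sup>2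
       = (L2_norm (F \<alpha>))\<^sup>2 - (\<Sum>a\<in>J. (norm (L2_inner (F \<alpha>) (translate a u)))\<^sup>2)
         + (\<Sum>a\<in>J. (norm (L2_inner (F \<alpha>) (translate a u) - (\<Sum>b\<in>K a. c (a, b) * character b \<alpha>)))\<^sup>2)"
  by (subst minus_apply, subst gabor_sum[OF J])
     (auto intro: L2_norm_expansion[OF J(1) translate_L2[OF u] on F])

lemma const_VL2:
  assumes "\<Omega> \<in> sets borel" "emeasure lborel \<Omega> = 1" "f \<in> PW \<Omega>"
  shows "(\<lambda>_. f) \<in> VL2 \<Omega>"
  using assms by (auto simp: VL2_def space_PW_borel set_integrable_def intro!: integrable_mult_left)

lemma gabor_VL2:
  assumes "\<Omega> \<in> sets borel" "emeasure lborel \<Omega> = 1" "u \<in> PW \<Omega>"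
  shows "gabor u a b \<in> VL2 \<Omega>"
proof -
  have "L2_norm (gabor u a b \<alpha>) = L2_norm u" for \<alpha>
    by (simp add: gabor_def L2_norm_scale L2_norm_translate PW_L2[OF assms(3)])
  moreover have "gabor u a b \<in> restrict_space lborel \<Omega> \<rightarrow>\<^sub>M PW_borel \<Omega>"
    unfolding gabor_def by (intro character_scale_measurable PW_translate assms)
  ultimately show ?thesis
    using assms by (auto simp: VL2_def set_integrable_def intro!: integrable_mult_left)
qed

section \<open>From the Gabor system to the translates\<close>

lemma gabor_basis_imp_translation_basis:
  fixes \<Omega> A :: "(real^'n) set" and u :: "real^'n \<Rightarrow> complex"
  assumes \<Omega>[measurable]: "\<Omega> \<in> sets borel" and one: "emeasure lborel \<Omega> = 1" and u: "u \<in> PW \<Omega>"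
    and onb: "orthonormal_basis (VL2 \<Omega>) VL2_scale (VL2_inner \<Omega>) (A \<times> A) (\<lambda>(a, b). gabor u a b)"
  shows "orthonormal_basis (PW \<Omega>) L2_scale L2_inner A (\<lambda>a. translate a u)"
  unfolding orthonormal_basis_def
proof (intro conjI ballI allI impI)
  show "translate a u \<in> PW \<Omega>" for a by (rule PW_translate[OF u])
  show on: "L2_inner (translate a u) (translate b u) = (if a = b then 1 else 0)" if "a \<in> A" "b \<in> A" for a b
  proof -
    \<comment> \<open>The index pairs \<open>(a, a)\<close> and \<open>(b, a)\<close> share their
      frequency, so the integral over \<Omega> in \<open>VL2_inner_gabor\<close> equals the measure
      of \<Omega>.\<close>
    have "(LINT \<alpha>:\<Omega>|lborel. character a \<alpha> * cnj (character a \<alpha>)) = 1"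
      using one by (simp add: set_lebesgue_integral_def measure_def)
    then show ?thesis
      using orthonormal_basisD(2)[OF onb, of "(a, a)" "(b, a)"] that by (simp add: VL2_inner_gabor)
  qed
  fix f :: "real^'n \<Rightarrow> complex" and \<epsilon> :: real assume f: "f \<in> PW \<Omega>" and "\<epsilon> > 0"
  obtain M c where M: "finite M" "M \<subseteq> A \<times> A"
    and lt: "ip_norm (VL2_inner \<Omega>) ((\<lambda>_. f) - (\<Sum>i\<in>M. VL2_scale (c i) (case i of (a, b) \<Rightarrow> gabor u a b))) < \<epsilon>"
    using orthonormal_basisD(3)[OF onb const_VL2[OF \<Omega> one f] \<open>\<epsilon> > 0\<close>] by blast
  define J K where "J = fst ` M" and "K a = {b. (a, b) \<in> M}" for a
  have M_eq: "M = Sigma J K" by (force simp: J_def K_def)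
  have J: "finite J" "J \<subseteq> A" using M by (auto simp: J_def)
  have K: "finite (K a)" for a
    using finite_imageI[OF M(1), of snd] by (rule finite_subset[rotated]) (force simp: K_def)
  define p where "p a \<alpha> = (\<Sum>b\<in>K a. c (a, b) * character b \<alpha>)" for a \<alpha>
  define h where "h \<alpha> = f - (\<Sum>a\<in>J. L2_scale (p a \<alpha>) (translate a u))" for \<alpha>
  \<comment> \<open>The squared error in the form given by \<open>L2_norm_expansion\<close>, in
    which its measurability in \<alpha> is evident.\<close>
  define m where "m \<alpha> = (L2_norm f)\<^sup>2 - (\<Sum>a\<in>J. (norm (L2_inner f (translate a u)))\<^sup>2)
         + (\<Sum>a\<in>J. (norm (L2_inner f (translate a u) - p a \<alpha>))\<^sup>2)" for \<alpha>
  have m: "(L2_norm (h \<alpha>))\<^sup>2 = m \<alpha>" for \<alpha>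
    unfolding h_def m_def
    by (intro L2_norm_expansion translate_L2 PW_L2[OF f] PW_L2[OF u] on J(1)) (use J(2) in auto)
  have hM: "((\<lambda>_. f) - (\<Sum>i\<in>M. VL2_scale (c i) (case i of (a, b) \<Rightarrow> gabor u a b))) \<alpha> = h \<alpha>" for \<alpha>
    by (subst minus_apply, unfold M_eq, subst gabor_sum[OF J(1) K]) (simp_all only: h_def p_def)
  have [measurable]: "m \<in> borel_measurable borel"
    unfolding m_def[abs_def] p_def by measurable
  \<comment> \<open>A bound on \<open>m\<close> uniform in \<alpha>, since characters have modulus
    1; it makes \<open>m\<close> integrable over \<Omega>, as the averaging argument
    requires.\<close>
  define B where "B = (L2_norm f)\<^sup>2 + (\<Sum>a\<in>J. (norm (L2_inner f (translate a u)) + (\<Sum>b\<in>K a. norm (c (a, b))))\<^sup>2)"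
  have mB: "m \<alpha> \<le> B" for \<alpha>
  proof -
    have "norm (p a \<alpha>) \<le> (\<Sum>b\<in>K a. norm (c (a, b)))" for a
      unfolding p_def by (rule order_trans[OF norm_sum]) (simp add: norm_mult)
    then have "norm (L2_inner f (translate a u) - p a \<alpha>) \<le> norm (L2_inner f (translate a u)) + (\<Sum>b\<in>K a. norm (c (a, b)))" for a
      by (intro order_trans[OF norm_triangle_ineq4] add_left_mono)
    then have "(\<Sum>a\<in>J. (norm (L2_inner f (translate a u) - p a \<alpha>))\<^sup>2)
        \<le> (\<Sum>a\<in>J. (norm (L2_inner f (translate a u)) + (\<Sum>b\<in>K a. norm (c (a, b))))\<^sup>2)"
      by (intro sum_mono power_mono) auto
    moreover have "0 \<le> (\<Sum>a\<in>J. (norm (L2_inner f (translate a u)))\<^sup>2)" by (intro sum_nonneg) auto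
    ultimately show ?thesis unfolding m_def B_def by linarith
  qed
  have m0: "0 \<le> m \<alpha>" for \<alpha> unfolding m[symmetric] by simp
  have int: "integrable lborel (\<lambda>\<alpha>. indicator \<Omega> \<alpha> * m \<alpha>)"
    by (rule integrableI_bounded_set[where A = \<Omega> and B = B])
       (use one mB m0 in \<open>auto simp: indicator_def\<close>)
  have small: "(LINT \<alpha>|lborel. indicator \<Omega> \<alpha> * m \<alpha>) < \<epsilon>\<^sup>2"
  proof -
    have "sqrt (LINT \<alpha>|lborel. indicator \<Omega> \<alpha> * m \<alpha>) < \<epsilon>"
      using lt unfolding VL2_norm_eq hM m .
    also have "\<epsilon> = sqrt (\<epsilon>\<^sup>2)" using \<open>\<epsilon> > 0\<close> by simp
    finally show ?thesis by (simp only: real_sqrt_less_iff)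
  qed
  \<comment> \<open>Averaging over a set of measure 1. As \<open>m\<close> and \<open>h\<close> are
    defined for every \<alpha>, the point is sought in the whole space.\<close>
  have "\<exists>\<alpha>. m \<alpha> < \<epsilon>\<^sup>2"
  proof (rule ccontr)
    assume "\<nexists>\<alpha>. m \<alpha> < \<epsilon>\<^sup>2"
    then have "\<epsilon>\<^sup>2 \<le> m \<alpha>" for \<alpha> by (simp add: not_less)
    then have "(LINT \<alpha>|lborel. indicator \<Omega> \<alpha> * \<epsilon>\<^sup>2) \<le> (LINT \<alpha>|lborel. indicator \<Omega> \<alpha> * m \<alpha>)"
      using one by (intro integral_mono int integrable_mult_left) (auto intro!: mult_left_mono)
    moreover have "(LINT \<alpha>|lborel. indicator \<Omega> \<alpha> * \<epsilon>\<^sup>2) = \<epsilon>\<^sup>2"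
      using one by (simp add: measure_def)
    ultimately show False using small by linarith
  qed
  then obtain \<alpha> where "m \<alpha> < \<epsilon>\<^sup>2" by blast
  then have "L2_norm (h \<alpha>) < \<epsilon>"
    unfolding m[symmetric] using \<open>\<epsilon> > 0\<close> by (intro power2_less_imp_less[of _ \<epsilon>]) auto
  then show "\<exists>J c. finite J \<and> J \<subseteq> A \<and> L2_norm (f - (\<Sum>i\<in>J. L2_scale (c i) (translate i u))) < \<epsilon>"
    using J unfolding h_def by (intro exI[of _ J] exI[of _ "\<lambda>a. p a \<alpha>"]) simp
qed

section \<open>From the translates to the Gabor system\<close>

context translation_basis
begin

lemma translate_orthonormal:
  "a \<in> A \<Longrightarrow> b \<in> A \<Longrightarrow> L2_inner (translate a u) (translate b u) = (if a = b then 1 else 0)"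
  by (rule orthonormal_basisD(2)[OF onb])

lemma VL2_PW: "F \<in> VL2 \<Omega> \<Longrightarrow> \<alpha> \<in> \<Omega> \<Longrightarrow> F \<alpha> \<in> PW \<Omega>"
  using measurable_space[of F "restrict_space lborel \<Omega>" "PW_borel \<Omega>" \<alpha>]
  by (auto simp: VL2_def space_PW_borel space_restrict_space)

lemma VL2_integrable: "F \<in> VL2 \<Omega> \<Longrightarrow> integrable lborel (\<lambda>\<alpha>. indicator \<Omega> \<alpha> * (L2_norm (F \<alpha>))\<^sup>2)"
  by (simp add: VL2_def set_integrable_def)

text \<open>Measurability comes from composing \<open>F\<close> with a Borel functional, square
  integrability from Bessel's inequality for a single translate.\<close>

lemma VL2_coefficient_L2:
  assumes F: "F \<in> VL2 \<Omega>" and a: "a \<in> A"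
  shows "(\<lambda>\<alpha>. indicator \<Omega> \<alpha> * L2_inner (F \<alpha>) (translate a u)) \<in> L2"
proof -
  have "F \<in> restrict_space lborel \<Omega> \<rightarrow>\<^sub>M PW_borel \<Omega>" using F by (simp add: VL2_def)
  then have "(\<lambda>\<alpha>. L2_inner (F \<alpha>) (translate a u)) \<in> borel_measurable (restrict_space lborel \<Omega>)"
    by (rule measurable_compose[OF _ L2_inner_PW_borel_measurable[OF translate_L2[OF u_L2]]])
  then have "(\<lambda>\<alpha>. indicator \<Omega> \<alpha> *\<^sub>R L2_inner (F \<alpha>) (translate a u)) \<in> borel_measurable lborel"
    by (subst (asm) borel_measurable_restrict_space_iff) auto
  also have "(\<lambda>\<alpha>. indicator \<Omega> \<alpha> *\<^sub>R L2_inner (F \<alpha>) (translate a u))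
      = (\<lambda>\<alpha>. indicator \<Omega> \<alpha> * L2_inner (F \<alpha>) (translate a u))"
    by (auto simp: indicator_def)
  finally have [measurable]: "(\<lambda>\<alpha>. indicator \<Omega> \<alpha> * L2_inner (F \<alpha>) (translate a u)) \<in> borel_measurable borel"
    by simp
  have "integrable lborel (\<lambda>\<alpha>. (norm (indicator \<Omega> \<alpha> * L2_inner (F \<alpha>) (translate a u)))\<^sup>2)"
  proof (rule Bochner_Integration.integrable_bound[OF VL2_integrable[OF F]])
    show "AE \<alpha> in lborel. norm ((norm (indicator \<Omega> \<alpha> * L2_inner (F \<alpha>) (translate a u)))\<^sup>2)
        \<le> norm (indicator \<Omega> \<alpha> * (L2_norm (F \<alpha>))\<^sup>2)"
    proof (rule AE_I2)
      fix \<alpha>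
      show "norm ((norm (indicator \<Omega> \<alpha> * L2_inner (F \<alpha>) (translate a u)))\<^sup>2)
        \<le> norm (indicator \<Omega> \<alpha> * (L2_norm (F \<alpha>))\<^sup>2)"
        using Bessel[of "{a}" "\<lambda>a. translate a u" "F \<alpha>"] PW_L2[OF VL2_PW[OF F]] a
        by (cases "\<alpha> \<in> \<Omega>") (auto simp: translate_L2 u_L2 translate_orthonormal)
    qed
  qed measurable
  then show ?thesis by (simp add: L2_iff)
qed

text \<open>For \<alpha> in \<Omega>, \<open>R J \<alpha>\<close> is the squared distance of
  \<open>F \<alpha>\<close> from the span of the translates in \<open>J\<close>; it tends to 0 along
  finite sets exhausting \<open>A\<close> and is dominated by the squared norm of
  \<open>F \<alpha>\<close>. Countability of \<open>A\<close> provides the exhausting sequence along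
  which dominated convergence runs.\<close>

lemma translation_expansion_converges:
  assumes A: "countable A" and F: "F \<in> VL2 \<Omega>" and "\<epsilon> > 0"
  defines "R J \<alpha> \<equiv> indicator \<Omega> \<alpha> * ((L2_norm (F \<alpha>))\<^sup>2 - (\<Sum>a\<in>J. (norm (L2_inner (F \<alpha>) (translate a u)))\<^sup>2))"
  obtains J where "finite J" "J \<subseteq> A" "integrable lborel (R J)" "(LINT \<alpha>|lborel. R J \<alpha>) < \<epsilon>"
proof -
  obtain S :: "nat \<Rightarrow> (real^'n) set" where S: "\<And>n. finite (S n)" "\<And>n. S n \<subseteq> A" "incseq S" "(\<Union>n. S n) = A"
  proof (cases "A = {}")
    case False
    have "(\<Union>n. from_nat_into A ` {..<n}) = range (from_nat_into A)"
      by (simp only: image_UN[symmetric] UN_lessThan_UNIV)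
    then have "(\<Union>n. from_nat_into A ` {..<n}) = A"
      by (simp only: range_from_nat_into[OF False A])
    moreover have "incseq (\<lambda>n. from_nat_into A ` {..<n})"
      unfolding incseq_def by (intro allI impI image_mono) auto
    ultimately show thesis
      using from_nat_into[OF False] by (intro that[of "\<lambda>n. from_nat_into A ` {..<n}"]) auto
  next
    case True
    then show thesis by (intro that[of "\<lambda>_. {}"]) (auto simp: incseq_def)
  qed
  have int: "integrable lborel (R J)" if "finite J" "J \<subseteq> A" for J
  proof -
    have "integrable lborel (\<lambda>\<alpha>. indicator \<Omega> \<alpha> * (L2_norm (F \<alpha>))\<^sup>2
        - (\<Sum>a\<in>J. (norm (indicator \<Omega> \<alpha> * L2_inner (F \<alpha>) (translate a u)))\<^sup>2))"
      using VL2_coefficient_L2[OF F] that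
      by (intro Bochner_Integration.integrable_diff Bochner_Integration.integrable_sum VL2_integrable[OF F] L2_integrable) auto
    also have "(\<lambda>\<alpha>. indicator \<Omega> \<alpha> * (L2_norm (F \<alpha>))\<^sup>2
        - (\<Sum>a\<in>J. (norm (indicator \<Omega> \<alpha> * L2_inner (F \<alpha>) (translate a u)))\<^sup>2)) = R J"
      by (auto simp: R_def fun_eq_iff indicator_def)
    finally show ?thesis .
  qed
  have bound: "0 \<le> R J \<alpha>" "R J \<alpha> \<le> indicator \<Omega> \<alpha> * (L2_norm (F \<alpha>))\<^sup>2" if "finite J" "J \<subseteq> A" for J \<alpha>
  proof -
    show "0 \<le> R J \<alpha>"
      using Bessel[of J "\<lambda>a. translate a u" "F \<alpha>"] PW_L2[OF VL2_PW[OF F]] that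
      by (cases "\<alpha> \<in> \<Omega>") (auto simp: R_def translate_L2 u_L2 translate_orthonormal subset_iff)
    show "R J \<alpha> \<le> indicator \<Omega> \<alpha> * (L2_norm (F \<alpha>))\<^sup>2"
      by (auto simp: R_def intro!: mult_left_mono sum_nonneg)
  qed
  have "(\<lambda>n. LINT \<alpha>|lborel. R (S n) \<alpha>) \<longlonglongrightarrow> integral\<^sup>L lborel (\<lambda>\<alpha> :: real^'n. 0 :: real)"
  proof (rule integral_dominated_convergence[OF _ _ VL2_integrable[OF F]])
    show "R (S n) \<in> borel_measurable lborel" for n using int[OF S(1,2), of n] by auto
    show "AE \<alpha> in lborel. norm (R (S n) \<alpha>) \<le> indicator \<Omega> \<alpha> * (L2_norm (F \<alpha>))\<^sup>2" for n
      using bound[OF S(1,2)] by simp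
    show "AE \<alpha> in lborel. (\<lambda>n. R (S n) \<alpha>) \<longlonglongrightarrow> 0"
    proof (rule AE_I2)
      fix \<alpha>
      show "(\<lambda>n. R (S n) \<alpha>) \<longlonglongrightarrow> 0"
      proof (cases "\<alpha> \<in> \<Omega>")
        case True
        show ?thesis
        proof (rule LIMSEQ_I)
          fix r :: real assume "r > 0"
          obtain J where J: "finite J" "J \<subseteq> A"
            and lt: "(L2_norm (F \<alpha>))\<^sup>2 - (\<Sum>a\<in>J. (norm (L2_inner (F \<alpha>) (translate a u)))\<^sup>2) < r"
            using orthonormal_basis_approx[OF onb PW_subset_L2 VL2_PW[OF F True] \<open>r > 0\<close>] .
          have "\<forall>a\<in>J. \<exists>k. a \<in> S k" using J(2) S(4) by blast
          then obtain k where k: "\<And>a. a \<in> J \<Longrightarrow> a \<in> S (k a)" by metis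
          \<comment> \<open>\<open>sum k J\<close> serves as an index at least as large as every
            \<open>k a\<close> with \<open>a\<close> in \<open>J\<close>.\<close>
          have N: "J \<subseteq> S (sum k J)"
          proof
            fix a assume "a \<in> J"
            then have "S (k a) \<subseteq> S (sum k J)"
              using S(3) member_le_sum[of a J k] J(1) by (auto simp: incseq_def)
            then show "a \<in> S (sum k J)" using k[OF \<open>a \<in> J\<close>] by blast
          qed
          have "norm (R (S n) \<alpha> - 0) < r" if "n \<ge> sum k J" for n
          proof -
            have "J \<subseteq> S n" using N S(3) that by (auto simp: incseq_def)
            then have "(\<Sum>a\<in>J. (norm (L2_inner (F \<alpha>) (translate a u)))\<^sup>2)
                \<le> (\<Sum>a\<in>S n. (norm (L2_inner (F \<alpha>) (translate a u)))\<^sup>2)"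
              using S(1) by (intro sum_mono2) auto
            then have "R (S n) \<alpha> < r" using lt True by (simp add: R_def)
            then show ?thesis using bound(1)[OF S(1,2)] by simp
          qed
          then show "\<exists>no. \<forall>n\<ge>no. norm (R (S n) \<alpha> - 0) < r" by blast
        qed
      qed (simp add: R_def)
    qed
  qed simp
  from LIMSEQ_D[OF this \<open>\<epsilon> > 0\<close>] obtain n where "norm ((LINT \<alpha>|lborel. R (S n) \<alpha>) - 0) < \<epsilon>"
    by auto
  then have "(LINT \<alpha>|lborel. R (S n) \<alpha>) < \<epsilon>" by simp
  then show thesis using that[OF S(1,2) int[OF S(1,2)]] by blast
qed

text \<open>Two stages: finitely many translates leave an integrated remainder below
  \<open>\<epsilon>\<^sup>2 / 2\<close>, then the coefficient function of each chosen translate is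
  approximated over \<Omega> by its own finite combination of characters.\<close>

lemma gabor_total:
  assumes A: "countable A" and F: "F \<in> VL2 \<Omega>" and "\<epsilon> > 0"
  shows "\<exists>M c. finite M \<and> M \<subseteq> A \<times> A \<and>
    ip_norm (VL2_inner \<Omega>) (F - (\<Sum>i\<in>M. VL2_scale (c i) (case i of (a, b) \<Rightarrow> gabor u a b))) < \<epsilon>"
proof -
  let ?F = "\<lambda>a \<alpha>. L2_inner (F \<alpha>) (translate a u)"
  define R where "R J \<alpha> = indicator \<Omega> \<alpha> * ((L2_norm (F \<alpha>))\<^sup>2 - (\<Sum>a\<in>J. (norm (?F a \<alpha>))\<^sup>2))" for J \<alpha>
  have "\<epsilon>\<^sup>2 / 2 > 0" using \<open>\<epsilon> > 0\<close> by simp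
  obtain J where J: "finite J" "J \<subseteq> A" and Rint: "integrable lborel (R J)" and R: "(LINT \<alpha>|lborel. R J \<alpha>) < \<epsilon>\<^sup>2 / 2"
    by (rule translation_expansion_converges[OF A F \<open>\<epsilon>\<^sup>2 / 2 > 0\<close>]) (rule that; simp only: R_def[abs_def])
  \<comment> \<open>The \<open>card J\<close> coefficient errors together take at most the other
    half of \<open>\<epsilon>\<^sup>2\<close>; the added 1 covers empty \<open>J\<close>.\<close>
  define \<delta> where "\<delta> = \<epsilon>\<^sup>2 / (2 * (real (card J) + 1))"
  have \<delta>: "\<delta> > 0" using \<open>\<epsilon> > 0\<close> by (simp add: \<delta>_def add_nonneg_pos)
  define D where "D a K c \<alpha> = indicator \<Omega> \<alpha> * (norm (?F a \<alpha> - (\<Sum>b\<in>K. c b * character b \<alpha>)))\<^sup>2" for a K c \<alpha>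
  define P where "P a K c \<longleftrightarrow> finite K \<and> K \<subseteq> A \<and> integrable lborel (D a K c) \<and> (LINT \<alpha>|lborel. D a K c \<alpha>) < \<delta>" for a K c
  have "\<exists>K c. P a K c" if "a \<in> J" for a
  proof -
    have g: "(\<lambda>\<alpha>. indicator \<Omega> \<alpha> * ?F a \<alpha>) \<in> L2" using VL2_coefficient_L2[OF F] that J by blast
    obtain K c where K: "finite K" "K \<subseteq> A"
      and *: "integrable lborel (\<lambda>\<alpha>. indicator \<Omega> \<alpha> * (norm (indicator \<Omega> \<alpha> * ?F a \<alpha> - (\<Sum>b\<in>K. c b * character b \<alpha>)))\<^sup>2)"
        "(LINT \<alpha>|lborel. indicator \<Omega> \<alpha> * (norm (indicator \<Omega> \<alpha> * ?F a \<alpha> - (\<Sum>b\<in>K. c b * character b \<alpha>)))\<^sup>2) < \<delta>"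
    proof (rule character_total[OF g _ \<delta>])
      show "indicator \<Omega> x * ?F a x = 0" if "x \<notin> \<Omega>" for x using that by simp
    qed (rule that)
    have "(\<lambda>\<alpha>. indicator \<Omega> \<alpha> * (norm (indicator \<Omega> \<alpha> * ?F a \<alpha> - (\<Sum>b\<in>K. c b * character b \<alpha>)))\<^sup>2) = D a K c"
      by (auto simp: D_def fun_eq_iff indicator_def)
    with * K have "P a K c" unfolding P_def by (simp only: simp_thms)
    then show ?thesis by blast
  qed
  then obtain K c where "\<And>a. a \<in> J \<Longrightarrow> P a (K a) (c a)"
    by metis
  then have K: "\<And>a. a \<in> J \<Longrightarrow> finite (K a)" "\<And>a. a \<in> J \<Longrightarrow> K a \<subseteq> A"
    and Dint: "\<And>a. a \<in> J \<Longrightarrow> integrable lborel (D a (K a) (c a))"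
    and D: "\<And>a. a \<in> J \<Longrightarrow> (LINT \<alpha>|lborel. D a (K a) (c a) \<alpha>) < \<delta>"
    by (simp_all add: P_def)
  define M where "M = Sigma J K"
  define c' where "c' i = c (fst i) (snd i)" for i
  let ?H = "F - (\<Sum>i\<in>M. VL2_scale (c' i) (case i of (a, b) \<Rightarrow> gabor u a b))"
  have "indicator \<Omega> \<alpha> * (L2_norm (?H \<alpha>))\<^sup>2 = R J \<alpha> + (\<Sum>a\<in>J. D a (K a) (c a) \<alpha>)" for \<alpha>
  proof (cases "\<alpha> \<in> \<Omega>")
    case True
    have "(L2_norm (?H \<alpha>))\<^sup>2 = (L2_norm (F \<alpha>))\<^sup>2 - (\<Sum>a\<in>J. (norm (?F a \<alpha>))\<^sup>2)
         + (\<Sum>a\<in>J. (norm (?F a \<alpha> - (\<Sum>b\<in>K a. c' (a, b) * character b \<alpha>)))\<^sup>2)"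
      unfolding M_def
      by (intro gabor_distance K u_L2 PW_L2[OF VL2_PW[OF F True]] translate_orthonormal J(1)) (use J(2) in auto)
    then show ?thesis using True by (simp add: R_def D_def c'_def)
  qed (simp add: R_def D_def)
  then have "(LINT \<alpha>|lborel. indicator \<Omega> \<alpha> * (L2_norm (?H \<alpha>))\<^sup>2)
      = (LINT \<alpha>|lborel. R J \<alpha>) + (\<Sum>a\<in>J. LINT \<alpha>|lborel. D a (K a) (c a) \<alpha>)"
    by (simp only: Bochner_Integration.integral_add Bochner_Integration.integral_sum
        Bochner_Integration.integrable_sum Rint Dint)
  also have "\<dots> < \<epsilon>\<^sup>2 / 2 + \<epsilon>\<^sup>2 / 2"
  proof -
    have "(\<Sum>a\<in>J. LINT \<alpha>|lborel. D a (K a) (c a) \<alpha>) \<le> (\<Sum>a\<in>J. \<delta>)"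
      using D by (intro sum_mono less_imp_le)
    also have "\<dots> = real (card J) * \<delta>" by simp
    also have "\<dots> \<le> \<epsilon>\<^sup>2 / 2" by (simp add: \<delta>_def field_simps add_nonneg_pos)
    finally show ?thesis using R by linarith
  qed
  finally have "(LINT \<alpha>|lborel. indicator \<Omega> \<alpha> * (L2_norm (?H \<alpha>))\<^sup>2) < \<epsilon>\<^sup>2" by simp
  then have "ip_norm (VL2_inner \<Omega>) ?H < \<epsilon>"
    unfolding VL2_norm_eq using \<open>\<epsilon> > 0\<close> by (intro real_less_lsqrt) auto
  moreover have "finite M" "M \<subseteq> A \<times> A" using J K by (auto simp: M_def)
  ultimately show ?thesis by blast
qed

lemma gabor_basis:
  assumes "countable A"
  shows "orthonormal_basis (VL2 \<Omega>) VL2_scale (VL2_inner \<Omega>) (A \<times> A) (\<lambda>(a, b). gabor u a b)"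
  unfolding orthonormal_basis_def
proof (intro conjI ballI allI impI)
  show "(case i of (a, b) \<Rightarrow> gabor u a b) \<in> VL2 \<Omega>" for i
    using gabor_VL2[OF borel_\<Omega> measure_\<Omega> u_PW] by (cases i) simp
  show "VL2_inner \<Omega> (case i of (a, b) \<Rightarrow> gabor u a b) (case j of (a, b) \<Rightarrow> gabor u a b) = (if i = j then 1 else 0)"
    if "i \<in> A \<times> A" "j \<in> A \<times> A" for i j
    using that by (cases i; cases j) (auto simp: VL2_inner_gabor character_orthonormal translate_orthonormal)
qed (rule gabor_total[OF assms])

end

theorem theorem4p3:
  fixes \<Omega> A :: "(real^'n) set" and u :: "real^'n \<Rightarrow> complex"
  assumes "\<Omega> \<in> sets borel" and "emeasure lborel \<Omega> = 1"
    and "countable A"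
    and "u \<in> PW \<Omega>"
    and "AE \<xi> in lborel. \<xi> \<in> \<Omega> \<longrightarrow> fourier u \<xi> \<noteq> 0"
  shows "orthonormal_basis (PW \<Omega>) L2_scale L2_inner A (\<lambda>a. translate a u) \<longleftrightarrow>
         orthonormal_basis (VL2 \<Omega>) VL2_scale (VL2_inner \<Omega>) (A \<times> A) (\<lambda>(a, b). gabor u a b)"
proof
  assume "orthonormal_basis (PW \<Omega>) L2_scale L2_inner A (\<lambda>a. translate a u)"
  then interpret translation_basis \<Omega> A u
    using assms by unfold_locales
  show "orthonormal_basis (VL2 \<Omega>) VL2_scale (VL2_inner \<Omega>) (A \<times> A) (\<lambda>(a, b). gabor u a b)"
    by (rule gabor_basis[OF assms(3)])
qed (rule gabor_basis_imp_translation_basis[OF assms(1,2,4)])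

end
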